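(* Suppose that the Taylor complex $\tilde K$ of $\mathcal A$ is a resolution of $S/I$. Then there is a canonical $k$-algebra isomorphism $$\operatorname{Tor}^S_*(S/I,k)\to H_*(\Delta(D)),$$ where the algebra structure on the right-hand side is induced by the DGA structure on $\Delta(D)$ described in the context.
   Context: Let $k$ be a field, $S=k[x_1,\dots,x_n]$, and let $\mathcal A=\{Q_1,\dots,Q_m\}\subset S$ be a finite set of nonconstant homogeneous polynomials, linearly ordered by index, minimally generating an ideal $I$ (so no $Q_i$ divides another). Let $E$ be the set of all irreducible factors in $S$ of the elements of $\mathcal A$, one chosen from each class of associates, $r=|E|$, with a fixed linear order. Least common multiples are normalized to be products of elements of $E$. For $\sigma\subset\mathcal A$ let $Q_\sigma$ be the least common multiple of the elements of $\sigma$, $Q_\emptyset=1$. Let $D=\{Q_\sigma:\sigma\subset\mathcal A\}$, a lattice under divisibility with join the lcm; its atoms are the elements $Q_1,\dots,Q_m$ (up to scalars). $\operatorname{Tor}^S_*(S/I,k)$, with $k=S/(x_1,\dots,x_n)$, carries its usual graded algebra structure. Taylor complex: $\tilde K_p$ is the free $S$-module with basis $\{\tau\subset\mathcal A: |\tau|=p\}$, and $\tilde d_p(\tau)=\sum_{Q_i\in\tau}(-1)^{\epsilon(\tau,i)}\frac{Q_\tau}{Q_{\tau_i}}\,\tau_i$, where $\tau_i=\tau\setminus\{Q_i\}$ and $\epsilon(\tau,i)=|\{Q_j\in\tau: j<i\}|$. One has $H_0(\tilde K)=S/I$. The DGA $\Delta(D)$ over $k$: $\Delta(D)_p$ is the $k$-space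 with basis the subsets $\sigma\subset\mathcal A$ with $|\sigma|=p$; the differential is $d\sigma=\sum_{Q_i\in\sigma,\ Q_{\sigma_i}=Q_\sigma}(-1)^{\epsilon(\sigma,i)}\sigma_i$. Let $\operatorname{rk}:D\to\mathbb N^r$ assign to $Q\in D$ the vector of multiplicities of the elements of $E$ in the factorization of $Q$. The bilinear product is $\sigma\cdot\tau=0$ if $\operatorname{rk}(Q_{\sigma\cup\tau})\ne\operatorname{rk}(Q_\sigma)+\operatorname{rk}(Q_\tau)$, and $\sigma\cdot\tau=(-1)^{\epsilon(\sigma,\tau)}\sigma\cup\tau$ otherwise, where $\epsilon(\sigma,\tau)$ is the parity of the permutation of $\sigma\cup\tau$ putting all elements of $\tau$ after the elements of $\sigma$ and preserving the orders inside these sets. *)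

theory Defs
  imports
    Complex_Main
    "HOL-Library.Poly_Mapping"
    "HOL-Library.Set_Algebras"
    "HOL-Combinatorics.Permutations"
    "HOL-Computational_Algebra.Factorial_Ring"
begin

section \<open>Polynomials and free modules\<close>

text \<open>
  The polynomial ring over a field \<open>'k\<close> in the variables indexed by a finite ordered type \<open>'x\<close>:
  finitely supported functions from exponent vectors to coefficients, with convolution as product.
  The same type constructor serves for free modules: \<open>'b \<Rightarrow>\<^sub>0 'r\<close> is the free \<open>'r\<close>-module on \<open>'b\<close>,
  and \<open>'b \<Rightarrow>\<^sub>0 int\<close> the free abelian group.
\<close>

type_synonym ('x, 'k) mpol = "('x \<Rightarrow>\<^sub>0 nat) \<Rightarrow>\<^sub>0 'k"

abbreviation lookup :: "('a \<Rightarrow>\<^sub>0 'b::zero) \<Rightarrow> 'a \<Rightarrow> 'b"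
  where "lookup \<equiv> Poly_Mapping.lookup"

abbreviation keys :: "('a \<Rightarrow>\<^sub>0 'b::zero) \<Rightarrow> 'a set"
  where "keys \<equiv> Poly_Mapping.keys"

definition homogeneous :: "('x::finite, 'k::zero) mpol \<Rightarrow> bool"
  where "homogeneous P \<longleftrightarrow> (\<exists>n. \<forall>t\<in>keys P. (\<Sum>x\<in>UNIV. lookup t x) = n)"

definition constant_poly :: "('x, 'k::zero) mpol \<Rightarrow> bool"
  where "constant_poly P \<longleftrightarrow> (\<exists>c. P = Poly_Mapping.single 0 c)"

definition const_coeff :: "('x, 'k::zero) mpol \<Rightarrow> 'k"
  where "const_coeff P = lookup P 0"

definition ideal_gen :: "'r::comm_ring_1 set \<Rightarrow> 'r set"
  where "ideal_gen B = module.span (*) B"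

definition pm_scale :: "'r \<Rightarrow> ('b \<Rightarrow>\<^sub>0 'r) \<Rightarrow> ('b \<Rightarrow>\<^sub>0 'r::semiring_0)"
  where "pm_scale r = Poly_Mapping.map ((*) r)"

definition on_basis :: "('b \<Rightarrow> ('b \<Rightarrow>\<^sub>0 'r)) \<Rightarrow> ('b \<Rightarrow>\<^sub>0 'r) \<Rightarrow> ('b \<Rightarrow>\<^sub>0 'r::semiring_0)"
  where "on_basis f v = (\<Sum>b\<in>keys v. pm_scale (lookup v b) (f b))"


section \<open>Free resolutions of a cyclic module\<close>

text \<open>
  Modules are submodules \<open>M\<close> of an ambient type with a scalar multiplication \<open>s\<close> satisfying the
  library locale \<^locale>\<open>module\<close>. All terms of a complex lie in one ambient type, which is
  no restriction (pass to the direct sum).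
\<close>

definition linear_map_on ::
  "('r \<Rightarrow> 'a \<Rightarrow> 'a) \<Rightarrow> ('r \<Rightarrow> 'b \<Rightarrow> 'b) \<Rightarrow> 'a::plus set \<Rightarrow> 'b::plus set \<Rightarrow> ('a \<Rightarrow> 'b) \<Rightarrow> bool"
  where "linear_map_on s s' M N f \<longleftrightarrow>
    (\<forall>x\<in>M. f x \<in> N) \<and>
    (\<forall>x\<in>M. \<forall>y\<in>M. f (x + y) = f x + f y) \<and>
    (\<forall>r. \<forall>x\<in>M. f (s r x) = s' r (f x))"

definition free_on :: "('r::comm_ring_1 \<Rightarrow> 'm \<Rightarrow> 'm) \<Rightarrow> 'm::ab_group_add set \<Rightarrow> bool"
  where "free_on s M \<longleftrightarrow> (\<exists>B. \<not> module.dependent s B \<and> module.span s B = M)"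

text \<open>
  A free resolution \<open>\<dots> \<rightarrow> F 1 \<rightarrow> F 0 \<rightarrow> R/I \<rightarrow> 0\<close>. The differential is \<open>d p : F p \<rightarrow> F (p - 1)\<close>,
  with \<open>d 0 = 0\<close>. The elements of \<open>R/I\<close> are the cosets \<open>a +o I\<close>, and the augmentation \<open>\<epsilon>\<close> takes
  values in them.
\<close>

definition free_resolution ::
  "('r::comm_ring_1 \<Rightarrow> 'm \<Rightarrow> 'm) \<Rightarrow> (nat \<Rightarrow> 'm::ab_group_add set) \<Rightarrow> (nat \<Rightarrow> 'm \<Rightarrow> 'm)
    \<Rightarrow> ('m \<Rightarrow> 'r set) \<Rightarrow> 'r set \<Rightarrow> bool"
  where "free_resolution s F d \<epsilon> I \<longleftrightarrow>
    module s \<and>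
    (\<forall>p. free_on s (F p)) \<and>
    (\<forall>p. linear_map_on s s (F (Suc p)) (F p) (d (Suc p))) \<and>
    (\<forall>x\<in>F 0. d 0 x = 0) \<and>
    (\<forall>p. {x \<in> F (Suc p). d (Suc p) x = 0} = d (Suc (Suc p)) ` F (Suc (Suc p))) \<and>
    \<epsilon> ` F 0 = {a +o I | a. True} \<and>
    (\<forall>x\<in>F 0. \<forall>y\<in>F 0. \<forall>a b. \<epsilon> x = a +o I \<longrightarrow> \<epsilon> y = b +o I \<longrightarrow> \<epsilon> (x + y) = (a + b) +o I) \<and>
    (\<forall>x\<in>F 0. \<forall>r a. \<epsilon> x = a +o I \<longrightarrow> \<epsilon> (s r x) = (r * a) +o I) \<and>
    {x \<in> F 0. \<epsilon> x = I} = d 1 ` F 1"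

text \<open>
  A chain map \<open>F \<otimes> F \<rightarrow> F\<close> over the multiplication \<open>R/I \<otimes> R/I \<rightarrow> R/I\<close>, given by its bilinear
  components \<open>\<mu> p q : F p \<times> F q \<rightarrow> F (p + q)\<close>. In the Leibniz rule, the truncated index \<open>p - 1\<close>
  for \<open>p = 0\<close> is harmless since then \<open>d p x = 0\<close>.
\<close>

definition lifts_multiplication ::
  "('r::comm_ring_1 \<Rightarrow> 'm \<Rightarrow> 'm) \<Rightarrow> (nat \<Rightarrow> 'm::ab_group_add set) \<Rightarrow> (nat \<Rightarrow> 'm \<Rightarrow> 'm)
    \<Rightarrow> ('m \<Rightarrow> 'r set) \<Rightarrow> 'r set \<Rightarrow> (nat \<Rightarrow> nat \<Rightarrow> 'm \<Rightarrow> 'm \<Rightarrow> 'm) \<Rightarrow> bool"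
  where "lifts_multiplication s F d \<epsilon> I \<mu> \<longleftrightarrow>
    (\<forall>p q. \<forall>x\<in>F p. linear_map_on s s (F q) (F (p + q)) (\<lambda>y. \<mu> p q x y)) \<and>
    (\<forall>p q. \<forall>y\<in>F q. linear_map_on s s (F p) (F (p + q)) (\<lambda>x. \<mu> p q x y)) \<and>
    (\<forall>p q. \<forall>x\<in>F p. \<forall>y\<in>F q.
       d (p + q) (\<mu> p q x y) = \<mu> (p - 1) q (d p x) y + s ((- 1) ^ p) (\<mu> p (q - 1) x (d q y))) \<and>
    (\<forall>x\<in>F 0. \<forall>y\<in>F 0. \<forall>a b.
       \<epsilon> x = a +o I \<longrightarrow> \<epsilon> y = b +o I \<longrightarrow> \<epsilon> (\<mu> 0 0 x y) = (a * b) +o I)"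

definition comparison_map ::
  "('r \<Rightarrow> 'm \<Rightarrow> 'm) \<Rightarrow> (nat \<Rightarrow> 'm::plus set) \<Rightarrow> (nat \<Rightarrow> 'm \<Rightarrow> 'm) \<Rightarrow> ('m \<Rightarrow> 'r set)
    \<Rightarrow> ('r \<Rightarrow> 'n \<Rightarrow> 'n) \<Rightarrow> (nat \<Rightarrow> 'n::plus set) \<Rightarrow> (nat \<Rightarrow> 'n \<Rightarrow> 'n) \<Rightarrow> ('n \<Rightarrow> 'r set)
    \<Rightarrow> (nat \<Rightarrow> 'm \<Rightarrow> 'n) \<Rightarrow> bool"
  where "comparison_map s F d \<epsilon> s' F' d' \<epsilon>' \<phi> \<longleftrightarrow>
    (\<forall>p. linear_map_on s s' (F p) (F' p) (\<phi> p)) \<and>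
    (\<forall>p. \<forall>x\<in>F (Suc p). \<phi> p (d (Suc p) x) = d' (Suc p) (\<phi> (Suc p) x)) \<and>
    (\<forall>x\<in>F 0. \<epsilon>' (\<phi> 0 x) = \<epsilon> x)"


section \<open>Homology algebras\<close>

text \<open>
  Data for a graded algebra with differential over \<open>'k\<close>, given degreewise as a quotient: the term
  of degree \<open>p\<close> is the abelian group \<open>car p / rel p\<close>, and the operations are given on
  representatives. An element of the homology is recorded as its full preimage in \<open>car p\<close>,
  that is, as a coset of \<open>d (car (p + 1)) + rel p\<close>.
\<close>

record ('k, 'a) dga =
  car :: "nat \<Rightarrow> 'a set"
  rel :: "nat \<Rightarrow> 'a set"
  diff :: "nat \<Rightarrow> 'a \<Rightarrow> 'a"
  scal :: "'k \<Rightarrow> 'a \<Rightarrow> 'a"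
  mult :: "nat \<Rightarrow> nat \<Rightarrow> 'a \<Rightarrow> 'a \<Rightarrow> 'a"
  unit :: "'a"

definition cycles :: "('k, 'a) dga \<Rightarrow> nat \<Rightarrow> 'a set"
  where "cycles X p = {z \<in> car X p. p = 0 \<or> diff X p z \<in> rel X (p - 1)}"

definition boundaries :: "('k, 'a::plus) dga \<Rightarrow> nat \<Rightarrow> 'a set"
  where "boundaries X p = diff X (Suc p) ` car X (Suc p) + rel X p"

definition hclass :: "('k, 'a::plus) dga \<Rightarrow> nat \<Rightarrow> 'a \<Rightarrow> 'a set"
  where "hclass X p z = z +o boundaries X p"

definition homology :: "('k, 'a::plus) dga \<Rightarrow> nat \<Rightarrow> 'a set set"
  where "homology X p = hclass X p ` cycles X p"

text \<open>
  The operations on homology take all representatives; the union below is a single class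
  exactly when the operation is well defined. Addition of classes is addition of sets.
\<close>

definition hscal :: "('k, 'a::plus) dga \<Rightarrow> nat \<Rightarrow> 'k \<Rightarrow> 'a set \<Rightarrow> 'a set"
  where "hscal X p c \<alpha> = (\<Union>z\<in>\<alpha>. hclass X p (scal X c z))"

definition hmult :: "('k, 'a::plus) dga \<Rightarrow> nat \<Rightarrow> nat \<Rightarrow> 'a set \<Rightarrow> 'a set \<Rightarrow> 'a set"
  where "hmult X p q \<alpha> \<beta> = (\<Union>z\<in>\<alpha>. \<Union>w\<in>\<beta>. hclass X (p + q) (mult X p q z w))"

definition hunit :: "('k, 'a::plus) dga \<Rightarrow> 'a set"
  where "hunit X = hclass X 0 (unit X)"

definition hops_closed :: "('k, 'a::plus) dga \<Rightarrow> bool"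
  where "hops_closed X \<longleftrightarrow>
    (\<forall>p. \<forall>\<alpha>\<in>homology X p. \<forall>\<beta>\<in>homology X p. \<alpha> + \<beta> \<in> homology X p) \<and>
    (\<forall>p c. \<forall>\<alpha>\<in>homology X p. hscal X p c \<alpha> \<in> homology X p) \<and>
    (\<forall>p q. \<forall>\<alpha>\<in>homology X p. \<forall>\<beta>\<in>homology X q. hmult X p q \<alpha> \<beta> \<in> homology X (p + q)) \<and>
    hunit X \<in> homology X 0"

definition homology_algebra_iso ::
  "('k, 'a::plus) dga \<Rightarrow> ('k, 'b::plus) dga \<Rightarrow> (nat \<Rightarrow> 'a set \<Rightarrow> 'b set) \<Rightarrow> bool"
  where "homology_algebra_iso X Y h \<longleftrightarrow>
    hops_closed X \<and> hops_closed Y \<and>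
    (\<forall>p. bij_betw (h p) (homology X p) (homology Y p)) \<and>
    (\<forall>p. \<forall>\<alpha>\<in>homology X p. \<forall>\<beta>\<in>homology X p. h p (\<alpha> + \<beta>) = h p \<alpha> + h p \<beta>) \<and>
    (\<forall>p c. \<forall>\<alpha>\<in>homology X p. h p (hscal X p c \<alpha>) = hscal Y p c (h p \<alpha>)) \<and>
    (\<forall>p q. \<forall>\<alpha>\<in>homology X p. \<forall>\<beta>\<in>homology X q.
       h (p + q) (hmult X p q \<alpha> \<beta>) = hmult Y p q (h p \<alpha>) (h q \<beta>)) \<and>
    h 0 (hunit X) = hunit Y"


section \<open>The Tor algebra\<close>

text \<open>\<open>M \<otimes> N\<close> is the free abelian group on \<open>M \<times> N\<close> modulo the subgroup \<open>tensor_rel\<close>.\<close>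

definition tensor_free :: "'a set \<Rightarrow> 'b set \<Rightarrow> ('a \<times> 'b \<Rightarrow>\<^sub>0 int) set"
  where "tensor_free M N = {z. keys z \<subseteq> M \<times> N}"

definition tensor_rel ::
  "('r \<Rightarrow> 'a \<Rightarrow> 'a) \<Rightarrow> ('r \<Rightarrow> 'b \<Rightarrow> 'b) \<Rightarrow> 'a::plus set \<Rightarrow> 'b::plus set \<Rightarrow> ('a \<times> 'b \<Rightarrow>\<^sub>0 int) set"
  where "tensor_rel s s' M N = module.span frag_cmul
    ({frag_of (x + x', y) - frag_of (x, y) - frag_of (x', y) | x x' y. x \<in> M \<and> x' \<in> M \<and> y \<in> N} \<union>
     {frag_of (x, y + y') - frag_of (x, y) - frag_of (x, y') | x y y'. x \<in> M \<and> y \<in> N \<and> y' \<in> N} \<union>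
     {frag_of (s r x, y) - frag_of (x, s' r y) | r x y. x \<in> M \<and> y \<in> N})"

text \<open>The residue field \<open>S/(x\<^sub>1, \<dots>, x\<^sub>n) = 'k\<close>, with \<open>S\<close> acting through constant coefficients.\<close>

definition residue_scale :: "('x, 'k::semiring_0) mpol \<Rightarrow> 'k \<Rightarrow> 'k"
  where "residue_scale P c = const_coeff P * c"

text \<open>
  The complex \<open>F \<otimes>\<^sub>S k\<close>, whose homology is \<open>Tor\<close> of \<open>S/I\<close> and \<open>k\<close>, with the product
  \<open>(x \<otimes> a)(y \<otimes> b) = \<mu> x y \<otimes> a b\<close> coming from a lift \<open>\<mu>\<close> of the multiplication of \<open>S/I\<close>.
  The unit is the class of \<open>e \<otimes> 1\<close> for any \<open>e \<in> F 0\<close> over \<open>1 \<in> S/I\<close>.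
\<close>

definition tor_dga ::
  "(('x, 'k::field) mpol \<Rightarrow> 'm \<Rightarrow> 'm) \<Rightarrow> (nat \<Rightarrow> 'm::ab_group_add set) \<Rightarrow> (nat \<Rightarrow> 'm \<Rightarrow> 'm)
    \<Rightarrow> ('m \<Rightarrow> ('x, 'k) mpol set) \<Rightarrow> ('x, 'k) mpol set \<Rightarrow> (nat \<Rightarrow> nat \<Rightarrow> 'm \<Rightarrow> 'm \<Rightarrow> 'm)
    \<Rightarrow> ('k, 'm \<times> 'k \<Rightarrow>\<^sub>0 int) dga"
  where "tor_dga s F d \<epsilon> I \<mu> = \<lparr>
    car = (\<lambda>p. tensor_free (F p) UNIV),
    rel = (\<lambda>p. tensor_rel s residue_scale (F p) UNIV),
    diff = (\<lambda>p. frag_extend (\<lambda>(x, a). frag_of (d p x, a))),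
    scal = (\<lambda>c. frag_extend (\<lambda>(x, a). frag_of (x, c * a))),
    mult = (\<lambda>p q z w. frag_extend (\<lambda>(x, a). frag_extend (\<lambda>(y, b). frag_of (\<mu> p q x y, a * b)) w) z),
    unit = frag_of (SOME e. e \<in> F 0 \<and> \<epsilon> e = 1 +o I, 1)\<rparr>"


section \<open>Least common multiples and the rank function\<close>

text \<open>
  A finite set \<open>{Q 1, \<dots>, Q m}\<close> of polynomials is ordered by index, and a subset of it is
  represented by its set of indices \<open>\<sigma> \<subseteq> {1..m}\<close>.
\<close>

definition irreducible_factors :: "'r::comm_semiring_1 set \<Rightarrow> 'r set"
  where "irreducible_factors A = {e. irreducible e \<and> (\<exists>q\<in>A. e dvd q)}"

definition factor_representatives :: "'r::comm_semiring_1 set \<Rightarrow> 'r set \<Rightarrow> bool"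
  where "factor_representatives A E \<longleftrightarrow>
    E \<subseteq> irreducible_factors A \<and>
    (\<forall>f\<in>irreducible_factors A. \<exists>!e. e \<in> E \<and> e dvd f \<and> f dvd e)"

definition E_product :: "'r::comm_semiring_1 set \<Rightarrow> ('r \<Rightarrow> nat) \<Rightarrow> 'r"
  where "E_product E f = (\<Prod>e\<in>E. e ^ f e)"

definition is_lcm :: "'r::comm_semiring_1 set \<Rightarrow> 'r \<Rightarrow> bool"
  where "is_lcm B L \<longleftrightarrow> (\<forall>q\<in>B. q dvd L) \<and> (\<forall>M. (\<forall>q\<in>B. q dvd M) \<longrightarrow> L dvd M)"

definition Qlcm :: "'r::comm_semiring_1 set \<Rightarrow> (nat \<Rightarrow> 'r) \<Rightarrow> nat set \<Rightarrow> 'r"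
  where "Qlcm E Q \<sigma> = (THE L. is_lcm (Q ` \<sigma>) L \<and> (\<exists>f. L = E_product E f))"

text \<open>The vector of exponents, an element of \<open>\<nat>\<^sup>E\<close> extended by zero.\<close>

definition rk :: "'r::comm_semiring_1 set \<Rightarrow> 'r \<Rightarrow> 'r \<Rightarrow> nat"
  where "rk E P = (THE f. (\<forall>e. e \<notin> E \<longrightarrow> f e = 0) \<and> P = E_product E f)"

definition eps_pos :: "nat set \<Rightarrow> nat \<Rightarrow> nat"
  where "eps_pos \<tau> i = card {j\<in>\<tau>. j < i}"

definition shuffle :: "nat set \<Rightarrow> nat set \<Rightarrow> nat \<Rightarrow> nat"
  where "shuffle \<sigma> \<tau> = (THE \<pi>. \<pi> permutes (\<sigma> \<union> \<tau>) \<and>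
    map \<pi> (sorted_list_of_set (\<sigma> \<union> \<tau>)) = sorted_list_of_set \<sigma> @ sorted_list_of_set \<tau>)"


section \<open>The Taylor complex\<close>

definition subset_module :: "nat \<Rightarrow> nat \<Rightarrow> (nat set \<Rightarrow>\<^sub>0 'r::zero) set"
  where "subset_module m p = {v. keys v \<subseteq> {\<tau>. \<tau> \<subseteq> {1..m} \<and> card \<tau> = p}}"

definition taylor_diff ::
  "'r::comm_ring_1 set \<Rightarrow> (nat \<Rightarrow> 'r) \<Rightarrow> (nat set \<Rightarrow>\<^sub>0 'r) \<Rightarrow> (nat set \<Rightarrow>\<^sub>0 'r)"
  where "taylor_diff E Q = on_basis (\<lambda>\<tau>. \<Sum>i\<in>\<tau>.
    Poly_Mapping.single (\<tau> - {i})
      ((- 1) ^ eps_pos \<tau> i * (THE c. Qlcm E Q \<tau> = c * Qlcm E Q (\<tau> - {i}))))"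

definition taylor_aug :: "'r::comm_ring_1 set \<Rightarrow> (nat set \<Rightarrow>\<^sub>0 'r) \<Rightarrow> 'r set"
  where "taylor_aug I v = lookup v {} +o I"

definition taylor_is_resolution ::
  "'r::comm_ring_1 set \<Rightarrow> (nat \<Rightarrow> 'r) \<Rightarrow> nat \<Rightarrow> 'r set \<Rightarrow> bool"
  where "taylor_is_resolution E Q m I \<longleftrightarrow>
    free_resolution pm_scale (subset_module m) (\<lambda>_. taylor_diff E Q) (taylor_aug I) I"


section \<open>The algebra of the lattice of least common multiples\<close>

definition delta_diff ::
  "'r::comm_semiring_1 set \<Rightarrow> (nat \<Rightarrow> 'r) \<Rightarrow> (nat set \<Rightarrow>\<^sub>0 'k) \<Rightarrow> (nat set \<Rightarrow>\<^sub>0 'k::comm_ring_1)"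
  where "delta_diff E Q = on_basis (\<lambda>\<sigma>.
    \<Sum>i | i \<in> \<sigma> \<and> Qlcm E Q (\<sigma> - {i}) = Qlcm E Q \<sigma>.
      Poly_Mapping.single (\<sigma> - {i}) ((- 1) ^ eps_pos \<sigma> i))"

definition delta_basis_mult ::
  "'r::comm_semiring_1 set \<Rightarrow> (nat \<Rightarrow> 'r) \<Rightarrow> nat set \<Rightarrow> nat set \<Rightarrow> (nat set \<Rightarrow>\<^sub>0 'k::comm_ring_1)"
  where "delta_basis_mult E Q \<sigma> \<tau> =
    (if rk E (Qlcm E Q (\<sigma> \<union> \<tau>)) \<noteq> (\<lambda>e. rk E (Qlcm E Q \<sigma>) e + rk E (Qlcm E Q \<tau>) e) then 0
     else Poly_Mapping.single (\<sigma> \<union> \<tau>) (of_int (sign (shuffle \<sigma> \<tau>))))"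

definition delta_dga ::
  "('x, 'k::field) mpol set \<Rightarrow> (nat \<Rightarrow> ('x, 'k) mpol) \<Rightarrow> nat \<Rightarrow> ('k, nat set \<Rightarrow>\<^sub>0 'k) dga"
  where "delta_dga E Q m = \<lparr>
    car = subset_module m,
    rel = (\<lambda>_. {0}),
    diff = (\<lambda>_. delta_diff E Q),
    scal = pm_scale,
    mult = (\<lambda>_ _ v w. on_basis (\<lambda>\<sigma>. on_basis (\<lambda>\<tau>. delta_basis_mult E Q \<sigma> \<tau>) w) v),
    unit = Poly_Mapping.single {} 1\<rparr>"


section \<open>The canonical map\<close>

text \<open>
  For a comparison map \<open>\<phi>\<close> from a resolution \<open>F\<close> to the Taylor complex: the map on \<open>F p \<otimes> k\<close>
  sending \<open>x \<otimes> a\<close> to the image of \<open>\<phi> x \<otimes> a\<close> under the identification of the Taylor complex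
  tensored with \<open>k\<close> with the space spanned by subsets (reduce coefficients to their constant
  terms).
\<close>

definition to_delta ::
  "(nat \<Rightarrow> 'm \<Rightarrow> (nat set \<Rightarrow>\<^sub>0 ('x, 'k) mpol)) \<Rightarrow> nat \<Rightarrow> ('m \<times> 'k \<Rightarrow>\<^sub>0 int)
    \<Rightarrow> (nat set \<Rightarrow>\<^sub>0 'k::field)"
  where "to_delta \<phi> p z = (\<Sum>(x, a)\<in>keys z.
    pm_scale (of_int (lookup z (x, a)) * a) (Poly_Mapping.map const_coeff (\<phi> p x)))"

text \<open>
  A family \<open>h\<close> on homology is canonical if it is induced by every comparison map, of which there
  is at least one; it is thereby unique on the homology of \<open>F \<otimes> k\<close> and compatible with the
  identifications between different resolutions.
\<close>

definition canonical_map ::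
  "(('x, 'k::field) mpol \<Rightarrow> 'm \<Rightarrow> 'm) \<Rightarrow> (nat \<Rightarrow> 'm::ab_group_add set) \<Rightarrow> (nat \<Rightarrow> 'm \<Rightarrow> 'm)
    \<Rightarrow> ('m \<Rightarrow> ('x, 'k) mpol set) \<Rightarrow> ('x, 'k) mpol set \<Rightarrow> (nat \<Rightarrow> nat \<Rightarrow> 'm \<Rightarrow> 'm \<Rightarrow> 'm)
    \<Rightarrow> ('x, 'k) mpol set \<Rightarrow> (nat \<Rightarrow> ('x, 'k) mpol) \<Rightarrow> nat
    \<Rightarrow> (nat \<Rightarrow> ('m \<times> 'k \<Rightarrow>\<^sub>0 int) set \<Rightarrow> (nat set \<Rightarrow>\<^sub>0 'k) set) \<Rightarrow> bool"
  where "canonical_map s F d \<epsilon> I \<mu> E Q m h \<longleftrightarrow>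
    (let is_comparison = comparison_map s F d \<epsilon>
           pm_scale (subset_module m) (\<lambda>_. taylor_diff E Q) (taylor_aug I)
     in (\<exists>\<phi>. is_comparison \<phi>) \<and>
        (\<forall>\<phi>. is_comparison \<phi> \<longrightarrow>
           (\<forall>p. \<forall>z\<in>cycles (tor_dga s F d \<epsilon> I \<mu>) p.
              h p (hclass (tor_dga s F d \<epsilon> I \<mu>) p z)
                = hclass (delta_dga E Q m) p (to_delta \<phi> p z))))"

end

theory Submission
  imports Defs "HOL-Computational_Algebra.Polynomial"
begin

text \<open>
  Write \<open>K\<close> for the Taylor complex and \<open>k\<close> for the coefficient field. Two free resolutions of \<open>S/I\<close>
  are homotopy equivalent over the identity of \<open>S/I\<close>, so a comparison map \<open>\<phi> : F \<rightarrow> K\<close> induces an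
  isomorphism from \<open>Tor = H(F \<otimes> k)\<close> to \<open>H(K \<otimes> k)\<close>, which depends only on the homotopy class of \<open>\<phi>\<close>
  and hence not on \<open>\<phi>\<close> at all. The complex \<open>K \<otimes> k\<close> is \<open>\<Delta>(D)\<close>: both have the subsets of \<open>{1..m}\<close>
  as basis, and the coefficient \<open>Q\<^sub>\<sigma> / Q\<^bsub>\<sigma>-i\<^esub>\<close> of a face is a product of elements of \<open>E\<close>. Those are
  irreducible factors of homogeneous polynomials, so they have no constant term, and modulo the
  variables the coefficient becomes \<open>1\<close> if \<open>Q\<^sub>\<sigma> = Q\<^bsub>\<sigma>-i\<^esub>\<close> and \<open>0\<close> otherwise
  (\<open>const_coeff_E_product\<close>, \<open>const_reduce_taylor_face\<close>).

  For the products, \<open>K\<close> carries Taylor's multiplication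
  \<open>\<sigma> \<cdot> \<tau> = \<plusminus> (Q\<^sub>\<sigma> Q\<^sub>\<tau> / Q\<^bsub>\<sigma>\<union>\<tau>\<^esub>) (\<sigma> \<union> \<tau>)\<close> for disjoint \<open>\<sigma>, \<tau>\<close>, and \<open>0\<close> otherwise. It satisfies the Leibniz
  rule (\<open>taylor_leibniz\<close>), and its coefficient has constant term \<open>1\<close> exactly if
  \<open>rk Q\<^bsub>\<sigma>\<union>\<tau>\<^esub> = rk Q\<^sub>\<sigma> + rk Q\<^sub>\<tau>\<close>, so modulo the variables it becomes the product of \<open>\<Delta>(D)\<close>
  (\<open>const_reduce_taylor_mult\<close>). A lift \<open>\<mu>\<close> of the multiplication of \<open>S/I\<close> to \<open>F\<close> is carried to \<open>K\<close> by
  comparison maps \<open>\<psi> : K \<rightarrow> F\<close> and \<open>\<phi> : F \<rightarrow> K\<close>. The result \<open>\<phi> \<mu> (\<psi> v, \<psi> w)\<close> and Taylor's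
  multiplication are chain maps \<open>K \<otimes> K \<rightarrow> K\<close> over the same map \<open>S/I \<otimes> S/I \<rightarrow> S/I\<close>, so they are homotopic
  (\<open>bilinear_null_homotopy\<close>, \<open>transported_homotopy\<close>), and modulo the variables they agree on pairs of
  cycles up to boundaries (\<open>bilin_transported\<close>).

  That least common multiples are products of elements of \<open>E\<close>, with unique exponents, rests on
  unique factorization in \<open>S\<close>. It is proved by induction on the set of variables
  (\<open>mpol_irreducible_dvd_mult\<close>). All statements about \<open>F \<otimes> k\<close> hold modulo the defining relations of the
  tensor product; the map \<open>from_delta\<close> is an inverse of the canonical map up to these relations and
  boundaries.
\<close>

section \<open>Unique factorization of polynomials\<close>

lemma poly_mapping_single_induct [case_names zero add]:
  fixes p :: "'a \<Rightarrow>\<^sub>0 'b::comm_monoid_add"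
  assumes "P 0" and "\<And>t c q. P q \<Longrightarrow> P (Poly_Mapping.single t c + q)"
  shows "P p"
proof (induction p rule: update_induct)
  case (update f a b)
  have "Poly_Mapping.update a b f = Poly_Mapping.single a b + f"
    using update by (intro poly_mapping_eqI)
      (auto simp: lookup_update lookup_add lookup_single when_def in_keys_iff)
  then show ?case using assms(2)[OF update(3)] by simp
qed (fact assms(1))

text \<open>
  For additive \<open>a\<close> and \<open>n\<close>, the ring homomorphism into polynomials in one new variable that multiplies each monomial \<open>t\<close> by
  the power \<open>n t\<close> of that variable and rewrites \<open>t\<close> to \<open>a t\<close>. Two instances occur: \<open>in_var x\<close> reads a
  polynomial as a polynomial in \<open>x\<close> over the other variables, and \<open>tgrade\<close> records the total degree.
\<close>

definition grading :: "(('x \<Rightarrow>\<^sub>0 nat) \<Rightarrow> ('x \<Rightarrow>\<^sub>0 nat)) \<Rightarrow> (('x \<Rightarrow>\<^sub>0 nat) \<Rightarrow> nat)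
    \<Rightarrow> ('x, 'k::comm_ring_1) mpol \<Rightarrow> ('x, 'k) mpol poly"
  where "grading a n p = (\<Sum>t\<in>keys p. monom (Poly_Mapping.single (a t) (lookup p t)) (n t))"

lemma grading_zero [simp]: "grading a n 0 = 0"
  by (simp add: grading_def)

lemma grading_add: "grading a n (p + q) = grading a n p + grading a n q"
  unfolding grading_def
  by (rule setsum_keys_plus_distrib) (simp_all add: single_add add_monom)

lemma grading_single: "grading a n (Poly_Mapping.single t c) = monom (Poly_Mapping.single (a t) c) (n t)"
  by (cases "c = 0") (simp_all add: grading_def)

lemma grading_mult:
  assumes a: "\<And>t u. a (t + u) = a t + a u" and n: "\<And>t u. n (t + u) = n t + n u"
  shows "grading a n (p * q) = grading a n p * grading a n q"
proof (induction p rule: poly_mapping_single_induct)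
  case (add t c p)
  have "grading a n (Poly_Mapping.single t c * q) =
      monom (Poly_Mapping.single (a t) c) (n t) * grading a n q"
    by (induction q rule: poly_mapping_single_induct)
      (simp_all add: distrib_left grading_add grading_single mult_single mult_monom a n)
  then show ?case
    by (simp add: distrib_right grading_add grading_single add)
qed simp

definition del_var :: "'x \<Rightarrow> ('x \<Rightarrow>\<^sub>0 nat) \<Rightarrow> ('x \<Rightarrow>\<^sub>0 nat)"
  where "del_var x t = Poly_Mapping.update x 0 t"

lemma lookup_del_var: "lookup (del_var x t) y = (if y = x then 0 else lookup t y)"
  by (simp add: del_var_def lookup_update)

lemma del_var_add: "del_var x (t + u) = del_var x t + del_var x u"
  by (rule poly_mapping_eqI) (simp add: lookup_del_var lookup_add)

definition in_var :: "'x \<Rightarrow> ('x, 'k::comm_ring_1) mpol \<Rightarrow> ('x, 'k) mpol poly"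
  where "in_var x = grading (del_var x) (\<lambda>t. lookup t x)"

lemma in_var_zero [simp]: "in_var x 0 = 0"
  and in_var_add: "in_var x (p + q) = in_var x p + in_var x q"
  and in_var_mult: "in_var x (p * q) = in_var x p * in_var x q"
  by (auto simp: in_var_def grading_add intro!: grading_mult del_var_add lookup_add)

lemma in_var_single:
  "in_var x (Poly_Mapping.single t c) = monom (Poly_Mapping.single (del_var x t) c) (lookup t x)"
  by (simp add: in_var_def grading_single)

definition var :: "'x \<Rightarrow> ('x, 'k::comm_ring_1) mpol"
  where "var x = Poly_Mapping.single (Poly_Mapping.single x 1) 1"

lemma var_power: "var x ^ n = Poly_Mapping.single (Poly_Mapping.single x n) 1"
  by (induction n) (simp_all add: var_def mult_single flip: single_add)

lemma poly_in_var: "poly (in_var x p) (var x) = p"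
proof (induction p rule: poly_mapping_single_induct)
  case (add t c p)
  have "del_var x t + Poly_Mapping.single x (lookup t x) = t"
    by (rule poly_mapping_eqI) (auto simp: lookup_add lookup_del_var lookup_single when_def)
  then show ?case
    by (simp add: in_var_add in_var_single poly_monom var_power mult_single add)
qed simp

lemma in_var_inj: "in_var x p = in_var x q \<Longrightarrow> p = q"
  by (metis poly_in_var)

lemma in_var_minus: "in_var x (p - q) = in_var x p - in_var x q"
  by (metis add_diff_cancel diff_add_cancel in_var_add)

definition pvars :: "('x, 'k::comm_ring_1) mpol \<Rightarrow> 'x set"
  where "pvars p = (\<Union>t\<in>keys p. keys t)"

text \<open>
  With this, statements about occurring variables become statements about degrees, which add up
  under multiplication.
\<close>

lemma pvars_iff_degree: 
  shows "x \<notin> pvars p \<longleftrightarrow> degree (in_var x p) = 0"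
proof
  assume "x \<notin> pvars p"
  then have "\<forall>t\<in>keys p. lookup t x = 0" by (auto simp: pvars_def in_keys_iff)
  then have "in_var x p = (\<Sum>t\<in>keys p. [:Poly_Mapping.single (del_var x t) (lookup p t):])"
    by (auto simp: in_var_def grading_def monom_0 intro!: sum.cong)
  also have "degree \<dots> \<le> 0" by (rule degree_sum_le) auto
  finally show "degree (in_var x p) = 0" by simp
next
  assume "degree (in_var x p) = 0"
  then obtain c where c: "in_var x p = [:c:]" by (metis degree_0_id)
  have *: "lookup (coeff (in_var x p) j) u = (\<Sum>t\<in>keys p. if lookup t x = j \<and> del_var x t = u then lookup p t else 0)" for j u
    unfolding in_var_def grading_def coeff_sum lookup_sum
    by (rule sum.cong) (auto simp: lookup_single)
  show "x \<notin> pvars p"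
  proof
    assume "x \<in> pvars p"
    then obtain t where t: "t \<in> keys p" "lookup t x \<noteq> 0" by (auto simp: pvars_def in_keys_iff)
    have "u = t" if "lookup u x = lookup t x" "del_var x u = del_var x t" for u
      using that by (metis lookup_del_var poly_mapping_eqI)
    then have "(\<Sum>u\<in>keys p. if lookup u x = lookup t x \<and> del_var x u = del_var x t then lookup p u else 0) =
       (\<Sum>u\<in>keys p. if u = t then lookup p u else 0)" by (intro sum.cong) auto
    also have "\<dots> = lookup p t" using t by simp
    finally have "lookup (coeff (in_var x p) (lookup t x)) (del_var x t) = lookup p t" by (simp only: *)
    moreover have "coeff (in_var x p) (lookup t x) = 0" using t(2) by (simp add: c coeff_pCons split: nat.split)
    ultimately show False using t(1) by (simp add: in_keys_iff)
  qed
qed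

lemma pvars_coeff: "pvars (coeff (in_var x p) j) \<subseteq> pvars p - {x}"
proof
  fix y assume "y \<in> pvars (coeff (in_var x p) j)"
  then obtain u where u: "u \<in> keys (coeff (in_var x p) j)" "y \<in> keys u" by (auto simp: pvars_def)
  have "keys (coeff (in_var x p) j) \<subseteq> (\<Union>t\<in>keys p. keys (coeff (monom (Poly_Mapping.single (del_var x t) (lookup p t)) (lookup t x)) j))"
    by (simp only: in_var_def grading_def coeff_sum keys_sum)
  then obtain t where t: "t \<in> keys p" "u = del_var x t"
    using u(1) by (auto split: if_splits)
  with u(2) show "y \<in> pvars p - {x}"
    by (auto simp: pvars_def in_keys_iff lookup_del_var split: if_splits)
qed

lemma in_var_no_var: "x \<notin> pvars p \<Longrightarrow> in_var x p = [:p:]"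
proof -
  assume "x \<notin> pvars p"
  then obtain c where c: "in_var x p = [:c:]" by (metis degree_0_id pvars_iff_degree)
  then have "p = c" using poly_in_var[of x p] by simp
  with c show ?thesis by simp
qed

lemma pvars_zero [simp]: "pvars 0 = {}" and pvars_one [simp]: "pvars 1 = {}"
  by (auto simp: pvars_def)

lemma pvars_add: "pvars (p + q) \<subseteq> pvars p \<union> pvars q"
  using keys_add[of p q] by (force simp: pvars_def)

lemma pvars_minus: "pvars (p - q) \<subseteq> pvars p \<union> pvars q"
  using keys_diff[of p q] by (force simp: pvars_def)

text \<open>
  Degrees are additive in each variable, so the polynomials in a given set of variables are closed
  under taking factors.
\<close>

lemma pvars_mult: 
  fixes p :: "('x::linorder, 'k::field) mpol"
  assumes "p * q \<noteq> 0"
  shows "pvars (p * q) = pvars p \<union> pvars q"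
proof -
  have "x \<notin> pvars (p * q) \<longleftrightarrow> x \<notin> pvars p \<and> x \<notin> pvars q" for x
  proof -
    have "in_var x p \<noteq> 0" "in_var x q \<noteq> 0" using assms by (metis in_var_inj in_var_zero mult_not_zero)+
    then show ?thesis by (simp add: pvars_iff_degree in_var_mult degree_mult_eq)
  qed
  then show ?thesis by blast
qed

lemma pvars_mult_le: 
  fixes p :: "('x::linorder, 'k::field) mpol"
  shows "pvars (p * q) \<subseteq> pvars p \<union> pvars q"
  by (cases "p * q = 0") (auto simp: pvars_mult)

lemma pvars_dvd:
  fixes p :: "('x::linorder, 'k::field) mpol"
  assumes "p dvd q" "q \<noteq> 0" shows "pvars p \<subseteq> pvars q"
  using assms pvars_mult by (metis Un_upper1 dvd_def)

lemma no_pvars_is_unit: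
  fixes p :: "('x::linorder, 'k::field) mpol"
  assumes "pvars p = {}" "p \<noteq> 0" shows "p dvd 1"
proof -
  have "keys p \<subseteq> {0}" using assms by (auto simp: pvars_def)
  then have p: "p = Poly_Mapping.single 0 (lookup p 0)"
    by (intro poly_mapping_eqI) (auto simp: lookup_single when_def in_keys_iff)
  with assms have "lookup p 0 \<noteq> 0" by (metis single_zero)
  then have "p * Poly_Mapping.single 0 (inverse (lookup p 0)) = 1"
    by (subst p) (simp add: mult_single)
  then show ?thesis by (intro dvdI[of 1 p]) simp
qed

definition tdeg :: "('x \<Rightarrow>\<^sub>0 nat) \<Rightarrow> nat"
  where "tdeg t = (\<Sum>x\<in>keys t. lookup t x)"

lemma tdeg_add: "tdeg (t + u) = tdeg t + tdeg u"
  unfolding tdeg_def by (rule setsum_keys_plus_distrib) auto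

definition tgrade :: "('x, 'k::comm_ring_1) mpol \<Rightarrow> ('x, 'k) mpol poly"
  where "tgrade = grading id tdeg"

lemma tgrade_mult: "tgrade (p * q) = tgrade p * tgrade q"
  unfolding tgrade_def by (rule grading_mult) (auto simp: tdeg_add)

lemma poly_tgrade: "poly (tgrade p) 1 = p"
  by (induction p rule: poly_mapping_single_induct)
    (simp_all add: tgrade_def grading_add grading_single poly_monom)

lemma tgrade_eq_0_iff [simp]: "tgrade p = 0 \<longleftrightarrow> p = 0"
  using poly_tgrade[of p] by (auto simp: tgrade_def)

lemma lookup_coeff_tgrade: "lookup (coeff (tgrade p) j) t = (if tdeg t = j then lookup p t else 0)"
proof -
  have "lookup (coeff (tgrade p) j) t = (\<Sum>u\<in>keys p. if u = t then (if tdeg t = j then lookup p t else 0) else 0)"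
    unfolding tgrade_def grading_def coeff_sum lookup_sum
    by (rule sum.cong) (auto simp: lookup_single)
  also have "\<dots> = (if tdeg t = j then lookup p t else 0)" by (simp add: in_keys_iff)
  finally show ?thesis .
qed

lemma tdeg_eq_0_iff: "tdeg t = 0 \<longleftrightarrow> t = 0"
proof
  assume "tdeg t = 0"
  then have "\<forall>x\<in>keys t. lookup t x = 0" by (simp add: tdeg_def)
  then have "keys t = {}" using in_keys_iff[of _ t] by blast
  then show "t = 0" by simp
qed (simp add: tdeg_def)

lemma degree_tgrade_eq_0_imp_unit:
  fixes p :: "('x::linorder, 'k::field) mpol"
  assumes "degree (tgrade p) = 0" "p \<noteq> 0" shows "p dvd 1"
proof (rule no_pvars_is_unit)
  have "keys p \<subseteq> {0}"
  proof
    fix t assume t: "t \<in> keys p"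
    then have "coeff (tgrade p) (tdeg t) \<noteq> 0" 
      using lookup_coeff_tgrade[of p "tdeg t" t] by (auto simp: in_keys_iff)
    then have "tdeg t \<le> 0" using le_degree assms(1) by metis
    then show "t \<in> {0}" by (simp add: tdeg_eq_0_iff)
  qed
  then show "pvars p = {}" by (auto simp: pvars_def)
qed fact

lemma exists_irreducible_factor:
  fixes p :: "('x::linorder, 'k::field) mpol"
  assumes "p \<noteq> 0" "\<not> p dvd 1"
  shows "\<exists>e. irreducible e \<and> e dvd p"
  using assms
proof (induction "degree (tgrade p)" arbitrary: p rule: less_induct)
  case less
  show ?case
  proof (cases "irreducible p")
    case False
    then obtain a b where ab: "p = a * b" "\<not> a dvd 1" "\<not> b dvd 1"
      using less.prems by (auto simp: irreducible_def)
    then have nz: "a \<noteq> 0" "b \<noteq> 0" using less.prems by auto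
    have "degree (tgrade b) > 0" using degree_tgrade_eq_0_imp_unit ab nz by blast
    then have "degree (tgrade a) < degree (tgrade p)"
      by (simp add: ab tgrade_mult degree_mult_eq nz)
    from less.hyps[OF this nz(1) ab(2)] show ?thesis unfolding ab(1) by (blast intro: dvd_mult2)
  qed (use dvd_refl in blast)
qed

text \<open>
  Every nonzero polynomial is a unit or has an irreducible factor, and removing that factor lowers
  the total degree. The rule stands in for a factorization into irreducibles.
\<close>

lemma irreducible_factor_induct [consumes 1, case_names unit mult]:
  fixes p :: "('x::linorder, 'k::field) mpol"
  assumes "p \<noteq> 0" and unit: "\<And>u. u dvd 1 \<Longrightarrow> P u"
    and step: "\<And>e q. irreducible e \<Longrightarrow> q \<noteq> 0 \<Longrightarrow> P q \<Longrightarrow> P (e * q)"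
  shows "P p"
  using assms(1)
proof (induction "degree (tgrade p)" arbitrary: p rule: less_induct)
  case less
  show ?case
  proof (cases "p dvd 1")
    case False
    obtain e q where e: "irreducible e" "p = e * q"
      using exists_irreducible_factor[OF less.prems False] by (auto simp: dvd_def)
    then have nz: "e \<noteq> 0" "q \<noteq> 0" using less.prems by auto
    have "\<not> e dvd 1" using e(1) by (simp add: irreducible_def)
    then have "degree (tgrade e) > 0" using degree_tgrade_eq_0_imp_unit nz by blast
    then have "degree (tgrade q) < degree (tgrade p)"
      by (simp add: e tgrade_mult degree_mult_eq nz)
    from less.hyps[OF this nz(2)] step e nz show ?thesis by simp
  qed (fact unit)
qed

text \<open>
  The induction on variables needs primality among the polynomials in the variables \<open>V\<close> only. Since
  factors stay within \<open>V\<close>, divisibility can be that of the full ring.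
\<close>

definition prime_within :: "'x set \<Rightarrow> ('x, 'k::field) mpol \<Rightarrow> bool"
  where "prime_within V p \<longleftrightarrow>
    (\<forall>a b. pvars a \<subseteq> V \<longrightarrow> pvars b \<subseteq> V \<longrightarrow> p dvd a * b \<longrightarrow> p dvd a \<or> p dvd b)"

lemma const_dvd_iff_dvd_coeff:
  fixes p :: "('x::linorder, 'k::field) mpol"
  assumes "x \<notin> pvars p"
  shows "p dvd a \<longleftrightarrow> (\<forall>j. p dvd coeff (in_var x a) j)"
proof -
  have "p dvd a \<longleftrightarrow> [:p:] dvd in_var x a"
  proof
    assume "p dvd a"
    then obtain q where "a = p * q" by (auto simp: dvd_def)
    then have "in_var x a = [:p:] * in_var x q" by (simp only: in_var_mult in_var_no_var[OF assms])
    then show "[:p:] dvd in_var x a" by (rule dvdI)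
  next
    assume "[:p:] dvd in_var x a"
    then obtain w where "in_var x a = [:p:] * w" by (auto simp: dvd_def)
    then have "a = p * poly w (var x)" using poly_in_var[of x a] by simp
    then show "p dvd a" by simp
  qed
  then show ?thesis by (simp add: const_poly_dvd_iff)
qed

text \<open>
  Gauss's lemma: if \<open>p\<close> does not involve \<open>x\<close> and divides neither \<open>a\<close> nor \<open>b\<close>, take the first
  coefficients \<open>a\<^sub>i\<close>, \<open>b\<^sub>j\<close> with respect to \<open>x\<close> that \<open>p\<close> does not divide. In the coefficient of
  \<open>x\<^bsup>i+j\<^esup>\<close> of \<open>a b\<close> every term except \<open>a\<^sub>i b\<^sub>j\<close> is divisible by \<open>p\<close>.
\<close>

lemma prime_within_insert:
  fixes p :: "('x::linorder, 'k::field) mpol"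
  assumes p: "prime_within V p" "pvars p \<subseteq> V" and x: "x \<notin> V"
  shows "prime_within (insert x V) p"
  unfolding prime_within_def
proof (intro allI impI, rule ccontr)
  fix a b assume a: "pvars a \<subseteq> insert x V" and b: "pvars b \<subseteq> insert x V"
    and ab: "p dvd a * b" and "\<not> (p dvd a \<or> p dvd b)"
  have xp: "x \<notin> pvars p" using p x by auto
  let ?a = "coeff (in_var x a)" and ?b = "coeff (in_var x b)"
  obtain i0 j0 where ij: "\<not> p dvd ?a i0" "\<not> p dvd ?b j0"
    using \<open>\<not> (p dvd a \<or> p dvd b)\<close> unfolding const_dvd_iff_dvd_coeff[OF xp, of a]
      const_dvd_iff_dvd_coeff[OF xp, of b] by blast
  define i where "i = (LEAST i. \<not> p dvd ?a i)"
  define j where "j = (LEAST j. \<not> p dvd ?b j)"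
  have i: "\<not> p dvd ?a i" unfolding i_def by (rule LeastI) (rule ij(1))
  have i': "p dvd ?a i'" if "i' < i" for i' using not_less_Least[OF that[unfolded i_def]] by simp
  have j: "\<not> p dvd ?b j" unfolding j_def by (rule LeastI) (rule ij(2))
  have j': "p dvd ?b j'" if "j' < j" for j' using not_less_Least[OF that[unfolded j_def]] by simp
  have "p dvd coeff (in_var x (a * b)) (i + j)"
    using ab unfolding const_dvd_iff_dvd_coeff[OF xp, of "a * b"] ..
  also have "coeff (in_var x (a * b)) (i + j) = (\<Sum>k\<le>i + j. ?a k * ?b (i + j - k))"
    by (simp add: in_var_mult coeff_mult)
  also have "\<dots> = ?a i * ?b (i + j - i) + (\<Sum>k\<in>{..i + j} - {i}. ?a k * ?b (i + j - k))"
    by (rule sum.remove) auto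
  finally have 1: "p dvd ?a i * ?b (i + j - i) + (\<Sum>k\<in>{..i + j} - {i}. ?a k * ?b (i + j - k))" .
  have 2: "p dvd (\<Sum>k\<in>{..i + j} - {i}. ?a k * ?b (i + j - k))"
  proof (rule dvd_sum)
    fix k assume k: "k \<in> {..i + j} - {i}"
    show "p dvd ?a k * ?b (i + j - k)"
    proof (cases "k < i")
      case False
      then have "i + j - k < j" using k by auto
      then show ?thesis using j' by simp
    qed (use i' in simp)
  qed
  from 1 have "p dvd ?a i * ?b (i + j - i)" by (rule iffD1[OF dvd_add_left_iff, OF 2])
  then have "p dvd ?a i * ?b j" by (simp only: add_diff_cancel_left')
  moreover have "pvars (?a i) \<subseteq> V" "pvars (?b j) \<subseteq> V"
    using pvars_coeff[of x a i] pvars_coeff[of x b j] a b by auto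
  ultimately show False using p(1) i j unfolding prime_within_def by blast
qed

text \<open>
  A factor \<open>c\<close> whose prime factors remain prime can be cancelled from \<open>c p = q g\<close> one prime at a time,
  each prime being taken from \<open>q\<close> or from \<open>g\<close>.
\<close>

lemma split_primes:
  fixes c :: "('x::linorder, 'k::field) mpol"
  assumes "c \<noteq> 0" and pr: "\<And>e::('x, 'k) mpol. irreducible e \<Longrightarrow> pvars e \<subseteq> V \<Longrightarrow> prime_within W e"
    and "pvars c \<subseteq> V" "c * p = q * g" "pvars q \<subseteq> W" "pvars g \<subseteq> W" "q * g \<noteq> 0"
  shows "\<exists>c1 c2 q0 g0. c = c1 * c2 \<and> q = c1 * q0 \<and> g = c2 * g0 \<and> p = q0 * g0"
  using assms(1,3-)
proof (induction c arbitrary: p q g rule: irreducible_factor_induct)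
  case (unit u)
  then obtain v where v: "1 = u * v" by (auto simp: dvd_def)
  have "q = (u * v) * q" "p = (u * v) * p" using v by simp_all
  then have "q = u * (v * q)" "p = v * (u * p)" by (simp_all only: mult_ac)
  then have "q = u * (v * q)" "p = (v * q) * g" using unit(3) by (simp_all add: mult.assoc)
  then show ?case by (intro exI[of _ u] exI[of _ 1] exI[of _ "v * q"] exI[of _ g]) simp
next
  case (mult e c)
  have W: "pvars e \<subseteq> V" "pvars c \<subseteq> V"
    using mult.prems(1) mult.hyps by (auto simp: pvars_mult irreducible_def)
  have e0: "e \<noteq> 0" using mult.hyps by auto
  have "q * g = e * (c * p)" using mult.prems(2) by (simp add: mult.assoc)
  then have "e dvd q * g" by simp
  then have "e dvd q \<or> e dvd g" using pr[OF mult.hyps(1) W(1)] mult.prems(3,4)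
    unfolding prime_within_def by blast
  then show ?case
  proof
    assume "e dvd q"
    then obtain q' where q': "q = e * q'" by (auto simp: dvd_def)
    then have 1: "c * p = q' * g" using mult.prems(2) e0 by (simp add: mult.assoc)
    have 2: "pvars q' \<subseteq> W" using mult.prems(3,5) by (simp add: q' pvars_mult)
    obtain c1 c2 q0 g0 where "c = c1 * c2 \<and> q' = c1 * q0 \<and> g = c2 * g0 \<and> p = q0 * g0"
      using mult.IH[OF W(2) 1 2 mult.prems(4)] mult.prems(5) q' by auto
    then show ?thesis by (intro exI[of _ "e * c1"] exI[of _ c2] exI[of _ q0] exI[of _ g0]) (simp add: q' mult.assoc)
  next
    assume "e dvd g"
    then obtain g' where g': "g = e * g'" by (auto simp: dvd_def)
    have "e * (c * p) = e * (q * g')" using mult.prems(2) by (simp add: g' mult_ac)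
    then have 1: "c * p = q * g'" using e0 by simp
    have 2: "pvars g' \<subseteq> W" using mult.prems(4,5) by (simp add: g' pvars_mult)
    obtain c1 c2 q0 g0 where "c = c1 * c2 \<and> q = c1 * q0 \<and> g' = c2 * g0 \<and> p = q0 * g0"
      using mult.IH[OF W(2) 1 mult.prems(3) 2] mult.prems(5) g' by auto
    then show ?thesis by (intro exI[of _ c1] exI[of _ "e * c2"] exI[of _ q0] exI[of _ g0]) (simp add: g' mult_ac)
  qed
qed

text \<open>
  An irreducible \<open>p\<close> that involves a new variable shares no factor with a polynomial in the old ones.
\<close>

lemma irreducible_dvd_cancel:
  fixes p :: "('x::linorder, 'k::field) mpol"
  assumes pr: "\<And>e::('x, 'k) mpol. irreducible e \<Longrightarrow> pvars e \<subseteq> V \<Longrightarrow> prime_within W e"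
    and p: "irreducible p" "pvars p \<subseteq> W" "\<not> pvars p \<subseteq> V"
    and c: "c \<noteq> 0" "pvars c \<subseteq> V" and b: "pvars b \<subseteq> W" "V \<subseteq> W" and dvd: "p dvd c * b"
  shows "p dvd b"
proof (cases "b = 0")
  case False
  obtain y where y: "c * b = p * y" using dvd by (auto simp: dvd_def)
  have nz: "p * y \<noteq> 0" using y c False by auto
  have "pvars y \<subseteq> pvars c \<union> pvars b"
    using pvars_mult[OF nz] pvars_mult_le[of c b] unfolding y by blast
  then have "pvars y \<subseteq> W" using b c by blast
  then obtain c1 c2 p0 y0 where *: "c = c1 * c2" "p = c1 * p0" "y = c2 * y0" "b = p0 * y0"
    using split_primes[OF c(1) pr c(2) y p(2) _ nz] by blast
  have "\<not> p0 dvd 1"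
  proof
    assume "p0 dvd 1"
    then have "pvars p0 = {}" using pvars_dvd[of p0 1] by auto
    moreover have "pvars c1 \<subseteq> V" using c * by (auto simp: pvars_mult)
    ultimately show False using p(3) pvars_mult_le[of c1 p0] * by auto
  qed
  then have "c1 dvd 1" using p(1) *(2) by (auto simp: irreducible_def)
  then obtain w where "1 = c1 * w" by (auto simp: dvd_def)
  then have "p0 = (c1 * w) * p0" by simp
  then have "p0 = p * w" using *(2) by (simp only: mult_ac)
  then have "p dvd p0" by simp
  then show ?thesis using * by simp
qed simp

text \<open>
  The Euclidean argument over the fraction field of the polynomials in \<open>V\<close>, with denominators cleared.
  Let \<open>g\<close> be an element of least \<open>x\<close>-degree of the ideal \<open>J\<close> generated by \<open>p\<close> and \<open>a\<close>. By pseudo-division,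
  for each \<open>f\<close> in \<open>J\<close> there is a nonzero polynomial \<open>c\<close> in \<open>V\<close> such that \<open>g\<close> divides \<open>c f\<close>. Comparing with the irreducible
  \<open>p\<close>, either \<open>g\<close> lies in \<open>V\<close>, and then \<open>p\<close> divides \<open>g b\<close>, or \<open>g\<close> is a multiple of \<open>p\<close>, and then \<open>p\<close> divides
  a multiple of \<open>a\<close>. Factors in \<open>V\<close> can be cancelled.
\<close>

lemma prime_within_insert_new:
  fixes p :: "('x::linorder, 'k::field) mpol"
  assumes IH: "\<And>e::('x, 'k) mpol. irreducible e \<Longrightarrow> pvars e \<subseteq> V \<Longrightarrow> prime_within V e"
    and x: "x \<notin> V" and p: "irreducible p" "pvars p \<subseteq> insert x V" "\<not> pvars p \<subseteq> V"
  shows "prime_within (insert x V) p"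
  unfolding prime_within_def
proof (intro allI impI)
  fix a b assume a: "pvars a \<subseteq> insert x V" and b: "pvars b \<subseteq> insert x V" and ab: "p dvd a * b"
  let ?W = "insert x V"
  have pr: "prime_within ?W e" if "irreducible e" "pvars e \<subseteq> V" for e :: "('x, 'k) mpol"
    by (rule prime_within_insert[OF IH[OF that] that(2) x])
  have subW: "pvars (f * g) \<subseteq> ?W" "pvars (f + g) \<subseteq> ?W" "pvars (f - g) \<subseteq> ?W"
    if "pvars f \<subseteq> ?W" "pvars g \<subseteq> ?W" for f g :: "('x, 'k) mpol"
    using that pvars_mult_le[of f g] pvars_add[of f g] pvars_minus[of f g] by blast+
  define J where "J = {u * p + v * a | u v. pvars u \<subseteq> ?W \<and> pvars v \<subseteq> ?W}"
  let ?d = "\<lambda>f. degree (in_var x f)"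
  have p0: "p \<noteq> 0" using p by auto
  have pJ: "p \<in> J" unfolding J_def by (intro CollectI exI[of _ 1] exI[of _ 0]) auto
  have aJ: "a \<in> J" unfolding J_def by (intro CollectI exI[of _ 0] exI[of _ 1]) auto
  have JW: "pvars f \<subseteq> ?W" if fJ: "f \<in> J" for f
  proof -
    obtain u v where f: "f = u * p + v * a" and uv: "pvars u \<subseteq> ?W" "pvars v \<subseteq> ?W"
      using fJ unfolding J_def by blast
    show ?thesis unfolding f by (intro subW uv p(2) a)
  qed
  have Jlin: "y * f - z * g \<in> J" if fg: "f \<in> J" "g \<in> J" and yz: "pvars y \<subseteq> ?W" "pvars z \<subseteq> ?W" for f g y z
  proof -
    obtain u v where f: "f = u * p + v * a" and W: "pvars u \<subseteq> ?W" "pvars v \<subseteq> ?W"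
      using fg(1) unfolding J_def by blast
    obtain u' v' where g: "g = u' * p + v' * a" and W': "pvars u' \<subseteq> ?W" "pvars v' \<subseteq> ?W"
      using fg(2) unfolding J_def by blast
    have "y * f - z * g = (y * u - z * u') * p + (y * v - z * v') * a"
      unfolding f g by (simp add: algebra_simps)
    moreover have "pvars (y * u - z * u') \<subseteq> ?W" "pvars (y * v - z * v') \<subseteq> ?W"
      by (intro subW W W' yz)+
    ultimately show ?thesis unfolding J_def by blast
  qed
  obtain g where g: "g \<in> J" "g \<noteq> 0" "\<And>f. f \<in> J \<Longrightarrow> f \<noteq> 0 \<Longrightarrow> ?d g \<le> ?d f"
    using ex_has_least_nat[of "\<lambda>f. f \<in> J \<and> f \<noteq> 0" p ?d] pJ p0 by auto
  have in_var_0: "in_var x f = 0 \<longleftrightarrow> f = 0" for f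
    using in_var_inj[of x f 0] by auto
  have gdvd: "\<exists>c. c \<noteq> 0 \<and> pvars c \<subseteq> V \<and> g dvd c * f" if "f \<in> J" for f
    using that
  proof (induction "?d f" arbitrary: f rule: less_induct)
    case less
    show ?case
    proof (cases "f = 0")
      case True
      then show ?thesis by (intro exI[of _ 1]) auto
    next
      case False
      let ?lf = "lead_coeff (in_var x f)" and ?lg = "lead_coeff (in_var x g)"
      \<comment> \<open>One step of pseudo-division: the leading terms of \<open>?lg * f\<close> and \<open>w * g\<close> are equal.\<close>
      define w where "w = ?lf * var x ^ (?d f - ?d g)"
      define f' where "f' = ?lg * f - w * g"
      have lV: "pvars ?lg \<subseteq> V" "pvars ?lf \<subseteq> V"
        using pvars_coeff[of x g] pvars_coeff[of x f] JW[OF g(1)] JW[OF less.prems] by blast+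
      have vW: "pvars (var x ^ n :: ('x, 'k) mpol) \<subseteq> ?W" for n
        by (auto simp: var_power pvars_def split: if_splits)
      have wW: "pvars w \<subseteq> ?W" unfolding w_def by (rule subW(1)) (use lV vW in auto)
      have f'J: "f' \<in> J" unfolding f'_def
        by (rule Jlin) (use lV wW less.prems g(1) in auto)
      have le: "?d g \<le> ?d f" using g(3) less.prems False by auto
      have "in_var x (var x :: ('x, 'k) mpol) = monom 1 1"
      proof -
        have "del_var x (Poly_Mapping.single x 1) = 0"
          by (rule poly_mapping_eqI) (auto simp: lookup_del_var lookup_single)
        then show ?thesis by (simp add: var_def in_var_single)
      qed
      moreover have "in_var x (f ^ n) = in_var x f ^ n" for f :: "('x,'k) mpol" and n
        by (induction n) (auto simp: in_var_mult in_var_no_var one_pCons)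
      ultimately have "in_var x (var x ^ n :: ('x, 'k) mpol) = monom 1 n" for n
        by (simp add: monom_power)
      moreover have ilg: "in_var x ?lg = [:?lg:]" and ilf: "in_var x ?lf = [:?lf:]"
        by (rule in_var_no_var; use lV x in blast)+
      ultimately have iw: "in_var x w = monom ?lf (?d f - ?d g)"
        by (simp add: w_def in_var_mult smult_monom del: in_var_zero)
      have if': "in_var x f' = smult ?lg (in_var x f) - monom ?lf (?d f - ?d g) * in_var x g"
        by (simp add: f'_def in_var_minus in_var_mult iw ilg)
      have "degree (in_var x f') \<le> ?d f" unfolding if'
        by (rule degree_diff_le) (use le degree_mult_le[of "monom ?lf (?d f - ?d g)" "in_var x g"]
          degree_monom_le[of ?lf "?d f - ?d g"] in \<open>auto intro: order.trans\<close>)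
      moreover have "coeff (in_var x f') (?d f) = 0"
        using le by (simp add: if' coeff_monom_mult mult.commute[of ?lf ?lg])
      ultimately have "in_var x f' = 0 \<or> ?d f' < ?d f" by (rule eq_zero_or_degree_less)
      then have "\<exists>c. c \<noteq> 0 \<and> pvars c \<subseteq> V \<and> g dvd c * f'"
      proof
        assume "in_var x f' = 0"
        then show ?thesis by (intro exI[of _ 1]) (simp add: in_var_0)
      qed (rule less.hyps[OF _ f'J])
      then obtain c where c: "c \<noteq> 0" "pvars c \<subseteq> V" "g dvd c * f'" by blast
      have "(c * ?lg) * f = c * f' + g * (c * w)" by (simp add: f'_def algebra_simps)
      then have "g dvd (c * ?lg) * f" using c(3) by simp
      moreover have "c * ?lg \<noteq> 0" using c(1) g(2) by (simp add: in_var_0)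
      moreover have "pvars (c * ?lg) \<subseteq> V" using pvars_mult_le[of c ?lg] lV c by auto
      ultimately show ?thesis by blast
    qed
  qed
  obtain c where c: "c \<noteq> 0" "pvars c \<subseteq> V" and "g dvd c * p" using gdvd[OF pJ] by blast
  then obtain q where q: "c * p = q * g" by (auto simp: dvd_def mult.commute)
  have nz: "q * g \<noteq> 0" using c p0 unfolding q[symmetric] by simp
  have "pvars q \<subseteq> pvars c \<union> pvars p"
    using pvars_mult[OF nz] pvars_mult_le[of c p] unfolding q by blast
  then have "pvars q \<subseteq> ?W" using c p(2) by blast
  then obtain c1 c2 q0 g0 where *: "c = c1 * c2" "q = c1 * q0" "g = c2 * g0" "p = q0 * g0"
    using split_primes[OF c(1) pr c(2) q _ JW[OF g(1)] nz] by blast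
  have c2V: "c2 \<noteq> 0" "pvars c2 \<subseteq> V" using c * by (auto simp: pvars_mult)
  have cancel: "p dvd f" if "c \<noteq> 0" "pvars c \<subseteq> V" "pvars f \<subseteq> ?W" "p dvd c * f" for c f
    using irreducible_dvd_cancel[OF pr p that(1,2,3) _ that(4)] by blast
  have "q0 dvd 1 \<or> g0 dvd 1" using p(1) *(4) by (auto simp: irreducible_def)
  then show "p dvd a \<or> p dvd b"
  proof
    assume "g0 dvd 1"
    then have "pvars g0 = {}" "g0 \<noteq> 0" using pvars_dvd[of g0 1] by auto
    then have gV: "pvars g \<subseteq> V" using c2V * pvars_mult_le[of c2 g0] by auto
    obtain u v where "g = u * p + v * a" using g(1) unfolding J_def by blast
    then have "g * b = p * (u * b) + v * (a * b)" by (simp add: algebra_simps)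
    then have "p dvd g * b" using ab by simp
    then have "p dvd b" by (rule cancel[OF g(2) gV b])
    then show ?thesis ..
  next
    assume "q0 dvd 1"
    then obtain w where "1 = q0 * w" by (auto simp: dvd_def)
    then have "g = c2 * (q0 * w) * g0" using * by simp
    then have "g = p * (w * c2)" using * by (simp add: mult_ac)
    moreover obtain c' where c': "c' \<noteq> 0" "pvars c' \<subseteq> V" "g dvd c' * a" using gdvd[OF aJ] by blast
    ultimately have "p dvd c' * a" using dvd_mult_left by blast
    then have "p dvd a" by (rule cancel[OF c'(1,2) a])
    then show ?thesis ..
  qed
qed

lemma irreducible_prime_within:
  fixes p :: "('x::linorder, 'k::field) mpol"
  assumes "finite V" "irreducible p" "pvars p \<subseteq> V"
  shows "prime_within V p"
  using assms
proof (induction V arbitrary: p rule: finite_induct)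
  case empty
  then show ?case using no_pvars_is_unit[of p] by (auto simp: irreducible_def)
next
  case (insert x V)
  then show ?case
    using prime_within_insert[of V p x] prime_within_insert_new[of V x p] by (cases "pvars p \<subseteq> V") auto
qed

theorem mpol_irreducible_dvd_mult:
  fixes p :: "('x::{finite,linorder}, 'k::field) mpol"
  assumes "irreducible p" "p dvd a * b" shows "p dvd a \<or> p dvd b"
  using irreducible_prime_within[of UNIV p] assms by (auto simp: prime_within_def)

section \<open>Least common multiples\<close>

lemma irreducible_not_dvd_unit: "irreducible e \<Longrightarrow> u dvd 1 \<Longrightarrow> \<not> e dvd u"
  for e :: "'a::comm_semiring_1"
  using dvd_trans irreducible_def by blast

lemma irreducible_dvd_irreducible:
  fixes e p :: "'a::comm_semiring_1"
  assumes "irreducible p" "\<not> e dvd 1" "p = e * w"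
  shows "w dvd 1" and "p dvd e"
proof -
  show "w dvd 1" using assms by (auto simp: irreducible_def)
  then obtain v where "1 = w * v" by (auto simp: dvd_def)
  then have "e = e * (w * v)" by simp
  then have "e = p * v" by (simp only: assms(3) mult.assoc)
  then show "p dvd e" by simp
qed

text \<open>
  Finiteness of \<open>E\<close> matters: a product over an infinite set would be \<open>1\<close> by convention.
\<close>

lemma finite_irreducible_factors:
  fixes q :: "('x::{finite,linorder}, 'k::field) mpol"
  assumes "q \<noteq> 0"
  shows "\<exists>P. finite P \<and> (\<forall>e. irreducible e \<longrightarrow> e dvd q \<longrightarrow> (\<exists>p\<in>P. e dvd p \<and> p dvd e))"
  using assms
proof (induction q rule: irreducible_factor_induct)
  case (unit u)
  then show ?case using irreducible_not_dvd_unit by blast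
next
  case (mult p q)
  then obtain P where P: "finite P" "\<And>e. irreducible e \<Longrightarrow> e dvd q \<Longrightarrow> \<exists>p\<in>P. e dvd p \<and> p dvd e"
    by blast
  have "\<exists>p'\<in>insert p P. e dvd p' \<and> p' dvd e" if e: "irreducible e" "e dvd p * q" for e
  proof (cases "e dvd q")
    case False
    then have ep: "e dvd p" using mpol_irreducible_dvd_mult[OF e] by blast
    then obtain w where "p = e * w" by (auto simp: dvd_def)
    then have "p dvd e" using irreducible_dvd_irreducible(2)[OF mult.hyps(1)] e(1) irreducible_def by blast
    with ep show ?thesis by blast
  qed (use P e in blast)
  with P(1) show ?case by (meson finite_insert)
qed

lemma E_product_update:
  assumes "finite E" "e \<in> E"
  shows "E_product E f = e ^ f e * (\<Prod>e'\<in>E - {e}. e' ^ f e')"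
  unfolding E_product_def using assms by (rule prod.remove)

lemma E_product_add: "E_product E (\<lambda>e. f e + g e) = E_product E f * E_product E g"
  by (simp add: E_product_def power_add prod.distrib)

lemma const_coeff_mult:
  fixes p q :: "('x, 'k::comm_ring_1) mpol"
  shows "const_coeff (p * q) = const_coeff p * const_coeff q"
proof (induction p rule: poly_mapping_single_induct)
  case (add t c p)
  have "const_coeff (Poly_Mapping.single t c * q) = const_coeff (Poly_Mapping.single t c) * const_coeff q"
  proof (induction q rule: poly_mapping_single_induct)
    case (add u d q)
    have "t + u = 0 \<longleftrightarrow> t = 0 \<and> u = 0"
      by (auto simp: poly_mapping_eq_iff lookup_add fun_eq_iff)
    with add show ?case
      by (auto simp: const_coeff_def distrib_left mult_single lookup_add lookup_single when_def)
  qed (simp add: const_coeff_def)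
  with add show ?case by (simp add: const_coeff_def distrib_right lookup_add)
qed (simp add: const_coeff_def)

lemma const_coeff_0 [simp]: "const_coeff 0 = 0"
  and const_coeff_1 [simp]: "const_coeff 1 = 1"
  and const_coeff_add: "const_coeff (p + q) = const_coeff p + const_coeff q"
  and const_coeff_single [simp]: "const_coeff (Poly_Mapping.single 0 c) = c"
  by (simp_all add: const_coeff_def lookup_add)

lemma const_coeff_uminus: "const_coeff (- p) = - const_coeff (p :: ('x, 'k::comm_ring_1) mpol)"
  by (simp add: const_coeff_def)

lemma const_coeff_power: "const_coeff (p ^ n) = const_coeff p ^ n"
  for p :: "('x, 'k::comm_ring_1) mpol"
  by (induction n) (simp_all add: const_coeff_mult)

lemma tdeg_conv_UNIV: "tdeg t = (\<Sum>x\<in>UNIV. lookup t x)" for t :: "'x::finite \<Rightarrow>\<^sub>0 nat"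
  unfolding tdeg_def by (rule sum.mono_neutral_left) (auto simp: in_keys_iff)

text \<open>
  The total degree grading turns homogeneity into being a monomial in the new variable.
\<close>

lemma tgrade_homogeneous:
  assumes "homogeneous q" shows "\<exists>n. tgrade q = monom q n"
proof -
  obtain n where n: "\<And>t. t \<in> keys q \<Longrightarrow> tdeg t = n"
    using assms by (auto simp: homogeneous_def tdeg_conv_UNIV)
  have "tgrade q = monom q n"
  proof (intro poly_eqI poly_mapping_eqI)
    show "lookup (coeff (tgrade q) j) t = lookup (coeff (monom q n) j) t" for j t
      using n[of t] by (cases "t \<in> keys q") (auto simp: lookup_coeff_tgrade in_keys_iff)
  qed
  then show ?thesis ..
qed

lemma const_coeff_homogeneous:
  assumes "homogeneous q" "\<not> constant_poly q" shows "const_coeff q = 0"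
proof (rule ccontr)
  assume c: "const_coeff q \<noteq> 0"
  obtain n where n: "\<And>t. t \<in> keys q \<Longrightarrow> tdeg t = n"
    using assms by (auto simp: homogeneous_def tdeg_conv_UNIV)
  have "0 \<in> keys q" using c by (simp add: const_coeff_def in_keys_iff)
  with n have "n = 0" by (metis tdeg_eq_0_iff)
  with n have "keys q \<subseteq> {0}" using tdeg_eq_0_iff by blast
  then have "q = Poly_Mapping.single 0 (lookup q 0)"
    by (intro poly_mapping_eqI) (auto simp: lookup_single when_def in_keys_iff)
  with assms(2) show False by (auto simp: constant_poly_def)
qed

text \<open>
  If a factor \<open>e\<close> had a nonzero constant term, then the lowest term of the product \<open>q = e b\<close> would have
  the degree of the lowest term of \<open>b\<close>, while the top term of \<open>q\<close> has degree greater than that of \<open>b\<close> because \<open>e\<close> is not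
  a constant. For homogeneous \<open>q\<close> both degrees are equal.
\<close>

lemma homogeneous_factor_const_coeff:
  fixes q :: "('x::{finite,linorder}, 'k::field) mpol"
  assumes q: "homogeneous q" "q \<noteq> 0" and e: "e dvd q" "\<not> e dvd 1"
  shows "const_coeff e = 0"
proof (rule ccontr)
  assume c: "const_coeff e \<noteq> 0"
  obtain n where n: "tgrade q = monom q n" using tgrade_homogeneous q(1) by blast
  obtain b where b: "q = e * b" using e(1) by (auto simp: dvd_def)
  then have nz: "e \<noteq> 0" "b \<noteq> 0" using q(2) by auto
  have eb: "tgrade e * tgrade b = monom q n" using n by (simp add: b tgrade_mult)
  have e0: "coeff (tgrade e) 0 \<noteq> 0"
    using c lookup_coeff_tgrade[of e 0 0] by (auto simp: const_coeff_def tdeg_def)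
  define j where "j = (LEAST j. coeff (tgrade b) j \<noteq> 0)"
  have j: "coeff (tgrade b) j \<noteq> 0" unfolding j_def
    by (rule LeastI[of _ "degree (tgrade b)"]) (simp add: nz)
  have j': "coeff (tgrade b) i = 0" if "i < j" for i
    using not_less_Least[OF that[unfolded j_def]] by simp
  have "coeff (tgrade e * tgrade b) j = (\<Sum>i\<in>{0}. coeff (tgrade e) i * coeff (tgrade b) (j - i))"
    unfolding coeff_mult by (rule sum.mono_neutral_right) (auto simp: j')
  also have "\<dots> \<noteq> 0" using e0 j by simp
  finally have "j = n" by (auto simp: eb split: if_splits)
  then have "n \<le> degree (tgrade b)" using j le_degree by blast
  moreover have "degree (tgrade e) + degree (tgrade b) = n"
    using degree_mult_eq[of "tgrade e" "tgrade b"] nz q(2) by (simp add: eb degree_monom_eq)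
  moreover have "degree (tgrade e) > 0" using degree_tgrade_eq_0_imp_unit[of e] nz e(2) by blast
  ultimately show False by simp
qed

text \<open>
  A finite set of pairwise non-associated irreducible polynomials. In a factorial ring the exponents of a
  product of such elements are determined by the product.
\<close>

locale prime_basis =
  fixes E :: "('x::{finite,linorder}, 'k::field) mpol set"
  assumes finite_E: "finite E"
    and irreducible_E: "e \<in> E \<Longrightarrow> irreducible e"
    and dvd_E: "e \<in> E \<Longrightarrow> e' \<in> E \<Longrightarrow> e dvd e' \<Longrightarrow> e = e'"
begin

lemma E_dvd_prod:
  assumes "e \<in> E" "finite A" "A \<subseteq> E" "e dvd (\<Prod>e'\<in>A. e' ^ f e')"
  shows "e \<in> A"
  using assms(2-)
proof (induction A rule: finite_induct)
  case empty
  then show ?case using irreducible_E[OF assms(1)] by (auto simp: irreducible_def)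
next
  case (insert a A)
  have "a = e" if "e dvd a ^ n" for n
    using that
  proof (induction n)
    case 0
    then show ?case using irreducible_E[OF assms(1)] by (auto simp: irreducible_def)
  next
    case (Suc n)
    then show ?case
      using mpol_irreducible_dvd_mult[OF irreducible_E[OF assms(1)], of a "a ^ n"]
        dvd_E[OF assms(1), of a] insert.prems by auto
  qed
  moreover have "e dvd a ^ f a \<or> e dvd (\<Prod>e'\<in>A. e' ^ f e')"
    using mpol_irreducible_dvd_mult[OF irreducible_E[OF assms(1)]] insert by auto
  ultimately show ?case using insert by auto
qed

lemma E_product_nonzero [simp]: "E_product E f \<noteq> 0"
  using finite_E irreducible_E by (force simp: E_product_def)

text \<open>
  The cofactor \<open>M\<close> is allowed because the elements to be compared with products over \<open>E\<close> are arbitrary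
  common multiples, which need not be products over \<open>E\<close>.
\<close>

lemma E_product_dvd_imp_le:
  assumes dvd: "E_product E f dvd E_product E h * M" and M: "\<And>e. e \<in> E \<Longrightarrow> \<not> e dvd M"
    and e: "e \<in> E"
  shows "f e \<le> h e"
proof (rule ccontr)
  assume "\<not> f e \<le> h e"
  then have le: "Suc (h e) \<le> f e" by simp
  let ?R = "\<Prod>e'\<in>E - {e}. e' ^ h e'"
  have "e ^ Suc (h e) dvd e ^ f e" using le by (rule le_imp_power_dvd)
  also have "\<dots> dvd E_product E f" by (simp add: E_product_update[OF finite_E e])
  also have "\<dots> dvd e ^ h e * (?R * M)" using dvd by (simp add: E_product_update[OF finite_E e, of h] mult.assoc)
  finally have "e ^ h e * e dvd e ^ h e * (?R * M)" by (simp add: mult.commute)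
  moreover have "e \<noteq> 0" using irreducible_E[OF e] by auto
  ultimately have "e dvd ?R * M" by simp
  then have "e dvd ?R" using mpol_irreducible_dvd_mult[OF irreducible_E[OF e]] M[OF e] by blast
  then show False using E_dvd_prod[OF e, of "E - {e}" h] finite_E by auto
qed

lemma E_product_dvd_E_product: "(\<And>e. e \<in> E \<Longrightarrow> f e \<le> h e) \<Longrightarrow> E_product E f dvd E_product E h"
  unfolding E_product_def by (rule prod_dvd_prod) (auto intro: le_imp_power_dvd)

lemma E_not_dvd_unit: "e \<in> E \<Longrightarrow> u dvd 1 \<Longrightarrow> \<not> e dvd u"
  using irreducible_not_dvd_unit irreducible_E by blast

lemma E_product_dvd_iff: "E_product E f dvd E_product E h \<longleftrightarrow> (\<forall>e\<in>E. f e \<le> h e)"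
  using E_product_dvd_imp_le[of f h 1] E_not_dvd_unit[of _ 1] E_product_dvd_E_product[of f h] by auto

lemma E_product_eq_imp:
  assumes "E_product E f = E_product E h" "e \<in> E" shows "f e = h e"
  using E_product_dvd_iff[of f h] E_product_dvd_iff[of h f] assms by (metis dvd_refl le_antisym)

lemma E_decomposition:
  assumes "M \<noteq> 0"
  shows "\<exists>h M'. M = E_product E h * M' \<and> (\<forall>e\<in>E. \<not> e dvd M') \<and> (\<forall>e. e \<notin> E \<longrightarrow> h e = 0)"
  using assms
proof (induction M rule: irreducible_factor_induct)
  case (unit u)
  then show ?case by (intro exI[of _ "\<lambda>_. 0"] exI[of _ u]) (auto simp: E_product_def E_not_dvd_unit)
next
  case (mult p q)
  then obtain h M' where h: "q = E_product E h * M'" "\<forall>e\<in>E. \<not> e dvd M'" "\<forall>e. e \<notin> E \<longrightarrow> h e = 0"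
    by blast
  show ?case
  proof (cases "\<exists>e\<in>E. e dvd p")
    case True
    then obtain e w where e: "e \<in> E" "p = e * w" by (auto simp: dvd_def)
    have "\<not> e dvd 1" by (rule E_not_dvd_unit[OF e(1)]) simp
    then have w: "w dvd 1" using irreducible_dvd_irreducible(1)[OF mult.hyps(1)] e(2) by blast
    have "E_product E (h(e := Suc (h e))) = e * E_product E h"
      using e(1) by (simp add: E_product_update[OF finite_E e(1)] mult.assoc)
    then have "p * q = E_product E (h(e := Suc (h e))) * (w * M')"
      by (simp add: h(1) e(2) mult_ac)
    moreover have "\<forall>e\<in>E. \<not> e dvd w * M'"
      using h(2) mpol_irreducible_dvd_mult irreducible_E E_not_dvd_unit[OF _ w] by blast
    moreover have "\<forall>x. x \<notin> E \<longrightarrow> (h(e := Suc (h e))) x = 0" using h(3) e(1) by auto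
    ultimately show ?thesis by blast
  next
    case False
    have "\<forall>e\<in>E. \<not> e dvd p * M'"
      using h(2) mpol_irreducible_dvd_mult irreducible_E False by blast
    then show ?thesis using h by (intro exI[of _ h] exI[of _ "p * M'"]) (auto simp: mult_ac)
  qed
qed

lemma rk_E_product:
  assumes "\<And>e. e \<notin> E \<Longrightarrow> f e = 0" shows "rk E (E_product E f) = f"
  unfolding rk_def
proof (rule the_equality)
  fix g assume g: "(\<forall>e. e \<notin> E \<longrightarrow> g e = 0) \<and> E_product E f = E_product E g"
  show "g = f"
  proof
    show "g e = f e" for e
      using g assms E_product_eq_imp[of f g e] by (cases "e \<in> E") auto
  qed
qed (use assms in auto)

end

locale taylor_data =
  fixes Q :: "nat \<Rightarrow> ('x::{finite,linorder}, 'k::field) mpol" and m :: nat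
    and E :: "('x, 'k) mpol set"
  assumes hom: "i \<in> {1..m} \<Longrightarrow> homogeneous (Q i)" and nonconst: "i \<in> {1..m} \<Longrightarrow> \<not> constant_poly (Q i)"
    and reps: "factor_representatives (Q ` {1..m}) E"
begin

lemma Q_nonzero: "i \<in> {1..m} \<Longrightarrow> Q i \<noteq> 0"
  using nonconst[of i] unfolding constant_poly_def by (metis single_zero)

lemma E_unique:
  assumes "e \<in> E" "e' \<in> E" "e dvd e'" "e' dvd e" shows "e = e'"
proof -
  have "e \<in> irreducible_factors (Q ` {1..m})" using reps assms(1) by (auto simp: factor_representatives_def)
  then have "\<exists>!x. x \<in> E \<and> x dvd e \<and> e dvd x" using reps by (simp add: factor_representatives_def)
  then show ?thesis using assms by (metis dvd_refl)
qed

lemma E_factor: "e \<in> E \<Longrightarrow> irreducible e" "e \<in> E \<Longrightarrow> \<exists>i\<in>{1..m}. e dvd Q i"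
  using reps by (auto simp: factor_representatives_def irreducible_factors_def)

sublocale prime_basis E
proof
  show irr: "irreducible e" if "e \<in> E" for e using E_factor that by blast
  show "e = e'" if "e \<in> E" "e' \<in> E" "e dvd e'" for e e'
  proof -
    obtain w where "e' = e * w" using \<open>e dvd e'\<close> by (auto simp: dvd_def)
    then have "e' dvd e" using irreducible_dvd_irreducible(2)[OF irr[OF that(2)]] irr[OF that(1)]
      by (auto simp: irreducible_def)
    with that show ?thesis by (intro E_unique)
  qed
  have "\<forall>i\<in>{1..m}. \<exists>P. finite P \<and> (\<forall>e. irreducible e \<longrightarrow> e dvd Q i \<longrightarrow> (\<exists>p\<in>P. e dvd p \<and> p dvd e))"
    using finite_irreducible_factors Q_nonzero by blast
  then obtain P where P: "\<And>i. i \<in> {1..m} \<Longrightarrow> finite (P i)"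
    "\<And>i e. i \<in> {1..m} \<Longrightarrow> irreducible e \<Longrightarrow> e dvd Q i \<Longrightarrow> \<exists>p\<in>P i. e dvd p \<and> p dvd e"
    by metis
  have "\<forall>e\<in>E. \<exists>p\<in>(\<Union>i\<in>{1..m}. P i). e dvd p \<and> p dvd e"
  proof
    fix e assume e: "e \<in> E"
    then obtain i where i: "i \<in> {1..m}" "e dvd Q i" using E_factor(2) by blast
    from P(2)[OF i(1) irr[OF e] i(2)] i(1) show "\<exists>p\<in>(\<Union>i\<in>{1..m}. P i). e dvd p \<and> p dvd e" by blast
  qed
  then obtain g where g: "\<And>e. e \<in> E \<Longrightarrow> g e \<in> (\<Union>i\<in>{1..m}. P i) \<and> e dvd g e \<and> g e dvd e" by metis
  have "inj_on g E"
  proof (rule inj_onI)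
    fix e e' assume e: "e \<in> E" "e' \<in> E" "g e = g e'"
    have "e dvd g e" "g e dvd e" "e' dvd g e" "g e dvd e'" using g[OF e(1)] g[OF e(2)] e(3) by auto
    then show "e = e'" by (intro E_unique e) (blast intro: dvd_trans)+
  qed
  moreover have "g ` E \<subseteq> (\<Union>i\<in>{1..m}. P i)" using g by blast
  moreover have "finite (\<Union>i\<in>{1..m}. P i)" using P(1) by blast
  ultimately show "finite E" by (metis finite_subset finite_imageD)
qed

lemma const_coeff_E: "e \<in> E \<Longrightarrow> const_coeff e = 0"
  using E_factor[of e] homogeneous_factor_const_coeff hom Q_nonzero irreducible_def by blast

lemma const_coeff_E_product:
  "const_coeff (E_product E f) = (if \<forall>e\<in>E. f e = 0 then 1 else 0)"
proof (cases "\<forall>e\<in>E. f e = 0")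
  case True
  then show ?thesis by (simp add: E_product_def)
next
  case False
  then obtain e where "e \<in> E" "f e \<noteq> 0" by blast
  then show ?thesis using False
    by (simp add: E_product_update[OF finite_E] const_coeff_mult const_coeff_power const_coeff_E)
qed

text \<open>
  The part of \<open>Q i\<close> prime to \<open>E\<close> is a unit, since \<open>E\<close> represents all irreducible factors of \<open>Q i\<close>.
\<close>

lemma Q_factorization:
  assumes "i \<in> {1..m}"
  shows "\<exists>h. (\<forall>e. e \<notin> E \<longrightarrow> h e = 0) \<and> Q i dvd E_product E h \<and> E_product E h dvd Q i"
proof -
  obtain h u where h: "Q i = E_product E h * u" "\<forall>e\<in>E. \<not> e dvd u" "\<forall>e. e \<notin> E \<longrightarrow> h e = 0"
    using E_decomposition[OF Q_nonzero[OF assms]] by blast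
  have "u dvd 1"
  proof (rule ccontr)
    assume "\<not> u dvd 1"
    moreover have "u \<noteq> 0" using h(1) Q_nonzero[OF assms] by auto
    ultimately obtain p where p: "irreducible p" "p dvd u" using exists_irreducible_factor by blast
    then have "p dvd Q i" using h(1) by simp
    then have "p \<in> irreducible_factors (Q ` {1..m})" using p(1) assms by (auto simp: irreducible_factors_def)
    then obtain e where "e \<in> E" "e dvd p" using reps unfolding factor_representatives_def by blast
    then show False using h(2) p(2) dvd_trans by blast
  qed
  then obtain v where v: "1 = u * v" by (elim dvdE)
  have "E_product E h = Q i * v" by (simp add: h(1) mult.assoc flip: v)
  then have "Q i dvd E_product E h" by (rule dvdI)
  moreover have "E_product E h dvd Q i" by (simp add: h(1))
  ultimately show ?thesis using h(3) by blast
qed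

definition Qexp :: "nat \<Rightarrow> ('x, 'k) mpol \<Rightarrow> nat"
  where "Qexp i = (SOME h. (\<forall>e. e \<notin> E \<longrightarrow> h e = 0) \<and> Q i dvd E_product E h \<and> E_product E h dvd Q i)"

lemma Qexp:
  assumes "i \<in> {1..m}"
  shows "e \<notin> E \<Longrightarrow> Qexp i e = 0" "Q i dvd E_product E (Qexp i)" "E_product E (Qexp i) dvd Q i"
  using someI_ex[OF Q_factorization[OF assms], folded Qexp_def] by blast+

text \<open>
  The exponents of the least common multiple. The inserted \<open>0\<close> makes the maximum defined for the
  empty set, whose least common multiple is \<open>1\<close>.
\<close>

definition lexp :: "nat set \<Rightarrow> ('x, 'k) mpol \<Rightarrow> nat"
  where "lexp \<sigma> e = (if e \<in> E then Max (insert 0 ((\<lambda>i. Qexp i e) ` \<sigma>)) else 0)"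

lemma lexp_le_iff:
  "finite \<sigma> \<Longrightarrow> e \<in> E \<Longrightarrow> lexp \<sigma> e \<le> n \<longleftrightarrow> (\<forall>i\<in>\<sigma>. Qexp i e \<le> n)"
  by (simp add: lexp_def)

lemma lexp_Un: "finite \<sigma> \<Longrightarrow> finite \<tau> \<Longrightarrow> lexp (\<sigma> \<union> \<tau>) e = max (lexp \<sigma> e) (lexp \<tau> e)"
  using Max_Un[of "insert 0 ((\<lambda>i. Qexp i e) ` \<sigma>)" "insert 0 ((\<lambda>i. Qexp i e) ` \<tau>)"]
  by (simp add: lexp_def image_Un)

lemma Q_dvd_iff:
  assumes "i \<in> {1..m}" "M \<noteq> 0" "M = E_product E h * M'" "\<forall>e\<in>E. \<not> e dvd M'"
  shows "Q i dvd M \<longleftrightarrow> (\<forall>e\<in>E. Qexp i e \<le> h e)"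
proof
  assume "Q i dvd M"
  then have "E_product E (Qexp i) dvd E_product E h * M'" using Qexp(3)[OF assms(1)] assms(3) dvd_trans by blast
  then show "\<forall>e\<in>E. Qexp i e \<le> h e" using E_product_dvd_imp_le assms(4) by blast
next
  assume "\<forall>e\<in>E. Qexp i e \<le> h e"
  then have "E_product E (Qexp i) dvd M" using assms(3) E_product_dvd_iff by (simp add: dvd_mult2)
  then show "Q i dvd M" using Qexp(2)[OF assms(1)] dvd_trans by blast
qed

lemma is_lcm_lexp:
  assumes \<sigma>: "\<sigma> \<subseteq> {1..m}" shows "is_lcm (Q ` \<sigma>) (E_product E (lexp \<sigma>))"
  unfolding is_lcm_def
proof (intro conjI allI impI ballI)
  have fin: "finite \<sigma>" using \<sigma> finite_subset by blast
  fix q assume "q \<in> Q ` \<sigma>"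
  then obtain i where i: "i \<in> \<sigma>" "q = Q i" by blast
  have "\<forall>e\<in>E. Qexp i e \<le> lexp \<sigma> e" using lexp_le_iff[OF fin] i(1) by blast
  then show "q dvd E_product E (lexp \<sigma>)"
    unfolding i(2) using Q_dvd_iff[of i "E_product E (lexp \<sigma>)" "lexp \<sigma>" 1] i(1) \<sigma> E_not_dvd_unit by auto
next
  have fin: "finite \<sigma>" using \<sigma> finite_subset by blast
  fix M assume M: "\<forall>q\<in>Q ` \<sigma>. q dvd M"
  show "E_product E (lexp \<sigma>) dvd M"
  proof (cases "M = 0")
    case False
    obtain h M' where h: "M = E_product E h * M'" "\<forall>e\<in>E. \<not> e dvd M'"
      using E_decomposition[OF False] by blast
    have "\<forall>i\<in>\<sigma>. \<forall>e\<in>E. Qexp i e \<le> h e" using M Q_dvd_iff[OF _ False h] \<sigma> by blast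
    then have "E_product E (lexp \<sigma>) dvd E_product E h"
      unfolding E_product_dvd_iff using lexp_le_iff[OF fin] by blast
    then show ?thesis by (simp add: h(1))
  qed simp
qed

lemma Qlcm_eq:
  assumes "\<sigma> \<subseteq> {1..m}" shows "Qlcm E Q \<sigma> = E_product E (lexp \<sigma>)"
  unfolding Qlcm_def
proof (rule the_equality)
  fix L assume L: "is_lcm (Q ` \<sigma>) L \<and> (\<exists>f. L = E_product E f)"
  then obtain f where f: "L = E_product E f" by blast
  have "L dvd E_product E (lexp \<sigma>)" "E_product E (lexp \<sigma>) dvd L"
    using L is_lcm_lexp[OF assms] by (auto simp: is_lcm_def)
  then have "\<forall>e\<in>E. f e = lexp \<sigma> e" unfolding f E_product_dvd_iff by (simp add: order_antisym)
  then show "L = E_product E (lexp \<sigma>)" unfolding f E_product_def by (auto intro: prod.cong)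
qed (use is_lcm_lexp[OF assms] in blast)

lemma Qlcm_nonzero: "\<sigma> \<subseteq> {1..m} \<Longrightarrow> Qlcm E Q \<sigma> \<noteq> 0"
  by (simp add: Qlcm_eq)

lemma Qlcm_empty [simp]: "Qlcm E Q {} = 1"
  by (simp add: Qlcm_eq E_product_def lexp_def)

lemma rk_Qlcm: "\<sigma> \<subseteq> {1..m} \<Longrightarrow> rk E (Qlcm E Q \<sigma>) = lexp \<sigma>"
  unfolding Qlcm_eq by (rule rk_E_product) (simp add: lexp_def)

lemma E_product_quotient:
  assumes "\<And>e. f e \<le> g e"
  shows "E_product E g = E_product E (\<lambda>e. g e - f e) * E_product E f"
  using E_product_add[of E "\<lambda>e. g e - f e" f] assms by simp

lemma lexp_outside: "e \<notin> E \<Longrightarrow> lexp \<sigma> e = 0"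
  by (simp add: lexp_def)

text \<open>
  The exponents of the quotient are the differences of exponents, so the quotient has a nonzero
  constant term only if all of them vanish.
\<close>

lemma Qlcm_quotient:
  assumes \<tau>: "\<tau> \<subseteq> \<sigma>" and \<sigma>: "\<sigma> \<subseteq> {1..m}"
  shows "\<exists>c. Qlcm E Q \<sigma> = c * Qlcm E Q \<tau> \<and> const_coeff c = (if Qlcm E Q \<tau> = Qlcm E Q \<sigma> then 1 else 0)"
proof -
  have \<tau>m: "\<tau> \<subseteq> {1..m}" using \<sigma> \<tau> by blast
  have fin: "finite \<sigma>" "finite \<tau>" by (rule finite_subset[OF \<sigma>] finite_subset[OF \<tau>m]; simp)+
  have le: "lexp \<tau> e \<le> lexp \<sigma> e" for e
  proof (cases "e \<in> E")
    case True
    have "\<forall>i\<in>\<sigma>. Qexp i e \<le> lexp \<sigma> e" using lexp_le_iff[OF fin(1) True] by blast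
    then show ?thesis unfolding lexp_le_iff[OF fin(2) True] using \<tau> by blast
  qed (simp add: lexp_outside)
  have "Qlcm E Q \<tau> = Qlcm E Q \<sigma> \<longleftrightarrow> (\<forall>e\<in>E. lexp \<sigma> e - lexp \<tau> e = 0)"
  proof
    assume "Qlcm E Q \<tau> = Qlcm E Q \<sigma>"
    then have "rk E (Qlcm E Q \<tau>) = rk E (Qlcm E Q \<sigma>)" by simp
    then show "\<forall>e\<in>E. lexp \<sigma> e - lexp \<tau> e = 0" by (simp add: rk_Qlcm[OF \<tau>m] rk_Qlcm[OF \<sigma>])
  next
    assume "\<forall>e\<in>E. lexp \<sigma> e - lexp \<tau> e = 0"
    then have "lexp \<tau> e = lexp \<sigma> e" for e using le[of e] lexp_outside[of e] by (cases "e \<in> E") auto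
    then have "lexp \<tau> = lexp \<sigma>" by (rule ext)
    then show "Qlcm E Q \<tau> = Qlcm E Q \<sigma>" by (simp add: Qlcm_eq[OF \<tau>m] Qlcm_eq[OF \<sigma>])
  qed
  then show ?thesis
    using E_product_quotient[of "lexp \<tau>" "lexp \<sigma>", OF le]
    by (intro exI[of _ "E_product E (\<lambda>e. lexp \<sigma> e - lexp \<tau> e)"])
      (simp add: Qlcm_eq[OF \<sigma>] Qlcm_eq[OF \<tau>m] const_coeff_E_product)
qed

text \<open>
  The exponent vector of the least common multiple is at most the sum of the two vectors, and the
  quotient has a nonzero constant term only if it is equal to the sum.
\<close>

lemma Qlcm_product_quotient:
  assumes \<sigma>: "\<sigma> \<subseteq> {1..m}" and \<tau>: "\<tau> \<subseteq> {1..m}"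
  shows "\<exists>c. Qlcm E Q \<sigma> * Qlcm E Q \<tau> = c * Qlcm E Q (\<sigma> \<union> \<tau>) \<and>
    const_coeff c = (if rk E (Qlcm E Q (\<sigma> \<union> \<tau>)) = (\<lambda>e. rk E (Qlcm E Q \<sigma>) e + rk E (Qlcm E Q \<tau>) e)
      then 1 else 0)"
proof -
  have fin: "finite \<sigma>" "finite \<tau>" by (rule finite_subset[OF \<sigma>] finite_subset[OF \<tau>]; simp)+
  have un: "\<sigma> \<union> \<tau> \<subseteq> {1..m}" using \<sigma> \<tau> by blast
  let ?g = "\<lambda>e. lexp \<sigma> e + lexp \<tau> e"
  have le: "lexp (\<sigma> \<union> \<tau>) e \<le> ?g e" for e by (simp add: lexp_Un[OF fin])
  have "lexp (\<sigma> \<union> \<tau>) = ?g \<longleftrightarrow> (\<forall>e\<in>E. ?g e - lexp (\<sigma> \<union> \<tau>) e = 0)"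
  proof
    assume *: "\<forall>e\<in>E. ?g e - lexp (\<sigma> \<union> \<tau>) e = 0"
    show "lexp (\<sigma> \<union> \<tau>) = ?g"
    proof
      show "lexp (\<sigma> \<union> \<tau>) e = ?g e" for e
        using * le[of e] lexp_outside[of e] by (cases "e \<in> E") (auto intro: antisym)
    qed
  qed simp
  then show ?thesis
    using E_product_quotient[of "lexp (\<sigma> \<union> \<tau>)" ?g, OF le]
    unfolding rk_Qlcm[OF \<sigma>] rk_Qlcm[OF \<tau>] rk_Qlcm[OF un]
    unfolding Qlcm_eq[OF \<sigma>] Qlcm_eq[OF \<tau>] Qlcm_eq[OF un]
    by (intro exI[of _ "E_product E (\<lambda>e. ?g e - lexp (\<sigma> \<union> \<tau>) e)"])
      (simp add: const_coeff_E_product E_product_add)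
qed

lemma Q_nonunit: "i \<in> {1..m} \<Longrightarrow> \<exists>e\<in>E. Qexp i e > 0"
proof (rule ccontr)
  assume i: "i \<in> {1..m}" and "\<not> (\<exists>e\<in>E. Qexp i e > 0)"
  then have "E_product E (Qexp i) = 1" by (simp add: E_product_def)
  then obtain v where "1 = Q i * v" using Qexp(2)[OF i] by (auto simp: dvd_def)
  then have "const_coeff (Q i * v) = 1" by simp
  then show False using const_coeff_homogeneous[OF hom nonconst] i by (simp add: const_coeff_mult)
qed

text \<open>
  A common element \<open>i\<close> contributes to both ranks but only once to their maximum. So overlapping sets
  have product \<open>0\<close> in \<open>\<Delta>(D)\<close>, as in Taylor's multiplication.
\<close>

lemma rk_Un_noteq:
  assumes \<sigma>: "\<sigma> \<subseteq> {1..m}" and \<tau>: "\<tau> \<subseteq> {1..m}" and i: "i \<in> \<sigma> \<inter> \<tau>"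
  shows "rk E (Qlcm E Q (\<sigma> \<union> \<tau>)) \<noteq> (\<lambda>e. rk E (Qlcm E Q \<sigma>) e + rk E (Qlcm E Q \<tau>) e)"
proof
  have fin: "finite \<sigma>" "finite \<tau>" by (rule finite_subset[OF \<sigma>] finite_subset[OF \<tau>]; simp)+
  obtain e where e: "e \<in> E" "Qexp i e > 0" using Q_nonunit i \<sigma> by blast
  have "Qexp i e \<le> lexp \<sigma> e" "Qexp i e \<le> lexp \<tau> e" using lexp_le_iff fin e(1) i by blast+
  moreover assume "rk E (Qlcm E Q (\<sigma> \<union> \<tau>)) = (\<lambda>e. rk E (Qlcm E Q \<sigma>) e + rk E (Qlcm E Q \<tau>) e)"
  then have "lexp (\<sigma> \<union> \<tau>) e = lexp \<sigma> e + lexp \<tau> e"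
    using rk_Qlcm[OF \<sigma>] rk_Qlcm[OF \<tau>] rk_Qlcm[of "\<sigma> \<union> \<tau>"] \<sigma> \<tau> by (simp add: fun_eq_iff)
  ultimately show False using e(2) by (simp add: lexp_Un[OF fin])
qed

end

section \<open>Free resolutions and comparison maps\<close>

lemma linear_map_onD:
  assumes "linear_map_on s s' M N f"
  shows "x \<in> M \<Longrightarrow> f x \<in> N" "x \<in> M \<Longrightarrow> y \<in> M \<Longrightarrow> f (x + y) = f x + f y"
    "x \<in> M \<Longrightarrow> f (s r x) = s' r (f x)"
  using assms by (simp_all add: linear_map_on_def)

lemma linear_map_on_0:
  fixes f :: "'a::ab_group_add \<Rightarrow> 'b::ab_group_add"
  assumes "linear_map_on s s' M N f" "0 \<in> M" shows "f 0 = 0"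
  using linear_map_onD(2)[OF assms(1), of 0 0] assms(2) by simp

lemma linear_map_on_diff:
  fixes f :: "'a::ab_group_add \<Rightarrow> 'b::ab_group_add"
  assumes "linear_map_on s s' M N f" "module s" "module.subspace s M" "x \<in> M" "y \<in> M"
  shows "f (x - y) = f x - f y"
proof -
  interpret module s by fact
  have "f (x - y + y) = f (x - y) + f y"
    using linear_map_onD(2)[OF assms(1) subspace_diff[OF assms(3-5)] assms(5)] .
  then show ?thesis by (simp add: algebra_simps)
qed

lemma linear_map_on_sum:
  fixes f :: "'a::ab_group_add \<Rightarrow> 'b::ab_group_add"
  assumes f: "linear_map_on s s' M N f" and "module s" "module.subspace s M" and g: "\<And>a. a \<in> A \<Longrightarrow> g a \<in> M"
  shows "f (sum g A) = (\<Sum>a\<in>A. f (g a))"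
proof -
  interpret module s by fact
  show ?thesis using g
  proof (induction A rule: infinite_finite_induct)
    case (insert a A)
    then have "sum g A \<in> M" by (intro subspace_sum[OF assms(3)]) auto
    with insert show ?case by (simp add: linear_map_onD(2)[OF f])
  qed (auto intro!: linear_map_on_0[OF f] subspace_0[OF assms(3)])
qed

lemma linear_map_on_compose:
  "linear_map_on s s' M N f \<Longrightarrow> linear_map_on s' s'' N L g \<Longrightarrow> linear_map_on s s'' M L (\<lambda>x. g (f x))"
  by (simp add: linear_map_on_def)

lemma linear_map_on_minus:
  fixes f g :: "'a::ab_group_add \<Rightarrow> 'b::ab_group_add"
  assumes f: "linear_map_on s s' M N f" and g: "linear_map_on s s' M N g"
    and "module s'" and N: "module.subspace s' N"
  shows "linear_map_on s s' M N (\<lambda>x. f x - g x)"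
proof -
  interpret module s' by fact
  show ?thesis unfolding linear_map_on_def
    by (auto simp: linear_map_onD[OF f] linear_map_onD[OF g] scale_right_diff_distrib
      intro: subspace_diff[OF N])
qed

lemma free_extension:
  fixes s :: "'r::comm_ring_1 \<Rightarrow> 'm::ab_group_add \<Rightarrow> 'm" and s' :: "'r \<Rightarrow> 'n::ab_group_add \<Rightarrow> 'n"
  assumes "module s" "module s'" and indep: "\<not> module.dependent s B"
    and G: "module.subspace s' G" and c: "\<And>b. b \<in> B \<Longrightarrow> c b \<in> G"
  shows "\<exists>h. linear_map_on s s' (module.span s B) G h \<and> (\<forall>b\<in>B. h b = c b)"
proof -
  interpret M: module s by fact
  interpret N: module s' by fact
  let ?R = "M.representation B"
  define h where "h v = (\<Sum>b | ?R v b \<noteq> 0. s' (?R v b) (c b))" for v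
  have h: "h v = (\<Sum>b\<in>S. s' (?R v b) (c b))" if "finite S" "{b. ?R v b \<noteq> 0} \<subseteq> S" for v S
    unfolding h_def using that by (intro sum.mono_neutral_left) auto
  note fin = M.finite_representation[of B]
  have "linear_map_on s s' (M.span B) G h"
    unfolding linear_map_on_def
  proof (intro conjI ballI allI)
    fix v assume "v \<in> M.span B"
    show "h v \<in> G" unfolding h_def
      by (rule N.subspace_sum[OF G]) (auto intro!: N.subspace_scale[OF G] c dest: M.representation_ne_zero)
  next
    fix x y assume xy: "x \<in> M.span B" "y \<in> M.span B"
    let ?S = "{b. ?R x b \<noteq> 0} \<union> {b. ?R y b \<noteq> 0}"
    have S: "finite ?S" using fin by simp
    have sub: "{b. ?R (x + y) b \<noteq> 0} \<subseteq> ?S"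
      unfolding M.representation_add[OF indep xy(2,1)] by auto
    show "h (x + y) = h x + h y"
      using h[OF S sub] h[OF S, of x] h[OF S, of y]
      by (simp add: M.representation_add[OF indep xy(2,1)] N.scale_left_distrib sum.distrib)
  next
    fix r x assume x: "x \<in> M.span B"
    have sub: "{b. ?R (s r x) b \<noteq> 0} \<subseteq> {b. ?R x b \<noteq> 0}"
      using M.representation_scale[OF indep x] by auto
    show "h (s r x) = s' r (h x)"
      using h[OF fin sub] by (simp add: h_def M.representation_scale[OF indep x] N.scale_sum_right)
  qed
  moreover have "h b = c b" if "b \<in> B" for b
    using h[of "{b}" b] by (simp add: M.representation_basis[OF indep that])
  ultimately show ?thesis by blast
qed

text \<open>
  Free modules are projective. This extends chain maps and homotopies from one degree to the next.
\<close>

lemma free_on_lift: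
  fixes s :: "'r::comm_ring_1 \<Rightarrow> 'm::ab_group_add \<Rightarrow> 'm" and s' :: "'r \<Rightarrow> 'n::ab_group_add \<Rightarrow> 'n"
  assumes s: "module s" and s': "module s'" and free: "free_on s M"
    and G: "module.subspace s' G" and D: "linear_map_on s' s' G N D" and g: "linear_map_on s s' M N g"
    and im: "\<And>x. x \<in> M \<Longrightarrow> g x \<in> D ` G"
  shows "\<exists>h. linear_map_on s s' M G h \<and> (\<forall>x\<in>M. D (h x) = g x)"
proof -
  interpret M: module s by fact
  interpret N: module s' by fact
  obtain B where B: "\<not> M.dependent B" "M.span B = M" using free by (auto simp: free_on_def)
  have "\<exists>y\<in>G. D y = g b" if "b \<in> B" for b
  proof -
    have "g b \<in> D ` G" using im M.span_base[OF that] unfolding B(2) .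
    then show ?thesis by auto
  qed
  then obtain c where c: "\<And>b. b \<in> B \<Longrightarrow> c b \<in> G \<and> D (c b) = g b" by metis
  obtain h where h: "linear_map_on s s' M G h" "\<forall>b\<in>B. h b = c b"
    using free_extension[OF s s' B(1) G, of c] c B(2) by blast
  have M: "M.subspace M" using B(2) M.subspace_span by blast
  have zero: "D (h 0) = g 0"
    using linear_map_on_0[OF h(1) M.subspace_0[OF M]] linear_map_on_0[OF g M.subspace_0[OF M]]
      linear_map_on_0[OF D N.subspace_0[OF G]] by simp
  have "x \<in> M \<and> D (h x) = g x" if "x \<in> M.span B" for x
    using that
  proof (induction rule: M.span_induct)
    case base
    show ?case
      unfolding M.subspace_def
      by (auto simp: linear_map_onD[OF h(1)] linear_map_onD[OF g] linear_map_onD[OF D]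
        zero M.subspace_0[OF M] M.subspace_add[OF M] M.subspace_scale[OF M])
  next
    case (step x)
    then show ?case using h(2) c M.span_base[OF step] unfolding B(2) by simp
  qed
  then show ?thesis using h(1) B(2) by blast
qed

text \<open>
  The three closure conditions say that \<open>I\<close> is an ideal.
\<close>

locale resolution =
  fixes s :: "'r::comm_ring_1 \<Rightarrow> 'm::ab_group_add \<Rightarrow> 'm" and F d \<epsilon> I
  assumes res: "free_resolution s F d \<epsilon> I"
    and I0: "0 \<in> I" and I_add: "a \<in> I \<Longrightarrow> b \<in> I \<Longrightarrow> a + b \<in> I" and I_mult: "a \<in> I \<Longrightarrow> r * a \<in> I"
begin

lemma module_s: "module s" using res by (simp add: free_resolution_def)

sublocale module s by (rule module_s)

lemma free: "free_on s (F p)" using res by (simp add: free_resolution_def)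

lemma subspace_F: "subspace (F p)"
  using free[of p] unfolding free_on_def by (metis subspace_span)

lemma F_closed: "0 \<in> F p" "x \<in> F p \<Longrightarrow> y \<in> F p \<Longrightarrow> x + y \<in> F p" "x \<in> F p \<Longrightarrow> y \<in> F p \<Longrightarrow> x - y \<in> F p"
    "x \<in> F p \<Longrightarrow> - x \<in> F p" "x \<in> F p \<Longrightarrow> s r x \<in> F p"
  by (simp_all add: subspace_0 subspace_add subspace_diff subspace_neg subspace_scale subspace_F)

lemma linear_d: "linear_map_on s s (F (Suc p)) (F p) (d (Suc p))"
  using res by (simp add: free_resolution_def)

lemma d_0 [simp]: "x \<in> F 0 \<Longrightarrow> d 0 x = 0"
  using res by (simp add: free_resolution_def)

lemma linear_d': "linear_map_on s s (F p) (F (p - 1)) (d p)"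
proof (cases p)
  case 0
  then show ?thesis by (auto simp: linear_map_on_def F_closed)
next
  case (Suc q)
  then show ?thesis using linear_d[of q] by simp
qed

lemma d_d: "x \<in> F (Suc p) \<Longrightarrow> d p (d (Suc p) x) = 0"
proof (cases p)
  case 0
  then show "x \<in> F (Suc p) \<Longrightarrow> ?thesis" using linear_map_onD(1)[OF linear_d, of x 0] by simp
next
  case (Suc q)
  have "{x \<in> F (Suc q). d (Suc q) x = 0} = d (Suc (Suc q)) ` F (Suc (Suc q))"
    using res by (simp add: free_resolution_def)
  then show "x \<in> F (Suc p) \<Longrightarrow> ?thesis" using Suc by blast
qed

lemma exact:
  assumes "x \<in> F (Suc p)" "d (Suc p) x = 0" shows "x \<in> d (Suc (Suc p)) ` F (Suc (Suc p))"
proof -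
  have "{x \<in> F (Suc p). d (Suc p) x = 0} = d (Suc (Suc p)) ` F (Suc (Suc p))"
    using res by (simp add: free_resolution_def)
  then show ?thesis using assms by blast
qed

lemma exact_0: "x \<in> F 0 \<and> \<epsilon> x = I \<longleftrightarrow> x \<in> d 1 ` F 1"
proof -
  have "{x \<in> F 0. \<epsilon> x = I} = d 1 ` F 1" using res by (simp add: free_resolution_def)
  then show ?thesis by blast
qed

lemma eps_image: "\<epsilon> ` F 0 = {a +o I | a. True}"
  using res by (simp add: free_resolution_def)

lemma eps_surj: "\<exists>x\<in>F 0. \<epsilon> x = a +o I"
proof -
  have "a +o I \<in> \<epsilon> ` F 0" unfolding eps_image by auto
  then show ?thesis by (metis imageE)
qed

lemma eps_coset: "x \<in> F 0 \<Longrightarrow> \<exists>a. \<epsilon> x = a +o I"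
  using eps_image by blast

lemma eps_add: "x \<in> F 0 \<Longrightarrow> y \<in> F 0 \<Longrightarrow> \<epsilon> x = a +o I \<Longrightarrow> \<epsilon> y = b +o I \<Longrightarrow> \<epsilon> (x + y) = (a + b) +o I"
  using res by (simp add: free_resolution_def)

lemma eps_scale: "x \<in> F 0 \<Longrightarrow> \<epsilon> x = a +o I \<Longrightarrow> \<epsilon> (s r x) = (r * a) +o I"
  using res by (simp add: free_resolution_def)

lemma coset_eq_iff: "a +o I = b +o I \<longleftrightarrow> a - b \<in> I"
proof
  assume "a +o I = b +o I"
  moreover have "a \<in> a +o I" using I0 by (force simp: elt_set_plus_def)
  ultimately show "a - b \<in> I" by (auto simp: elt_set_plus_def)
next
  have neg: "- x \<in> I" if "x \<in> I" for x using I_mult[OF that, of "- 1"] by simp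
  have sub: "a +o I \<subseteq> b +o I" if "a - b \<in> I" for a b
  proof
    fix x assume "x \<in> a +o I"
    then obtain i where "i \<in> I" "x = a + i" by (auto simp: elt_set_plus_def)
    then have "x = b + ((a - b) + i)" "(a - b) + i \<in> I" using that I_add by auto
    then show "x \<in> b +o I" unfolding elt_set_plus_def by blast
  qed
  assume "a - b \<in> I"
  then show "a +o I = b +o I" using sub[of a b] sub[of b a] neg[of "a - b"] by auto
qed

lemma eps_0: "\<epsilon> 0 = I"
proof -
  have "0 = d 1 0" using linear_map_on_0[OF linear_d F_closed(1), of 0] by simp
  then have "(0::'m) \<in> d 1 ` F 1" using F_closed(1)[of 1] by blast
  then show ?thesis using exact_0 by blast
qed

lemma eps_diff_eq:
  assumes "x \<in> F 0" "y \<in> F 0" "\<epsilon> x = \<epsilon> y" shows "\<epsilon> (x - y) = I"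
proof -
  obtain a where a: "\<epsilon> x = a +o I" using eps_coset[OF assms(1)] by blast
  have "\<epsilon> (s (- 1) y) = (- 1 * a) +o I" using eps_scale[OF assms(2)] a assms(3) by metis
  then have "\<epsilon> (- y) = (- a) +o I" by (simp add: scale_minus_left)
  then have "\<epsilon> (x + - y) = (a + - a) +o I" by (intro eps_add assms a F_closed)
  then show ?thesis by simp
qed

end

text \<open>
  The chain map is built degree by degree. The condition carried along besides compatibility is that
  cycles go to boundaries; it makes the composite with the differential liftable in the next degree.
\<close>

theorem comparison_map_exists:
  assumes "resolution s F d \<epsilon> I" "resolution s' F' d' \<epsilon>' I"
  shows "\<exists>\<phi>. comparison_map s F d \<epsilon> s' F' d' \<epsilon>' \<phi>"
proof -
  interpret X: resolution s F d \<epsilon> I by fact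
  interpret Y: resolution s' F' d' \<epsilon>' I by fact
  let ?cyc = "\<lambda>n x. if n = 0 then \<epsilon> x = I else d n x = 0"
  let ?P = "\<lambda>n f. linear_map_on s s' (F n) (F' n) f \<and> (n = 0 \<longrightarrow> (\<forall>x\<in>F 0. \<epsilon>' (f x) = \<epsilon> x)) \<and>
      (\<forall>x\<in>F n. ?cyc n x \<longrightarrow> f x \<in> d' (Suc n) ` F' (Suc n))"
  have "\<exists>\<phi>. \<forall>n. ?P n (\<phi> n) \<and> (\<forall>x\<in>F (Suc n). \<phi> n (d (Suc n) x) = d' (Suc n) (\<phi> (Suc n) x))"
  proof (rule dependent_nat_choice)
    obtain B where B: "\<not> X.dependent B" "X.span B = F 0" using X.free[of 0] by (auto simp: free_on_def)
    have "\<exists>y\<in>F' 0. \<epsilon>' y = \<epsilon> b" if bB: "b \<in> B" for b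
    proof -
      obtain a where "\<epsilon> b = a +o I" using X.eps_coset X.span_base[OF bB] unfolding B(2) by blast
      then show ?thesis using Y.eps_surj[of a] by simp
    qed
    then obtain c where c: "\<And>b. b \<in> B \<Longrightarrow> c b \<in> F' 0 \<and> \<epsilon>' (c b) = \<epsilon> b" by metis
    obtain h where h: "linear_map_on s s' (F 0) (F' 0) h" "\<forall>b\<in>B. h b = c b"
      using free_extension[OF X.module_s Y.module_s B(1) Y.subspace_F, of c 0] c B(2) by auto
    have "x \<in> F 0 \<and> \<epsilon>' (h x) = \<epsilon> x" if "x \<in> X.span B" for x
      using that
    proof (induction rule: X.span_induct)
      case base
      have "\<epsilon>' (h (x + y)) = \<epsilon> (x + y)"
        if xy: "x \<in> F 0" "\<epsilon>' (h x) = \<epsilon> x" "y \<in> F 0" "\<epsilon>' (h y) = \<epsilon> y" for x y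
      proof -
        obtain a b where ab: "\<epsilon> x = a +o I" "\<epsilon> y = b +o I" using X.eps_coset[OF xy(1)] X.eps_coset[OF xy(3)] by blast
        have "\<epsilon>' (h x + h y) = (a + b) +o I"
          by (rule Y.eps_add) (use xy ab linear_map_onD(1)[OF h(1)] in auto)
        also have "\<dots> = \<epsilon> (x + y)" by (rule X.eps_add[symmetric]) (use xy ab in auto)
        finally show ?thesis using linear_map_onD(2)[OF h(1)] xy by simp
      qed
      moreover have "\<epsilon>' (h (s r x)) = \<epsilon> (s r x)" if x: "x \<in> F 0" "\<epsilon>' (h x) = \<epsilon> x" for r x
      proof -
        obtain a where a: "\<epsilon> x = a +o I" using X.eps_coset[OF x(1)] by blast
        have "\<epsilon>' (s' r (h x)) = (r * a) +o I"
          by (rule Y.eps_scale) (use x a linear_map_onD(1)[OF h(1)] in auto)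
        also have "\<dots> = \<epsilon> (s r x)" by (rule X.eps_scale[symmetric]) (use x a in auto)
        finally show ?thesis using linear_map_onD(3)[OF h(1)] x by simp
      qed
      moreover have "\<epsilon>' (h 0) = \<epsilon> 0"
        using linear_map_on_0[OF h(1) X.F_closed(1)] X.eps_0 Y.eps_0 by simp
      ultimately show ?case unfolding X.subspace_def by (auto intro: X.F_closed)
    next
      case (step x)
      then show ?case using h(2) c X.span_base[OF step] unfolding B(2) by simp
    qed
    then have eps: "\<forall>x\<in>F 0. \<epsilon>' (h x) = \<epsilon> x" using B(2) by blast
    then have "\<forall>x\<in>F 0. \<epsilon> x = I \<longrightarrow> h x \<in> d' (Suc 0) ` F' (Suc 0)"
      using Y.exact_0 linear_map_onD(1)[OF h(1)] by (metis One_nat_def)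
    with h(1) eps show "\<exists>h. ?P 0 h" by auto
  next
    fix n f assume P: "?P n f"
    have lin: "linear_map_on s s' (F (Suc n)) (F' n) (\<lambda>x. f (d (Suc n) x))"
      using X.linear_d P linear_map_on_compose by blast
    have "f (d (Suc n) x) \<in> d' (Suc n) ` F' (Suc n)" if x: "x \<in> F (Suc n)" for x
    proof -
      have "d (Suc n) x \<in> F n" using linear_map_onD(1)[OF X.linear_d x] .
      moreover have "?cyc n (d (Suc n) x)" using X.d_d[OF x] X.exact_0 x by auto
      ultimately show ?thesis using P by blast
    qed
    then obtain g where g: "linear_map_on s s' (F (Suc n)) (F' (Suc n)) g"
      "\<forall>x\<in>F (Suc n). d' (Suc n) (g x) = f (d (Suc n) x)"
      using free_on_lift[OF X.module_s Y.module_s X.free Y.subspace_F Y.linear_d lin] by blast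
    have "g x \<in> d' (Suc (Suc n)) ` F' (Suc (Suc n))" if x: "x \<in> F (Suc n)" "d (Suc n) x = 0" for x
    proof (rule Y.exact)
      show "g x \<in> F' (Suc n)" using linear_map_onD(1)[OF g(1) x(1)] .
      have "d' (Suc n) (g x) = f 0" using g(2) x by auto
      also have "f 0 = 0" using linear_map_on_0 P X.F_closed(1) by blast
      finally show "d' (Suc n) (g x) = 0" .
    qed
    with g show "\<exists>g. ?P (Suc n) g \<and> (\<forall>x\<in>F (Suc n). f (d (Suc n) x) = d' (Suc n) (g x))"
      by (intro exI[of _ g]) auto
  qed
  then obtain \<phi> where \<phi>: "\<And>n. ?P n (\<phi> n) \<and> (\<forall>x\<in>F (Suc n). \<phi> n (d (Suc n) x) = d' (Suc n) (\<phi> (Suc n) x))"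
    by blast
  then have "comparison_map s F d \<epsilon> s' F' d' \<epsilon>' \<phi>"
    unfolding comparison_map_def by (metis (lifting))
  then show ?thesis by (rule exI[of _ \<phi>])
qed

definition chain_map ::
  "('r \<Rightarrow> 'm \<Rightarrow> 'm) \<Rightarrow> (nat \<Rightarrow> 'm::plus set) \<Rightarrow> (nat \<Rightarrow> 'm \<Rightarrow> 'm)
    \<Rightarrow> ('r \<Rightarrow> 'n \<Rightarrow> 'n) \<Rightarrow> (nat \<Rightarrow> 'n::plus set) \<Rightarrow> (nat \<Rightarrow> 'n \<Rightarrow> 'n) \<Rightarrow> (nat \<Rightarrow> 'm \<Rightarrow> 'n) \<Rightarrow> bool"
  where "chain_map s F d s' F' d' f \<longleftrightarrow> (\<forall>p. linear_map_on s s' (F p) (F' p) (f p)) \<and>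
    (\<forall>p. \<forall>x\<in>F (Suc p). f p (d (Suc p) x) = d' (Suc p) (f (Suc p) x))"

text \<open>
  Again a degreewise construction: the difference of \<open>f\<close> and the part of the homotopy already
  known takes values in cycles, hence in boundaries by exactness.
\<close>

theorem null_homotopy:
  assumes "resolution s F d \<epsilon> I" "resolution s' F' d' \<epsilon>' I"
    and f: "chain_map s F d s' F' d' f" and f0: "\<And>x. x \<in> F 0 \<Longrightarrow> \<epsilon>' (f 0 x) = I"
  shows "\<exists>h. (\<forall>p. linear_map_on s s' (F p) (F' (Suc p)) (h p)) \<and>
    (\<forall>x\<in>F 0. f 0 x = d' 1 (h 0 x)) \<and>
    (\<forall>p. \<forall>x\<in>F (Suc p). f (Suc p) x = d' (Suc (Suc p)) (h (Suc p) x) + h p (d (Suc p) x))"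
proof -
  interpret X: resolution s F d \<epsilon> I by fact
  interpret Y: resolution s' F' d' \<epsilon>' I by fact
  have fl: "linear_map_on s s' (F p) (F' p) (f p)" for p using f by (simp add: chain_map_def)
  have fd: "f p (d (Suc p) x) = d' (Suc p) (f (Suc p) x)" if "x \<in> F (Suc p)" for p x
    using f that by (simp add: chain_map_def)
  let ?P = "\<lambda>n h. linear_map_on s s' (F n) (F' (Suc n)) h \<and> (n = 0 \<longrightarrow> (\<forall>x\<in>F 0. f 0 x = d' 1 (h x))) \<and>
    (\<forall>x\<in>F (Suc n). d' (Suc n) (f (Suc n) x - h (d (Suc n) x)) = 0)"
  have "\<exists>h. \<forall>n. ?P n (h n) \<and>
    (\<forall>x\<in>F (Suc n). f (Suc n) x = d' (Suc (Suc n)) (h (Suc n) x) + h n (d (Suc n) x))"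
  proof (rule dependent_nat_choice)
    have "f 0 x \<in> d' (Suc 0) ` F' (Suc 0)" if "x \<in> F 0" for x
      using Y.exact_0[of "f 0 x"] f0[OF that] linear_map_onD(1)[OF fl that] by simp
    then obtain h where h: "linear_map_on s s' (F 0) (F' (Suc 0)) h" "\<forall>x\<in>F 0. d' (Suc 0) (h x) = f 0 x"
      using free_on_lift[OF X.module_s Y.module_s X.free Y.subspace_F Y.linear_d fl] by blast
    have "d' (Suc 0) (f (Suc 0) x - h (d (Suc 0) x)) = 0" if x: "x \<in> F (Suc 0)" for x
    proof -
      have dx: "d (Suc 0) x \<in> F 0" using linear_map_onD(1)[OF X.linear_d x] .
      show ?thesis
        using linear_map_on_diff[OF Y.linear_d Y.module_s Y.subspace_F
            linear_map_onD(1)[OF fl x] linear_map_onD(1)[OF h(1) dx]] h(2) dx fd[OF x] by simp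
    qed
    with h show "\<exists>h. ?P 0 h" by (intro exI[of _ h]) auto
  next
    fix n h assume P: "?P n h"
    then have hl: "linear_map_on s s' (F n) (F' (Suc n)) h" by blast
    let ?g = "\<lambda>x. f (Suc n) x - h (d (Suc n) x)"
    have gl: "linear_map_on s s' (F (Suc n)) (F' (Suc n)) ?g"
      by (rule linear_map_on_minus[OF fl linear_map_on_compose[OF X.linear_d hl] Y.module_s Y.subspace_F])
    have "?g x \<in> d' (Suc (Suc n)) ` F' (Suc (Suc n))" if "x \<in> F (Suc n)" for x
      using Y.exact[OF linear_map_onD(1)[OF gl that]] P that by blast
    then obtain k where k: "linear_map_on s s' (F (Suc n)) (F' (Suc (Suc n))) k"
      "\<forall>x\<in>F (Suc n). d' (Suc (Suc n)) (k x) = ?g x"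
      using free_on_lift[OF X.module_s Y.module_s X.free Y.subspace_F Y.linear_d gl] by blast
    have "d' (Suc (Suc n)) (f (Suc (Suc n)) x - k (d (Suc (Suc n)) x)) = 0" if x: "x \<in> F (Suc (Suc n))" for x
    proof -
      have dx: "d (Suc (Suc n)) x \<in> F (Suc n)" using linear_map_onD(1)[OF X.linear_d x] .
      have "h (d (Suc n) (d (Suc (Suc n)) x)) = 0"
        using X.d_d[OF x] linear_map_on_0[OF hl X.F_closed(1)] by simp
      then show ?thesis
        using linear_map_on_diff[OF Y.linear_d Y.module_s Y.subspace_F
            linear_map_onD(1)[OF fl x] linear_map_onD(1)[OF k(1) dx]] k(2) dx fd[OF x] by simp
    qed
    with k show "\<exists>k. ?P (Suc n) k \<and> (\<forall>x\<in>F (Suc n). f (Suc n) x = d' (Suc (Suc n)) (k x) + h (d (Suc n) x))"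
      by (intro exI[of _ k]) auto
  qed
  then obtain h where h: "\<And>n. ?P n (h n) \<and>
    (\<forall>x\<in>F (Suc n). f (Suc n) x = d' (Suc (Suc n)) (h (Suc n) x) + h n (d (Suc n) x))" by blast
  show ?thesis by (intro exI[of _ h]) (use h[of 0] h in auto)
qed

lemma comparison_homotopy:
  assumes X: "resolution s F d \<epsilon> I" and Y: "resolution s' F' d' \<epsilon>' I"
    and f: "comparison_map s F d \<epsilon> s' F' d' \<epsilon>' f" and g: "comparison_map s F d \<epsilon> s' F' d' \<epsilon>' g"
  shows "\<exists>h. (\<forall>p. linear_map_on s s' (F p) (F' (Suc p)) (h p)) \<and>
    (\<forall>x\<in>F 0. f 0 x - g 0 x = d' 1 (h 0 x)) \<and>
    (\<forall>p. \<forall>x\<in>F (Suc p). f (Suc p) x - g (Suc p) x = d' (Suc (Suc p)) (h (Suc p) x) + h p (d (Suc p) x))"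
proof -
  interpret X: resolution s F d \<epsilon> I by fact
  interpret Y: resolution s' F' d' \<epsilon>' I by fact
  have l: "linear_map_on s s' (F p) (F' p) (f p)" "linear_map_on s s' (F p) (F' p) (g p)" for p
    using f g by (simp_all add: comparison_map_def)
  have "chain_map s F d s' F' d' (\<lambda>p x. f p x - g p x)"
    unfolding chain_map_def
  proof (intro conjI allI ballI)
    show "linear_map_on s s' (F p) (F' p) (\<lambda>x. f p x - g p x)" for p
      by (rule linear_map_on_minus[OF l Y.module_s Y.subspace_F])
    fix p x assume x: "x \<in> F (Suc p)"
    show "f p (d (Suc p) x) - g p (d (Suc p) x) = d' (Suc p) (f (Suc p) x - g (Suc p) x)"
      using linear_map_on_diff[OF Y.linear_d Y.module_s Y.subspace_F linear_map_onD(1)[OF l(1) x]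
          linear_map_onD(1)[OF l(2) x]] f g x by (simp add: comparison_map_def)
  qed
  moreover have "\<epsilon>' (f 0 x - g 0 x) = I" if "x \<in> F 0" for x
    using f g that by (intro Y.eps_diff_eq) (auto simp: comparison_map_def dest: linear_map_onD)
  ultimately show ?thesis using null_homotopy[OF X Y] by blast
qed

lemma comparison_map_compose:
  assumes "comparison_map s F d \<epsilon> s' F' d' \<epsilon>' f" "comparison_map s' F' d' \<epsilon>' s'' F'' d'' \<epsilon>'' g"
  shows "comparison_map s F d \<epsilon> s'' F'' d'' \<epsilon>'' (\<lambda>p x. g p (f p x))"
  unfolding comparison_map_def
proof (intro conjI allI ballI)
  have f: "linear_map_on s s' (F p) (F' p) (f p)" and g: "linear_map_on s' s'' (F' p) (F'' p) (g p)" for p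
    using assms by (simp_all add: comparison_map_def)
  show "linear_map_on s s'' (F p) (F'' p) (\<lambda>x. g p (f p x))" for p
    by (rule linear_map_on_compose[OF f g])
  show "g p (f p (d (Suc p) x)) = d'' (Suc p) (g (Suc p) (f (Suc p) x))" if "x \<in> F (Suc p)" for p x
    using assms that linear_map_onD(1)[OF f that] by (simp add: comparison_map_def)
  show "\<epsilon>'' (g 0 (f 0 x)) = \<epsilon> x" if "x \<in> F 0" for x
    using assms that linear_map_onD(1)[OF f that] by (simp add: comparison_map_def)
qed

lemma comparison_map_id: "comparison_map s F d \<epsilon> s F d \<epsilon> (\<lambda>p x. x)"
  by (simp add: comparison_map_def linear_map_on_def)

section \<open>Linear and bilinear maps given on a basis\<close>

lemma lookup_map: "f 0 = 0 \<Longrightarrow> lookup (Poly_Mapping.map f p) k = f (lookup p k)"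
  by (auto simp: Poly_Mapping.map.rep_eq when_def)

lemma lookup_pm_scale [simp]: "lookup (pm_scale r v) b = r * lookup v b"
  by (simp add: pm_scale_def lookup_map)

lemma module_pm_scale: "module (pm_scale :: 'r::comm_ring_1 \<Rightarrow> ('b \<Rightarrow>\<^sub>0 'r) \<Rightarrow> _)"
  by standard (auto intro!: poly_mapping_eqI simp: lookup_add algebra_simps)

interpretation pm: module "pm_scale :: 'r::comm_ring_1 \<Rightarrow> ('b \<Rightarrow>\<^sub>0 'r) \<Rightarrow> _"
  by (rule module_pm_scale)

lemma pm_scale_single: "pm_scale r (Poly_Mapping.single b c) = Poly_Mapping.single b (r * c)"
  for r :: "'r::comm_ring_1"
  by (rule poly_mapping_eqI) (simp add: lookup_single when_def)

lemma on_basis_add: "on_basis f (v + w) = on_basis f v + on_basis f w" for f :: "'b \<Rightarrow> 'b \<Rightarrow>\<^sub>0 'r::comm_ring_1"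
  unfolding on_basis_def by (rule setsum_keys_plus_distrib) (simp_all add: pm.scale_left_distrib)

lemma on_basis_0 [simp]: "on_basis f 0 = 0"
  by (simp add: on_basis_def)

lemma on_basis_single: "on_basis f (Poly_Mapping.single b c) = pm_scale c (f b)" for c :: "'r::comm_ring_1"
  by (cases "c = 0") (simp_all add: on_basis_def)

lemma on_basis_scale: "on_basis f (pm_scale r v) = pm_scale r (on_basis f v)" for r :: "'r::comm_ring_1"
  by (induction v rule: poly_mapping_single_induct)
    (simp_all add: on_basis_add on_basis_single pm.scale_right_distrib pm_scale_single)

lemma on_basis_minus: "on_basis f (- v) = - on_basis f v" for v :: "'b \<Rightarrow>\<^sub>0 'r::comm_ring_1"
  using on_basis_scale[of f "- 1" v] by simp

lemma on_basis_diff: "on_basis f (v - w) = on_basis f v - on_basis f w" for v :: "'b \<Rightarrow>\<^sub>0 'r::comm_ring_1"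
  using on_basis_add[of f v "- w"] by (simp add: on_basis_minus)

lemma on_basis_sum: "on_basis f (sum g A) = (\<Sum>a\<in>A. on_basis f (g a))" for g :: "'c \<Rightarrow> 'b \<Rightarrow>\<^sub>0 'r::comm_ring_1"
  by (induction A rule: infinite_finite_induct) (simp_all add: on_basis_add)

lemma on_basis_fun_add: "on_basis (\<lambda>b. f b + g b) v = on_basis f v + on_basis g v" for v :: "'b \<Rightarrow>\<^sub>0 'r::comm_ring_1"
  by (simp add: on_basis_def pm.scale_right_distrib sum.distrib)

lemma on_basis_fun_diff: "on_basis (\<lambda>b. f b - g b) v = on_basis f v - on_basis g v" for v :: "'b \<Rightarrow>\<^sub>0 'r::comm_ring_1"
  by (simp add: on_basis_def pm.scale_right_diff_distrib sum_subtractf)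

lemma on_basis_fun_0 [simp]: "on_basis (\<lambda>b. 0) v = 0" for v :: "'b \<Rightarrow>\<^sub>0 'r::comm_ring_1"
  by (simp add: on_basis_def)

lemma on_basis_fun_scale: "on_basis (\<lambda>b. pm_scale r (f b)) v = pm_scale r (on_basis f v)" for r :: "'r::comm_ring_1"
  by (simp add: on_basis_def pm.scale_sum_right mult.commute)

lemma on_basis_cong: "(\<And>b. b \<in> keys v \<Longrightarrow> f b = g b) \<Longrightarrow> on_basis f v = on_basis g v"
  by (simp add: on_basis_def)

lemma on_basis_on_basis: "on_basis f (on_basis g v) = on_basis (\<lambda>b. on_basis f (g b)) v" for v :: "'b \<Rightarrow>\<^sub>0 'r::comm_ring_1"
  by (induction v rule: poly_mapping_single_induct)
    (simp_all add: on_basis_add on_basis_single on_basis_scale)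

lemma on_basis_swap:
  "on_basis (\<lambda>a. on_basis (H a) w) v = on_basis (\<lambda>b. on_basis (\<lambda>a. H a b) v) w"
  for v :: "'b \<Rightarrow>\<^sub>0 'r::comm_ring_1"
  by (induction v rule: poly_mapping_single_induct)
    (simp_all add: on_basis_add on_basis_single on_basis_fun_add on_basis_fun_scale)

lemma on_basis_basis: "on_basis (\<lambda>b. Poly_Mapping.single b 1) v = v" for v :: "'b \<Rightarrow>\<^sub>0 'r::comm_ring_1"
  by (induction v rule: poly_mapping_single_induct)
    (simp_all add: on_basis_add on_basis_single pm_scale_single)

lemma keys_pm_scale: "keys (pm_scale r v) \<subseteq> keys v"
  by (auto simp: in_keys_iff)

lemma keys_on_basis: "keys (on_basis f v) \<subseteq> (\<Union>b\<in>keys v. keys (f b))"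
proof -
  have "keys (on_basis f v) \<subseteq> (\<Union>b\<in>keys v. keys (pm_scale (lookup v b) (f b)))"
    unfolding on_basis_def by (rule keys_sum)
  also have "\<dots> \<subseteq> (\<Union>b\<in>keys v. keys (f b))" by (intro UN_mono keys_pm_scale order_refl)
  finally show ?thesis .
qed

text \<open>
  Reduction modulo the variables of a vector over the polynomial ring.
\<close>

definition const_reduce :: "('b \<Rightarrow>\<^sub>0 ('x, 'k::comm_ring_1) mpol) \<Rightarrow> ('b \<Rightarrow>\<^sub>0 'k)"
  where "const_reduce = Poly_Mapping.map const_coeff"

lemma lookup_const_reduce [simp]: "lookup (const_reduce v) b = const_coeff (lookup v b)"
  by (simp add: const_reduce_def lookup_map)

lemma const_reduce_add: "const_reduce (v + w) = const_reduce v + const_reduce w"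
  and const_reduce_0 [simp]: "const_reduce 0 = 0"
  and const_reduce_scale: "const_reduce (pm_scale r v) = pm_scale (const_coeff r) (const_reduce v)"
  and const_reduce_single: "const_reduce (Poly_Mapping.single b r) = Poly_Mapping.single b (const_coeff r)"
  by (auto intro!: poly_mapping_eqI simp: lookup_add const_coeff_add const_coeff_mult lookup_single when_def)

lemma const_reduce_diff: "const_reduce (v - w) = const_reduce v - const_reduce w"
  by (rule poly_mapping_eqI) (simp add: lookup_minus const_coeff_def)

lemma const_reduce_sum: "const_reduce (sum g A) = (\<Sum>a\<in>A. const_reduce (g a))"
  by (induction A rule: infinite_finite_induct) (simp_all add: const_reduce_add)

lemma const_reduce_on_basis: "const_reduce (on_basis f v) = on_basis (\<lambda>b. const_reduce (f b)) (const_reduce v)"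
  by (induction v rule: poly_mapping_single_induct)
    (simp_all add: on_basis_add on_basis_single const_reduce_add const_reduce_scale const_reduce_single)

lemma keys_const_reduce: "keys (const_reduce v) \<subseteq> keys v"
  by (auto simp: in_keys_iff)

lemma subset_module_closed:
  "0 \<in> subset_module m p" "v \<in> subset_module m p \<Longrightarrow> w \<in> subset_module m p \<Longrightarrow> v + w \<in> subset_module m p"
  "v \<in> subset_module m p \<Longrightarrow> w \<in> subset_module m p \<Longrightarrow> v - w \<in> subset_module m p"
  "v \<in> subset_module m p \<Longrightarrow> pm_scale r v \<in> subset_module m p" for r :: "'r::comm_ring_1"
  using keys_add[of v w] keys_diff[of v w] keys_pm_scale[of r v] unfolding subset_module_def mem_Collect_eq
  by (simp, (blast intro: subset_trans)+)

lemma subset_module_single: "\<sigma> \<subseteq> {1..m} \<Longrightarrow> card \<sigma> = p \<Longrightarrow> Poly_Mapping.single \<sigma> c \<in> subset_module m p"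
  by (simp add: subset_module_def)

lemma subset_module_keys: "v \<in> subset_module m p \<Longrightarrow> \<sigma> \<in> keys v \<Longrightarrow> \<sigma> \<subseteq> {1..m} \<and> card \<sigma> = p"
  by (auto simp: subset_module_def)

lemma subset_module_on_basis:
  "(\<And>\<sigma>. \<sigma> \<in> keys v \<Longrightarrow> f \<sigma> \<in> subset_module m q) \<Longrightarrow> on_basis f v \<in> subset_module m q"
  using keys_on_basis[of f v] unfolding subset_module_def by blast

lemma subset_module_const_reduce: "v \<in> subset_module m p \<Longrightarrow> const_reduce v \<in> subset_module m p"
  using keys_const_reduce[of v] by (auto simp: subset_module_def)

lemma subspace_subset_module: "pm.subspace (subset_module m p :: (nat set \<Rightarrow>\<^sub>0 'r::comm_ring_1) set)"
  by (simp add: pm.subspace_def subset_module_closed)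

lemma linear_on_subset_module:
  fixes s' :: "'r::comm_ring_1 \<Rightarrow> 'n::ab_group_add \<Rightarrow> 'n"
  assumes f: "linear_map_on pm_scale s' (subset_module m p) N f" and v: "v \<in> subset_module m p"
  shows "f v = (\<Sum>\<sigma>\<in>keys v. s' (lookup v \<sigma>) (f (Poly_Mapping.single \<sigma> 1)))"
proof -
  have single: "Poly_Mapping.single \<sigma> 1 \<in> subset_module m p" if "\<sigma> \<in> keys v" for \<sigma>
    using subset_module_keys[OF v that] by (intro subset_module_single) auto
  have "f v = f (\<Sum>\<sigma>\<in>keys v. pm_scale (lookup v \<sigma>) (Poly_Mapping.single \<sigma> 1))"
    using on_basis_basis[of v] by (simp add: on_basis_def)
  also have "\<dots> = (\<Sum>\<sigma>\<in>keys v. f (pm_scale (lookup v \<sigma>) (Poly_Mapping.single \<sigma> 1)))"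
    by (rule linear_map_on_sum[OF f module_pm_scale subspace_subset_module])
      (intro subset_module_closed single)
  also have "\<dots> = (\<Sum>\<sigma>\<in>keys v. s' (lookup v \<sigma>) (f (Poly_Mapping.single \<sigma> 1)))"
    by (rule sum.cong[OF refl]) (rule linear_map_onD(3)[OF f single])
  finally show ?thesis .
qed

lemma linear_on_subset_module_on_basis:
  fixes f :: "(nat set \<Rightarrow>\<^sub>0 'r::comm_ring_1) \<Rightarrow> (nat set \<Rightarrow>\<^sub>0 'r)"
  assumes "linear_map_on pm_scale pm_scale (subset_module m p) N f" "v \<in> subset_module m p"
  shows "f v = on_basis (\<lambda>\<sigma>. f (Poly_Mapping.single \<sigma> 1)) v"
  using linear_on_subset_module[OF assms] by (simp add: on_basis_def)

text \<open>
  The bilinear extension of a map given on pairs of basis elements.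
\<close>

definition bilin :: "('b \<Rightarrow> 'b \<Rightarrow> ('b \<Rightarrow>\<^sub>0 'r)) \<Rightarrow> ('b \<Rightarrow>\<^sub>0 'r) \<Rightarrow> ('b \<Rightarrow>\<^sub>0 'r) \<Rightarrow> ('b \<Rightarrow>\<^sub>0 'r::comm_ring_1)"
  where "bilin H v w = on_basis (\<lambda>\<sigma>. on_basis (H \<sigma>) w) v"

lemma bilin_0 [simp]: "bilin H 0 w = 0" "bilin H v 0 = 0"
  and bilin_fun_add: "bilin (\<lambda>\<sigma> \<tau>. H \<sigma> \<tau> + H' \<sigma> \<tau>) v w = bilin H v w + bilin H' v w"
  by (simp_all add: bilin_def on_basis_add on_basis_fun_add on_basis_single)

lemma bilin_cong:
  "(\<And>\<sigma> \<tau>. \<sigma> \<in> keys v \<Longrightarrow> \<tau> \<in> keys w \<Longrightarrow> H \<sigma> \<tau> = H' \<sigma> \<tau>) \<Longrightarrow> bilin H v w = bilin H' v w"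
  unfolding bilin_def by (intro on_basis_cong) auto

lemma bilin_fun_scale: "bilin (\<lambda>\<sigma> \<tau>. pm_scale r (H \<sigma> \<tau>)) v w = pm_scale r (bilin H v w)"
  by (simp add: bilin_def on_basis_fun_scale)

lemma bilin_on_basis: "on_basis f (bilin H v w) = bilin (\<lambda>\<sigma> \<tau>. on_basis f (H \<sigma> \<tau>)) v w"
  by (simp add: bilin_def on_basis_on_basis)

lemma bilin_on_basis_left: "bilin (\<lambda>\<sigma> \<tau>. on_basis (\<lambda>\<sigma>'. H \<sigma>' \<tau>) (f \<sigma>)) v w = bilin H (on_basis f v) w"
  unfolding bilin_def on_basis_on_basis[of _ f v] by (simp add: on_basis_swap[of H w])

lemma bilin_on_basis_right: "bilin (\<lambda>\<sigma> \<tau>. on_basis (H \<sigma>) (f \<tau>)) v w = bilin H v (on_basis f w)"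
  by (simp add: bilin_def on_basis_on_basis)

lemma const_reduce_bilin: "const_reduce (bilin H v w) = bilin (\<lambda>\<sigma> \<tau>. const_reduce (H \<sigma> \<tau>)) (const_reduce v) (const_reduce w)"
  by (simp add: bilin_def const_reduce_on_basis)

section \<open>Signs of shuffles\<close>

text \<open>
  The number of pairs \<open>(a, b)\<close> with \<open>a \<in> \<sigma>\<close>, \<open>b \<in> \<tau>\<close> and \<open>b < a\<close>.
\<close>

definition inversions :: "nat set \<Rightarrow> nat set \<Rightarrow> nat"
  where "inversions \<sigma> \<tau> = (\<Sum>a\<in>\<sigma>. eps_pos \<tau> a)"

lemma inversions_remove_left:
  "finite \<sigma> \<Longrightarrow> i \<in> \<sigma> \<Longrightarrow> inversions \<sigma> \<tau> = eps_pos \<tau> i + inversions (\<sigma> - {i}) \<tau>"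
  unfolding inversions_def by (rule sum.remove)

lemma eps_pos_remove:
  assumes "finite \<tau>" "i \<in> \<tau>" shows "eps_pos \<tau> a = eps_pos (\<tau> - {i}) a + (if i < a then 1 else 0)"
proof (cases "i < a")
  case True
  then have "{j\<in>\<tau>. j < a} = insert i {j\<in>\<tau> - {i}. j < a}" using assms by auto
  then show ?thesis using True assms by (simp add: eps_pos_def)
next
  case False
  then have "{j\<in>\<tau>. j < a} = {j\<in>\<tau> - {i}. j < a}" by auto
  then show ?thesis using False by (simp add: eps_pos_def)
qed

lemma inversions_remove_right:
  assumes "finite \<sigma>" "finite \<tau>" "i \<in> \<tau>"
  shows "inversions \<sigma> \<tau> = inversions \<sigma> (\<tau> - {i}) + card {a\<in>\<sigma>. i < a}"
proof -
  have "inversions \<sigma> \<tau> = (\<Sum>a\<in>\<sigma>. eps_pos (\<tau> - {i}) a + (if i < a then 1 else 0))"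
    unfolding inversions_def by (rule sum.cong) (use eps_pos_remove[OF assms(2,3)] in auto)
  also have "\<dots> = inversions \<sigma> (\<tau> - {i}) + card {a\<in>\<sigma>. i < a}"
    using assms(1) by (simp add: sum.distrib inversions_def sum.If_cases Int_def)
  finally show ?thesis .
qed

lemma eps_pos_Un:
  assumes "finite \<sigma>" "finite \<tau>" "\<sigma> \<inter> \<tau> = {}" shows "eps_pos (\<sigma> \<union> \<tau>) i = eps_pos \<sigma> i + eps_pos \<tau> i"
proof -
  have "{j\<in>\<sigma> \<union> \<tau>. j < i} = {j\<in>\<sigma>. j < i} \<union> {j\<in>\<tau>. j < i}" by auto
  then show ?thesis unfolding eps_pos_def using assms by (simp add: card_Un_disjoint disjoint_iff)
qed

lemma card_split_at:
  assumes "finite \<sigma>"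
  shows "card \<sigma> = eps_pos \<sigma> i + card {a\<in>\<sigma>. i < a} + (if i \<in> \<sigma> then 1 else 0)"
proof -
  have "card ({j\<in>\<sigma>. j < i} \<union> {a\<in>\<sigma>. i < a}) = card {j\<in>\<sigma>. j < i} + card {a\<in>\<sigma>. i < a}"
    using assms by (intro card_Un_disjoint) auto
  moreover have "{j\<in>\<sigma>. j < i} \<union> {a\<in>\<sigma>. i < a} = \<sigma> - {i}" by auto
  ultimately have *: "card (\<sigma> - {i}) = eps_pos \<sigma> i + card {a\<in>\<sigma>. i < a}" by (simp add: eps_pos_def)
  show ?thesis
  proof (cases "i \<in> \<sigma>")
    case True
    then show ?thesis using * card_Suc_Diff1[OF assms True] by simp
  next
    case False
    then have "\<sigma> - {i} = \<sigma>" by blast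
    with * False show ?thesis by (simp only: if_False add_0_right)
  qed
qed

text \<open>
  Moving the last entry of a list to the front takes one transposition for each entry that it
  passes.
\<close>

lemma cyclic_shift_sign:
  assumes "distinct xs" "M \<notin> set xs"
  shows "\<exists>c. c permutes (insert M (set xs)) \<and> map c xs @ [c M] = M # xs \<and> sign c = (- 1) ^ length xs"
  using assms
proof (induction xs)
  case Nil
  then show ?case by (intro exI[of _ id]) (auto simp: permutes_id)
next
  case (Cons x ys)
  then obtain c where c: "c permutes insert M (set ys)" "map c ys @ [c M] = M # ys" "sign c = (- 1) ^ length ys"
    by auto
  have x: "x \<noteq> M" "x \<notin> set ys" using Cons by auto
  let ?t = "Transposition.transpose x M"
  have cx: "c x = x" using permutes_not_in[OF c(1), of x] x by simp
  have ys: "map ?t ys = ys" using x Cons.prems by (intro map_idI) (auto simp: transpose_def)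
  have "map ?t (map c ys @ [c M]) = map ?t (M # ys)" by (simp only: c(2))
  also have "\<dots> = x # ys" by (simp add: ys)
  finally have 1: "map (?t \<circ> c) ys @ [(?t \<circ> c) M] = x # ys" by simp
  have 2: "(?t \<circ> c) permutes insert M (set (x # ys))"
    by (intro permutes_compose permutes_swap_id) (auto intro: permutes_subset[OF c(1)])
  have "permutation c" using permutes_imp_permutation[OF _ c(1)] by simp
  then have "sign (?t \<circ> c) = (- 1) ^ length (x # ys)"
    using x by (simp add: sign_compose permutation_swap_id sign_swap_id c(3))
  moreover have "map (?t \<circ> c) (x # ys) @ [(?t \<circ> c) M] = M # x # ys"
    using 1 cx by simp
  ultimately show ?case using 2 by blast
qed

lemma sorted_list_of_set_insert_max:
  fixes M :: nat
  assumes "finite A" "\<forall>a\<in>A. a < M"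
  shows "sorted_list_of_set (insert M A) = sorted_list_of_set A @ [M]"
proof -
  have "sorted (sorted_list_of_set A @ [M])" "distinct (sorted_list_of_set A @ [M])"
    using assms by (auto simp: sorted_append intro: less_imp_le)
  then have *: "sorted_list_of_set (set (sorted_list_of_set A @ [M])) = sorted_list_of_set A @ [M]"
    by (rule sorted_list_of_set.idem_if_sorted_distinct)
  have "set (sorted_list_of_set A @ [M]) = insert M A" using assms(1) by auto
  then show ?thesis using * by (simp only:)
qed

text \<open>
  By induction on the largest element \<open>M\<close>. If \<open>M\<close> belongs to \<open>\<tau>\<close>, it stays at the end and is in no
  inversion. If it belongs to \<open>\<sigma>\<close>, it has to move to the left past all of \<open>\<tau>\<close>, as in \<open>cyclic_shift_sign\<close>,
  and it is in an inversion with each element of \<open>\<tau>\<close>.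
\<close>

lemma shuffle_exists:
  assumes "finite A" "\<sigma> \<union> \<tau> = A" "\<sigma> \<inter> \<tau> = {}"
  shows "\<exists>\<pi>. \<pi> permutes A \<and> map \<pi> (sorted_list_of_set A) = sorted_list_of_set \<sigma> @ sorted_list_of_set \<tau> \<and>
    sign \<pi> = (- 1) ^ inversions \<sigma> \<tau>"
  using assms
proof (induction A arbitrary: \<sigma> \<tau> rule: finite_linorder_max_induct)
  case empty
  then show ?case by (intro exI[of _ id]) (auto simp: inversions_def permutes_id)
next
  case (insert M A)
  have M: "M \<notin> A" using insert.hyps by auto
  have "finite (\<sigma> \<union> \<tau>)" using insert.hyps(1) insert.prems(1) by simp
  then have fin: "finite \<sigma>" "finite \<tau>" by simp_all
  note sA = sorted_list_of_set_insert_max[OF insert.hyps(1,2)]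
  show ?case
  proof (cases "M \<in> \<tau>")
    case True
    then have u: "\<sigma> \<union> (\<tau> - {M}) = A" "\<sigma> \<inter> (\<tau> - {M}) = {}" using insert.prems M by auto
    obtain \<pi> where \<pi>: "\<pi> permutes A"
      "map \<pi> (sorted_list_of_set A) = sorted_list_of_set \<sigma> @ sorted_list_of_set (\<tau> - {M})"
      "sign \<pi> = (- 1) ^ inversions \<sigma> (\<tau> - {M})"
      using insert.IH[OF u] by blast
    have "sorted_list_of_set (insert M (\<tau> - {M})) = sorted_list_of_set (\<tau> - {M}) @ [M]"
      using fin insert.hyps(2) u by (intro sorted_list_of_set_insert_max) auto
    then have s\<tau>: "sorted_list_of_set \<tau> = sorted_list_of_set (\<tau> - {M}) @ [M]" using True by (simp add: insert_absorb)
    have "a < M" if "a \<in> \<sigma>" for a using insert.hyps(2) u(1) that by blast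
    then have "{a\<in>\<sigma>. M < a} = {}" by fastforce
    then have "card {a\<in>\<sigma>. M < a} = 0" by (simp only: card.empty)
    then have "inversions \<sigma> \<tau> = inversions \<sigma> (\<tau> - {M})" using inversions_remove_right[OF fin True] by simp
    moreover have "\<pi> permutes insert M A" using \<pi>(1) by (rule permutes_subset) auto
    moreover have "\<pi> M = M" using permutes_not_in[OF \<pi>(1) M] .
    ultimately show ?thesis using \<pi> by (intro exI[of _ \<pi>]) (simp add: sA s\<tau>)
  next
    case False
    then have "M \<in> \<sigma>" using insert.prems by auto
    then have u: "(\<sigma> - {M}) \<union> \<tau> = A" "(\<sigma> - {M}) \<inter> \<tau> = {}" using insert.prems M by auto
    obtain \<pi> where \<pi>: "\<pi> permutes A"
      "map \<pi> (sorted_list_of_set A) = sorted_list_of_set (\<sigma> - {M}) @ sorted_list_of_set \<tau>"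
      "sign \<pi> = (- 1) ^ inversions (\<sigma> - {M}) \<tau>"
      using insert.IH[OF u] by blast
    obtain c where c: "c permutes insert M \<tau>" "map c (sorted_list_of_set \<tau>) @ [c M] = M # sorted_list_of_set \<tau>"
      "sign c = (- 1) ^ card \<tau>"
      using cyclic_shift_sign[of "sorted_list_of_set \<tau>" M] fin False by auto
    have "sorted_list_of_set (insert M (\<sigma> - {M})) = sorted_list_of_set (\<sigma> - {M}) @ [M]"
      using fin insert.hyps(2) u by (intro sorted_list_of_set_insert_max) auto
    then have s\<sigma>: "sorted_list_of_set \<sigma> = sorted_list_of_set (\<sigma> - {M}) @ [M]"
      using \<open>M \<in> \<sigma>\<close> by (simp add: insert_absorb)
    have "j < M" if "j \<in> \<tau>" for j using insert.hyps(2) u(1) that by blast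
    then have "{j\<in>\<tau>. j < M} = \<tau>" by fastforce
    then have inv: "inversions \<sigma> \<tau> = card \<tau> + inversions (\<sigma> - {M}) \<tau>"
      using inversions_remove_left[OF fin(1) \<open>M \<in> \<sigma>\<close>, of \<tau>] by (simp add: eps_pos_def)
    have "\<pi> M = M" using permutes_not_in[OF \<pi>(1) M] .
    then have "map \<pi> (sorted_list_of_set (insert M A)) = sorted_list_of_set (\<sigma> - {M}) @ sorted_list_of_set \<tau> @ [M]"
      by (simp add: sA \<pi>(2))
    then have "map c (map \<pi> (sorted_list_of_set (insert M A))) =
        map c (sorted_list_of_set (\<sigma> - {M})) @ map c (sorted_list_of_set \<tau>) @ [c M]" by simp
    also have "map c (sorted_list_of_set (\<sigma> - {M})) = sorted_list_of_set (\<sigma> - {M})"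
      using u fin by (intro map_idI permutes_not_in[OF c(1)]) auto
    finally have "map (c \<circ> \<pi>) (sorted_list_of_set (insert M A)) = sorted_list_of_set \<sigma> @ sorted_list_of_set \<tau>"
      by (simp add: c(2) s\<sigma>)
    moreover have "(c \<circ> \<pi>) permutes insert M A"
      by (rule permutes_compose; rule permutes_subset[OF \<pi>(1)] permutes_subset[OF c(1)]) (use u in auto)
    moreover have "permutation c" "permutation \<pi>"
      using permutes_imp_permutation[OF _ c(1)] permutes_imp_permutation[OF _ \<pi>(1)] fin insert.hyps(1)
      by simp_all
    then have "sign (c \<circ> \<pi>) = (- 1) ^ inversions \<sigma> \<tau>"
      by (simp add: sign_compose c(3) \<pi>(3) inv power_add)
    ultimately show ?thesis by blast
  qed
qed

lemma sign_shuffle: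
  assumes "finite \<sigma>" "finite \<tau>" "\<sigma> \<inter> \<tau> = {}"
  shows "sign (shuffle \<sigma> \<tau>) = (- 1) ^ inversions \<sigma> \<tau>"
proof -
  let ?P = "\<lambda>\<pi>. \<pi> permutes (\<sigma> \<union> \<tau>) \<and>
    map \<pi> (sorted_list_of_set (\<sigma> \<union> \<tau>)) = sorted_list_of_set \<sigma> @ sorted_list_of_set \<tau>"
  obtain \<pi> where \<pi>: "?P \<pi>" "sign \<pi> = (- 1) ^ inversions \<sigma> \<tau>"
    using shuffle_exists[of "\<sigma> \<union> \<tau>" \<sigma> \<tau>] assms by auto
  have unique: "\<rho> = \<pi>" if "?P \<rho>" for \<rho>
  proof
    fix x
    have "map \<rho> (sorted_list_of_set (\<sigma> \<union> \<tau>)) = map \<pi> (sorted_list_of_set (\<sigma> \<union> \<tau>))" using that \<pi>(1) by simp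
    then have "\<forall>x\<in>\<sigma> \<union> \<tau>. \<rho> x = \<pi> x" using assms by (simp add: map_eq_conv)
    moreover have "\<rho> x = x" "\<pi> x = x" if "x \<notin> \<sigma> \<union> \<tau>"
      using permutes_not_in[OF conjunct1[OF \<open>?P \<rho>\<close>] that] permutes_not_in[OF conjunct1[OF \<pi>(1)] that] .
    ultimately show "\<rho> x = \<pi> x" by (cases "x \<in> \<sigma> \<union> \<tau>") auto
  qed
  have "shuffle \<sigma> \<tau> = \<pi>" unfolding shuffle_def
    by (rule the_equality, rule \<pi>(1), erule unique)
  then show ?thesis using \<pi>(2) by simp
qed

section \<open>Taylor's multiplication\<close>

lemma minus_one_power_cong: "even (a + b) \<Longrightarrow> (- 1) ^ a = ((- 1) ^ b :: 'r::comm_ring_1)"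
  by (cases "even a") simp_all

lemma minus_one_power_opp: "odd (a + b) \<Longrightarrow> (- 1) ^ a = - ((- 1) ^ b :: 'r::comm_ring_1)"
  by (cases "even a") simp_all

context taylor_data
begin

definition face_coeff :: "nat set \<Rightarrow> nat \<Rightarrow> ('x, 'k) mpol"
  where "face_coeff \<sigma> i = (THE c. Qlcm E Q \<sigma> = c * Qlcm E Q (\<sigma> - {i}))"

definition mult_coeff :: "nat set \<Rightarrow> nat set \<Rightarrow> ('x, 'k) mpol"
  where "mult_coeff \<sigma> \<tau> = (THE c. Qlcm E Q \<sigma> * Qlcm E Q \<tau> = c * Qlcm E Q (\<sigma> \<union> \<tau>))"

lemma face_coeff:
  assumes "\<sigma> \<subseteq> {1..m}"
  shows "face_coeff \<sigma> i * Qlcm E Q (\<sigma> - {i}) = Qlcm E Q \<sigma>"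
    and "const_coeff (face_coeff \<sigma> i) = (if Qlcm E Q (\<sigma> - {i}) = Qlcm E Q \<sigma> then 1 else 0)"
proof -
  obtain c where c: "Qlcm E Q \<sigma> = c * Qlcm E Q (\<sigma> - {i})"
    "const_coeff c = (if Qlcm E Q (\<sigma> - {i}) = Qlcm E Q \<sigma> then 1 else 0)"
    using Qlcm_quotient[of "\<sigma> - {i}" \<sigma>] assms by blast
  have "Qlcm E Q (\<sigma> - {i}) \<noteq> 0" using assms by (intro Qlcm_nonzero) blast
  then have "face_coeff \<sigma> i = c" unfolding face_coeff_def
    by (intro the_equality) (use c(1) in auto)
  with c show "face_coeff \<sigma> i * Qlcm E Q (\<sigma> - {i}) = Qlcm E Q \<sigma>"
    and "const_coeff (face_coeff \<sigma> i) = (if Qlcm E Q (\<sigma> - {i}) = Qlcm E Q \<sigma> then 1 else 0)" by simp_all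
qed

lemma mult_coeff:
  assumes "\<sigma> \<subseteq> {1..m}" "\<tau> \<subseteq> {1..m}"
  shows "mult_coeff \<sigma> \<tau> * Qlcm E Q (\<sigma> \<union> \<tau>) = Qlcm E Q \<sigma> * Qlcm E Q \<tau>"
    and "const_coeff (mult_coeff \<sigma> \<tau>) =
      (if rk E (Qlcm E Q (\<sigma> \<union> \<tau>)) = (\<lambda>e. rk E (Qlcm E Q \<sigma>) e + rk E (Qlcm E Q \<tau>) e) then 1 else 0)"
proof -
  obtain c where c: "Qlcm E Q \<sigma> * Qlcm E Q \<tau> = c * Qlcm E Q (\<sigma> \<union> \<tau>)"
    "const_coeff c = (if rk E (Qlcm E Q (\<sigma> \<union> \<tau>)) = (\<lambda>e. rk E (Qlcm E Q \<sigma>) e + rk E (Qlcm E Q \<tau>) e) then 1 else 0)"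
    using Qlcm_product_quotient[OF assms] by blast
  have "Qlcm E Q (\<sigma> \<union> \<tau>) \<noteq> 0" using assms by (intro Qlcm_nonzero) blast
  then have "mult_coeff \<sigma> \<tau> = c" unfolding mult_coeff_def
    by (intro the_equality) (use c(1) in auto)
  with c show "mult_coeff \<sigma> \<tau> * Qlcm E Q (\<sigma> \<union> \<tau>) = Qlcm E Q \<sigma> * Qlcm E Q \<tau>"
    and "const_coeff (mult_coeff \<sigma> \<tau>) =
      (if rk E (Qlcm E Q (\<sigma> \<union> \<tau>)) = (\<lambda>e. rk E (Qlcm E Q \<sigma>) e + rk E (Qlcm E Q \<tau>) e) then 1 else 0)"
    by simp_all
qed

definition taylor_face :: "nat set \<Rightarrow> (nat set \<Rightarrow>\<^sub>0 ('x, 'k) mpol)"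
  where "taylor_face \<sigma> = (\<Sum>i\<in>\<sigma>. Poly_Mapping.single (\<sigma> - {i}) ((- 1) ^ eps_pos \<sigma> i * face_coeff \<sigma> i))"

definition taylor_mult :: "nat set \<Rightarrow> nat set \<Rightarrow> (nat set \<Rightarrow>\<^sub>0 ('x, 'k) mpol)"
  where "taylor_mult \<sigma> \<tau> = (if \<sigma> \<inter> \<tau> = {}
    then Poly_Mapping.single (\<sigma> \<union> \<tau>) ((- 1) ^ inversions \<sigma> \<tau> * mult_coeff \<sigma> \<tau>) else 0)"

definition delta_face :: "nat set \<Rightarrow> (nat set \<Rightarrow>\<^sub>0 'k)"
  where "delta_face \<sigma> = (\<Sum>i | i \<in> \<sigma> \<and> Qlcm E Q (\<sigma> - {i}) = Qlcm E Q \<sigma>.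
    Poly_Mapping.single (\<sigma> - {i}) ((- 1) ^ eps_pos \<sigma> i))"

lemma taylor_diff_eq: "taylor_diff E Q = on_basis taylor_face"
  unfolding taylor_diff_def taylor_face_def face_coeff_def ..

lemma delta_diff_eq: "delta_diff E Q = on_basis delta_face"
  unfolding delta_diff_def delta_face_def ..

lemma const_coeff_sign: "const_coeff ((- 1) ^ n :: ('x, 'k) mpol) = (- 1) ^ n"
  by (simp add: const_coeff_power const_coeff_uminus)

lemma const_reduce_taylor_face:
  assumes "\<sigma> \<subseteq> {1..m}" shows "const_reduce (taylor_face \<sigma>) = delta_face \<sigma>"
proof -
  have fin: "finite \<sigma>" by (rule finite_subset[OF assms]) simp
  have "const_reduce (taylor_face \<sigma>) = (\<Sum>i\<in>\<sigma>. if Qlcm E Q (\<sigma> - {i}) = Qlcm E Q \<sigma>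
      then Poly_Mapping.single (\<sigma> - {i}) ((- 1) ^ eps_pos \<sigma> i) else 0)"
    unfolding taylor_face_def const_reduce_sum
    by (rule sum.cong) (simp_all add: const_reduce_single const_coeff_mult const_coeff_sign face_coeff(2)[OF assms])
  also have "\<dots> = delta_face \<sigma>"
    unfolding delta_face_def using fin by (simp add: sum.inter_filter)
  finally show ?thesis .
qed

lemma const_reduce_taylor_mult:
  assumes "\<sigma> \<subseteq> {1..m}" "\<tau> \<subseteq> {1..m}"
  shows "const_reduce (taylor_mult \<sigma> \<tau>) = delta_basis_mult E Q \<sigma> \<tau>"
proof (cases "\<sigma> \<inter> \<tau> = {}")
  case True
  have fin: "finite \<sigma>" "finite \<tau>" by (rule finite_subset[OF assms(1)] finite_subset[OF assms(2)]; simp)+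
  show ?thesis using True
    by (simp add: taylor_mult_def delta_basis_mult_def const_reduce_single const_coeff_mult const_coeff_sign
      mult_coeff(2)[OF assms] sign_shuffle[OF fin True])
next
  case False
  then show ?thesis using rk_Un_noteq[OF assms] by (auto simp: taylor_mult_def delta_basis_mult_def)
qed

lemma keys_taylor_face: "\<rho> \<in> keys (taylor_face \<sigma>) \<Longrightarrow> \<exists>i\<in>\<sigma>. \<rho> = \<sigma> - {i}"
  using keys_sum[of "\<lambda>i. Poly_Mapping.single (\<sigma> - {i}) ((- 1) ^ eps_pos \<sigma> i * face_coeff \<sigma> i)" \<sigma>]
  unfolding taylor_face_def by (force split: if_splits)

lemma taylor_face_card:
  assumes "\<sigma> \<subseteq> {1..m}" "\<rho> \<in> keys (taylor_face \<sigma>)" shows "\<rho> \<subseteq> {1..m}" "card \<sigma> = Suc (card \<rho>)"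
proof -
  have fin: "finite \<sigma>" by (rule finite_subset[OF assms(1)]) simp
  obtain i where i: "i \<in> \<sigma>" "\<rho> = \<sigma> - {i}" using keys_taylor_face[OF assms(2)] by blast
  show "\<rho> \<subseteq> {1..m}" using i assms by blast
  show "card \<sigma> = Suc (card \<rho>)" using card_Suc_Diff1[OF fin i(1)] i(2) by simp
qed

lemma taylor_face_empty [simp]: "taylor_face {} = 0"
  by (simp add: taylor_face_def)

lemma taylor_mult_in: 
  assumes "\<sigma> \<subseteq> {1..m}" "\<tau> \<subseteq> {1..m}"
  shows "taylor_mult \<sigma> \<tau> \<in> subset_module m (card \<sigma> + card \<tau>)"
proof -
  have fin: "finite \<sigma>" "finite \<tau>" by (rule finite_subset[OF assms(1)] finite_subset[OF assms(2)]; simp)+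
  show ?thesis unfolding taylor_mult_def
    by (auto intro!: subset_module_single card_Un_disjoint fin subset_module_closed simp del: atLeastAtMost_iff)
      (use assms in auto)
qed

lemma on_basis_taylor_face:
  "on_basis f (taylor_face \<sigma>) = (\<Sum>i\<in>\<sigma>. pm_scale ((- 1) ^ eps_pos \<sigma> i * face_coeff \<sigma> i) (f (\<sigma> - {i})))"
  unfolding taylor_face_def on_basis_sum by (simp add: on_basis_single)

text \<open>
  Both sides have one term for each element \<open>i\<close> of \<open>\<sigma> \<union> \<tau>\<close>. Up to sign, both coefficients of
  \<open>\<sigma> \<union> \<tau> - {i}\<close> become \<open>Q\<^sub>\<sigma> Q\<^sub>\<tau>\<close> when multiplied by \<open>Q\<close> of that set, and this factor can be
  cancelled.
\<close>

lemma taylor_leibniz_disjoint: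
  assumes \<sigma>: "\<sigma> \<subseteq> {1..m}" and \<tau>: "\<tau> \<subseteq> {1..m}" and disj: "\<sigma> \<inter> \<tau> = {}"
  shows "on_basis taylor_face (taylor_mult \<sigma> \<tau>) =
    on_basis (\<lambda>\<sigma>'. taylor_mult \<sigma>' \<tau>) (taylor_face \<sigma>) +
    pm_scale ((- 1) ^ card \<sigma>) (on_basis (taylor_mult \<sigma>) (taylor_face \<tau>))"
proof -
  have fin: "finite \<sigma>" "finite \<tau>" by (rule finite_subset[OF \<sigma>] finite_subset[OF \<tau>]; simp)+
  have u: "\<sigma> \<union> \<tau> \<subseteq> {1..m}" using \<sigma> \<tau> by blast
  let ?t = "\<lambda>i. pm_scale ((- 1) ^ inversions \<sigma> \<tau> * mult_coeff \<sigma> \<tau>)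
    (Poly_Mapping.single (\<sigma> \<union> \<tau> - {i}) ((- 1) ^ eps_pos (\<sigma> \<union> \<tau>) i * face_coeff (\<sigma> \<union> \<tau>) i))"
  have "on_basis taylor_face (taylor_mult \<sigma> \<tau>) = (\<Sum>i\<in>\<sigma> \<union> \<tau>. ?t i)"
    using disj by (simp add: taylor_mult_def on_basis_single) (simp add: taylor_face_def pm.scale_sum_right)
  also have "\<dots> = (\<Sum>i\<in>\<sigma>. ?t i) + (\<Sum>i\<in>\<tau>. ?t i)"
    by (rule sum.union_disjoint[OF fin disj])
  also have "(\<Sum>i\<in>\<sigma>. ?t i) = on_basis (\<lambda>\<sigma>'. taylor_mult \<sigma>' \<tau>) (taylor_face \<sigma>)"
    unfolding on_basis_taylor_face
  proof (rule sum.cong[OF refl])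
    fix i assume i: "i \<in> \<sigma>"
    have it: "i \<notin> \<tau>" using i disj by blast
    have un: "(\<sigma> - {i}) \<union> \<tau> = \<sigma> \<union> \<tau> - {i}" using it by blast
    have dj: "(\<sigma> - {i}) \<inter> \<tau> = {}" using disj by blast
    have \<sigma>i: "\<sigma> - {i} \<subseteq> {1..m}" using \<sigma> by blast
    have nz: "Qlcm E Q (\<sigma> \<union> \<tau> - {i}) \<noteq> 0" using u by (intro Qlcm_nonzero) blast
    (* the signs agree because their exponents add up to an even number *)
    have eq: "inversions \<sigma> \<tau> + eps_pos (\<sigma> \<union> \<tau>) i + (eps_pos \<sigma> i + inversions (\<sigma> - {i}) \<tau>) =
      2 * (eps_pos \<sigma> i + eps_pos \<tau> i + inversions (\<sigma> - {i}) \<tau>)"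
      unfolding inversions_remove_left[OF fin(1) i, of \<tau>] eps_pos_Un[OF fin disj] by simp
    have sgn: "(- 1) ^ (inversions \<sigma> \<tau> + eps_pos (\<sigma> \<union> \<tau>) i) =
        ((- 1) ^ (eps_pos \<sigma> i + inversions (\<sigma> - {i}) \<tau>) :: ('x, 'k) mpol)"
      by (rule minus_one_power_cong) (simp only: eq dvd_triv_left)
    have "mult_coeff \<sigma> \<tau> * face_coeff (\<sigma> \<union> \<tau>) i * Qlcm E Q (\<sigma> \<union> \<tau> - {i}) =
        mult_coeff \<sigma> \<tau> * Qlcm E Q (\<sigma> \<union> \<tau>)"
      using face_coeff(1)[OF u, of i] by (simp add: mult.assoc)
    also have "\<dots> = face_coeff \<sigma> i * Qlcm E Q (\<sigma> - {i}) * Qlcm E Q \<tau>"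
      by (simp add: mult_coeff(1)[OF \<sigma> \<tau>] face_coeff(1)[OF \<sigma>])
    also have "\<dots> = face_coeff \<sigma> i * mult_coeff (\<sigma> - {i}) \<tau> * Qlcm E Q (\<sigma> \<union> \<tau> - {i})"
      using mult_coeff(1)[OF \<sigma>i \<tau>] unfolding un by (simp add: mult.assoc)
    finally have coeff: "mult_coeff \<sigma> \<tau> * face_coeff (\<sigma> \<union> \<tau>) i = face_coeff \<sigma> i * mult_coeff (\<sigma> - {i}) \<tau>"
      using nz by simp
    have "(- 1) ^ inversions \<sigma> \<tau> * mult_coeff \<sigma> \<tau> * ((- 1) ^ eps_pos (\<sigma> \<union> \<tau>) i * face_coeff (\<sigma> \<union> \<tau>) i) =
      (- 1) ^ (inversions \<sigma> \<tau> + eps_pos (\<sigma> \<union> \<tau>) i) * (mult_coeff \<sigma> \<tau> * face_coeff (\<sigma> \<union> \<tau>) i)"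
      by (simp only: power_add mult_ac)
    also have "\<dots> = (- 1) ^ eps_pos \<sigma> i * face_coeff \<sigma> i * ((- 1) ^ inversions (\<sigma> - {i}) \<tau> * mult_coeff (\<sigma> - {i}) \<tau>)"
      unfolding sgn coeff by (simp only: power_add mult_ac)
    finally show "?t i = pm_scale ((- 1) ^ eps_pos \<sigma> i * face_coeff \<sigma> i) (taylor_mult (\<sigma> - {i}) \<tau>)"
      unfolding taylor_mult_def pm_scale_single un using dj by (simp only: if_True simp_thms pm_scale_single)
  qed
  also have "(\<Sum>i\<in>\<tau>. ?t i) = pm_scale ((- 1) ^ card \<sigma>) (on_basis (taylor_mult \<sigma>) (taylor_face \<tau>))"
    unfolding on_basis_taylor_face pm.scale_sum_right
  proof (rule sum.cong[OF refl])
    fix i assume i: "i \<in> \<tau>"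
    have it: "i \<notin> \<sigma>" using i disj by blast
    have un: "\<sigma> \<union> (\<tau> - {i}) = \<sigma> \<union> \<tau> - {i}" using it by blast
    have dj: "\<sigma> \<inter> (\<tau> - {i}) = {}" using disj by blast
    have \<tau>i: "\<tau> - {i} \<subseteq> {1..m}" using \<tau> by blast
    have nz: "Qlcm E Q (\<sigma> \<union> \<tau> - {i}) \<noteq> 0" using u by (intro Qlcm_nonzero) blast
    have eq: "inversions \<sigma> \<tau> + eps_pos (\<sigma> \<union> \<tau>) i + (card \<sigma> + eps_pos \<tau> i + inversions \<sigma> (\<tau> - {i})) =
      2 * (inversions \<sigma> (\<tau> - {i}) + card {a\<in>\<sigma>. i < a} + eps_pos \<sigma> i + eps_pos \<tau> i)"
      unfolding inversions_remove_right[OF fin i] eps_pos_Un[OF fin disj]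
      using card_split_at[OF fin(1), of i] it by simp
    have sgn: "(- 1) ^ (inversions \<sigma> \<tau> + eps_pos (\<sigma> \<union> \<tau>) i) =
        ((- 1) ^ (card \<sigma> + eps_pos \<tau> i + inversions \<sigma> (\<tau> - {i})) :: ('x, 'k) mpol)"
      by (rule minus_one_power_cong) (simp only: eq dvd_triv_left)
    have "mult_coeff \<sigma> \<tau> * face_coeff (\<sigma> \<union> \<tau>) i * Qlcm E Q (\<sigma> \<union> \<tau> - {i}) =
        mult_coeff \<sigma> \<tau> * Qlcm E Q (\<sigma> \<union> \<tau>)"
      using face_coeff(1)[OF u, of i] by (simp add: mult.assoc)
    also have "\<dots> = face_coeff \<tau> i * (Qlcm E Q \<sigma> * Qlcm E Q (\<tau> - {i}))"
      using face_coeff(1)[OF \<tau>, of i] by (simp add: mult_coeff(1)[OF \<sigma> \<tau>] mult.left_commute)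
    also have "\<dots> = face_coeff \<tau> i * mult_coeff \<sigma> (\<tau> - {i}) * Qlcm E Q (\<sigma> \<union> \<tau> - {i})"
      using mult_coeff(1)[OF \<sigma> \<tau>i] unfolding un by (simp add: mult.assoc)
    finally have coeff: "mult_coeff \<sigma> \<tau> * face_coeff (\<sigma> \<union> \<tau>) i = face_coeff \<tau> i * mult_coeff \<sigma> (\<tau> - {i})"
      using nz by simp
    have "(- 1) ^ inversions \<sigma> \<tau> * mult_coeff \<sigma> \<tau> * ((- 1) ^ eps_pos (\<sigma> \<union> \<tau>) i * face_coeff (\<sigma> \<union> \<tau>) i) =
      (- 1) ^ (inversions \<sigma> \<tau> + eps_pos (\<sigma> \<union> \<tau>) i) * (mult_coeff \<sigma> \<tau> * face_coeff (\<sigma> \<union> \<tau>) i)"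
      by (simp only: power_add mult_ac)
    also have "\<dots> = (- 1) ^ card \<sigma> * ((- 1) ^ eps_pos \<tau> i * face_coeff \<tau> i *
        ((- 1) ^ inversions \<sigma> (\<tau> - {i}) * mult_coeff \<sigma> (\<tau> - {i})))"
      unfolding sgn coeff by (simp only: power_add mult_ac)
    finally show "?t i = pm_scale ((- 1) ^ card \<sigma>)
        (pm_scale ((- 1) ^ eps_pos \<tau> i * face_coeff \<tau> i) (taylor_mult \<sigma> (\<tau> - {i})))"
      unfolding taylor_mult_def pm_scale_single un using dj by (simp only: if_True simp_thms pm_scale_single)
  qed
  finally show ?thesis .
qed

text \<open>
  A term survives only if it removes the only common element of \<open>\<sigma>\<close> and \<open>\<tau>\<close>. If there is exactly
  one, it can be removed from \<open>\<sigma>\<close> or from \<open>\<tau>\<close>, and the two terms cancel.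
\<close>

lemma taylor_leibniz_meet:
  assumes \<sigma>: "\<sigma> \<subseteq> {1..m}" and \<tau>: "\<tau> \<subseteq> {1..m}" and i: "i \<in> \<sigma> \<inter> \<tau>"
  shows "on_basis (\<lambda>\<sigma>'. taylor_mult \<sigma>' \<tau>) (taylor_face \<sigma>) +
    pm_scale ((- 1) ^ card \<sigma>) (on_basis (taylor_mult \<sigma>) (taylor_face \<tau>)) = 0"
proof -
  have fin: "finite \<sigma>" "finite \<tau>" by (rule finite_subset[OF \<sigma>] finite_subset[OF \<tau>]; simp)+
  have L: "on_basis (\<lambda>\<sigma>'. taylor_mult \<sigma>' \<tau>) (taylor_face \<sigma>) =
      pm_scale ((- 1) ^ eps_pos \<sigma> i * face_coeff \<sigma> i) (taylor_mult (\<sigma> - {i}) \<tau>)"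
  proof -
    have "taylor_mult (\<sigma> - {j}) \<tau> = 0" if "j \<in> \<sigma> - {i}" for j
      using i that by (auto simp: taylor_mult_def)
    then have "(\<Sum>j\<in>\<sigma> - {i}. pm_scale ((- 1) ^ eps_pos \<sigma> j * face_coeff \<sigma> j) (taylor_mult (\<sigma> - {j}) \<tau>)) = 0"
      by (intro sum.neutral) simp
    then show ?thesis unfolding on_basis_taylor_face
      by (subst sum.remove[OF fin(1), of i]) (use i in simp_all)
  qed
  have R: "on_basis (taylor_mult \<sigma>) (taylor_face \<tau>) =
      pm_scale ((- 1) ^ eps_pos \<tau> i * face_coeff \<tau> i) (taylor_mult \<sigma> (\<tau> - {i}))"
  proof -
    have "taylor_mult \<sigma> (\<tau> - {j}) = 0" if "j \<in> \<tau> - {i}" for j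
      using i that by (auto simp: taylor_mult_def)
    then have "(\<Sum>j\<in>\<tau> - {i}. pm_scale ((- 1) ^ eps_pos \<tau> j * face_coeff \<tau> j) (taylor_mult \<sigma> (\<tau> - {j}))) = 0"
      by (intro sum.neutral) simp
    then show ?thesis unfolding on_basis_taylor_face
      by (subst sum.remove[OF fin(2), of i]) (use i in simp_all)
  qed
  show ?thesis
  proof (cases "\<sigma> \<inter> \<tau> = {i}")
    case False
    then have "(\<sigma> - {i}) \<inter> \<tau> \<noteq> {}" "\<sigma> \<inter> (\<tau> - {i}) \<noteq> {}" using i by auto
    then show ?thesis unfolding L R by (simp add: taylor_mult_def)
  next
    case True
    have un: "(\<sigma> - {i}) \<union> \<tau> = \<sigma> \<union> \<tau>" "\<sigma> \<union> (\<tau> - {i}) = \<sigma> \<union> \<tau>" using i by auto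
    have dj: "(\<sigma> - {i}) \<inter> \<tau> = {}" "\<sigma> \<inter> (\<tau> - {i}) = {}" using True by auto
    have sub: "\<sigma> - {i} \<subseteq> {1..m}" "\<tau> - {i} \<subseteq> {1..m}" using \<sigma> \<tau> by auto
    have nz: "Qlcm E Q (\<sigma> \<union> \<tau>) \<noteq> 0" using \<sigma> \<tau> by (intro Qlcm_nonzero) auto
    have "face_coeff \<sigma> i * mult_coeff (\<sigma> - {i}) \<tau> * Qlcm E Q (\<sigma> \<union> \<tau>) =
        (face_coeff \<sigma> i * Qlcm E Q (\<sigma> - {i})) * Qlcm E Q \<tau>"
      using mult_coeff(1)[OF sub(1) \<tau>] unfolding un by (simp add: mult.assoc)
    also have "\<dots> = Qlcm E Q \<sigma> * Qlcm E Q \<tau>" by (simp add: face_coeff(1)[OF \<sigma>])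
    also have "\<dots> = face_coeff \<tau> i * (Qlcm E Q \<sigma> * Qlcm E Q (\<tau> - {i}))"
      using face_coeff(1)[OF \<tau>, of i] by (simp add: mult.left_commute)
    also have "\<dots> = face_coeff \<tau> i * mult_coeff \<sigma> (\<tau> - {i}) * Qlcm E Q (\<sigma> \<union> \<tau>)"
      using mult_coeff(1)[OF \<sigma> sub(2)] unfolding un by (simp add: mult.assoc)
    finally have coeff: "face_coeff \<sigma> i * mult_coeff (\<sigma> - {i}) \<tau> = face_coeff \<tau> i * mult_coeff \<sigma> (\<tau> - {i})"
      using nz by simp
    have 1: "inversions (\<sigma> - {i}) \<tau> = inversions (\<sigma> - {i}) (\<tau> - {i}) + card {a\<in>\<sigma> - {i}. i < a}"
      using inversions_remove_right[of "\<sigma> - {i}" \<tau> i] fin i by simp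
    have 2: "inversions \<sigma> (\<tau> - {i}) = eps_pos (\<tau> - {i}) i + inversions (\<sigma> - {i}) (\<tau> - {i})"
      using inversions_remove_left[OF fin(1)] i by simp
    have 3: "eps_pos \<tau> i = eps_pos (\<tau> - {i}) i" using eps_pos_remove[OF fin(2), of i i] i by simp
    have "{a\<in>\<sigma> - {i}. i < a} = {a\<in>\<sigma>. i < a}" by auto
    then have 4: "card \<sigma> = eps_pos \<sigma> i + card {a\<in>\<sigma> - {i}. i < a} + 1"
      using card_split_at[OF fin(1), of i] i by simp
    (* the element \<open>i\<close> itself is counted in the cardinality of \<open>\<sigma>\<close> only, which makes the sum odd *)
    have eq: "eps_pos \<sigma> i + inversions (\<sigma> - {i}) \<tau> + (card \<sigma> + eps_pos \<tau> i + inversions \<sigma> (\<tau> - {i})) =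
      2 * (eps_pos \<sigma> i + card {a\<in>\<sigma> - {i}. i < a} + inversions (\<sigma> - {i}) (\<tau> - {i}) + eps_pos \<tau> i) + 1"
      unfolding 1 2 3 4 by simp
    have sgn: "(- 1) ^ (eps_pos \<sigma> i + inversions (\<sigma> - {i}) \<tau>) =
        - ((- 1) ^ (card \<sigma> + eps_pos \<tau> i + inversions \<sigma> (\<tau> - {i})) :: ('x, 'k) mpol)"
      by (rule minus_one_power_opp) (simp only: eq, simp)
    have "(- 1) ^ eps_pos \<sigma> i * face_coeff \<sigma> i * ((- 1) ^ inversions (\<sigma> - {i}) \<tau> * mult_coeff (\<sigma> - {i}) \<tau>) =
        (- 1) ^ (eps_pos \<sigma> i + inversions (\<sigma> - {i}) \<tau>) * (face_coeff \<sigma> i * mult_coeff (\<sigma> - {i}) \<tau>)"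
      by (simp only: power_add mult_ac)
    also have "\<dots> = - ((- 1) ^ card \<sigma> * ((- 1) ^ eps_pos \<tau> i * face_coeff \<tau> i *
        ((- 1) ^ inversions \<sigma> (\<tau> - {i}) * mult_coeff \<sigma> (\<tau> - {i}))))"
      unfolding sgn coeff by (simp only: power_add mult_ac mult_minus_left mult_minus_right)
    finally show ?thesis
      unfolding L R
      unfolding taylor_mult_def un using dj
      by (simp only: if_True simp_thms pm_scale_single flip: single_add) simp
  qed
qed

lemma taylor_leibniz:
  assumes "\<sigma> \<subseteq> {1..m}" "\<tau> \<subseteq> {1..m}"
  shows "on_basis taylor_face (taylor_mult \<sigma> \<tau>) =
    on_basis (\<lambda>\<sigma>'. taylor_mult \<sigma>' \<tau>) (taylor_face \<sigma>) +
    pm_scale ((- 1) ^ card \<sigma>) (on_basis (taylor_mult \<sigma>) (taylor_face \<tau>))"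
proof (cases "\<sigma> \<inter> \<tau> = {}")
  case False
  then obtain i where "i \<in> \<sigma> \<inter> \<tau>" by blast
  from taylor_leibniz_meet[OF assms this] False show ?thesis by (simp add: taylor_mult_def)
qed (rule taylor_leibniz_disjoint[OF assms])

end

section \<open>Homotopies between bilinear maps on the Taylor complex\<close>

locale taylor_resolution = taylor_data Q m E
  for Q :: "nat \<Rightarrow> ('x::{finite,linorder}, 'k::field) mpol" and m E +
  fixes I :: "('x, 'k) mpol set"
  assumes I_def: "I = ideal_gen (Q ` {1..m})"
    and taylor_res: "taylor_is_resolution E Q m I"
begin

lemma module_mult: "module ((*) :: ('x, 'k) mpol \<Rightarrow> _)"
  by standard (simp_all add: algebra_simps)

lemma ideal_I: "0 \<in> I" "a \<in> I \<Longrightarrow> b \<in> I \<Longrightarrow> a + b \<in> I" "a \<in> I \<Longrightarrow> r * a \<in> I"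
  unfolding I_def ideal_gen_def
  by (simp_all add: module.span_zero[OF module_mult] module.span_add[OF module_mult] module.span_scale[OF module_mult])

sublocale K: resolution pm_scale "subset_module m" "\<lambda>_. taylor_diff E Q" "taylor_aug I" I
  by standard (use taylor_res ideal_I in \<open>simp_all add: taylor_is_resolution_def\<close>)

text \<open>
  The generators are homogeneous of positive degree.
\<close>

lemma const_coeff_I: "a \<in> I \<Longrightarrow> const_coeff a = 0"
  unfolding I_def ideal_gen_def
proof (induction rule: module.span_induct[OF module_mult, consumes 1, case_names base step])
  case base
  show ?case unfolding module.subspace_def[OF module_mult] by (simp add: const_coeff_add const_coeff_mult)
next
  case (step a)
  then obtain i where "i \<in> {1..m}" "a = Q i" by blast
  then show ?case using const_coeff_homogeneous[OF hom nonconst] by blast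
qed

lemma taylor_diff_single: "taylor_diff E Q (Poly_Mapping.single \<sigma> 1) = taylor_face \<sigma>"
  by (simp add: taylor_diff_eq on_basis_single)

lemma taylor_face_in:
  assumes "\<sigma> \<subseteq> {1..m}" "card \<sigma> = Suc p" shows "taylor_face \<sigma> \<in> subset_module m p"
  using taylor_face_card[OF assms(1)] assms(2) by (auto simp: subset_module_def)

lemma on_basis_taylor_face_face:
  assumes "\<sigma> \<subseteq> {1..m}" shows "on_basis taylor_face (taylor_face \<sigma>) = 0"
proof (cases "card \<sigma>")
  case 0
  then have "\<sigma> = {}" using finite_subset[OF assms] by simp
  then show ?thesis by simp
next
  case (Suc p)
  then have "Poly_Mapping.single \<sigma> 1 \<in> subset_module m (Suc p)" using assms by (intro subset_module_single)
  from K.d_d[OF this] show ?thesis by (simp add: taylor_diff_single) (simp add: taylor_diff_eq)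
qed

text \<open>
  For bilinear \<open>H\<close> this is \<open>H(d \<sigma>, \<tau>) + (-1)\<^bsup>|\<sigma>|\<^esup> H(\<sigma>, d \<tau>)\<close>, that is, \<open>H\<close> composed with the
  differential of \<open>K \<otimes> K\<close>.
\<close>

definition bilin_diff :: "(nat set \<Rightarrow> nat set \<Rightarrow> (nat set \<Rightarrow>\<^sub>0 ('x, 'k) mpol)) \<Rightarrow> nat set \<Rightarrow> nat set \<Rightarrow> (nat set \<Rightarrow>\<^sub>0 ('x, 'k) mpol)"
  where "bilin_diff H \<sigma> \<tau> = on_basis (\<lambda>\<sigma>'. H \<sigma>' \<tau>) (taylor_face \<sigma>) +
    pm_scale ((- 1) ^ card \<sigma>) (on_basis (H \<sigma>) (taylor_face \<tau>))"

lemma on_basis_bilin_diff: "on_basis f (bilin_diff H \<sigma> \<tau>) = bilin_diff (\<lambda>\<sigma> \<tau>. on_basis f (H \<sigma> \<tau>)) \<sigma> \<tau>"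
  by (simp add: bilin_diff_def on_basis_add on_basis_scale on_basis_on_basis)

lemma bilin_diff_diff: "bilin_diff (\<lambda>\<sigma> \<tau>. G \<sigma> \<tau> - H \<sigma> \<tau>) \<sigma> \<tau> = bilin_diff G \<sigma> \<tau> - bilin_diff H \<sigma> \<tau>"
  by (simp add: bilin_diff_def on_basis_fun_diff pm.scale_right_diff_distrib)

lemma bilin_diff_cong:
  assumes \<sigma>: "\<sigma> \<subseteq> {1..m}" and \<tau>: "\<tau> \<subseteq> {1..m}"
    and eq: "\<And>\<sigma>' \<tau>'. \<sigma>' \<subseteq> {1..m} \<Longrightarrow> \<tau>' \<subseteq> {1..m} \<Longrightarrow> Suc (card \<sigma>' + card \<tau>') = card \<sigma> + card \<tau> \<Longrightarrow> G \<sigma>' \<tau>' = H \<sigma>' \<tau>'"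
  shows "bilin_diff G \<sigma> \<tau> = bilin_diff H \<sigma> \<tau>"
proof -
  have "on_basis (\<lambda>\<sigma>'. G \<sigma>' \<tau>) (taylor_face \<sigma>) = on_basis (\<lambda>\<sigma>'. H \<sigma>' \<tau>) (taylor_face \<sigma>)"
    by (rule on_basis_cong) (use eq \<tau> taylor_face_card[OF \<sigma>] in auto)
  moreover have "on_basis (G \<sigma>) (taylor_face \<tau>) = on_basis (H \<sigma>) (taylor_face \<tau>)"
    by (rule on_basis_cong) (use eq \<sigma> taylor_face_card[OF \<tau>] in auto)
  ultimately show ?thesis by (simp add: bilin_diff_def)
qed

text \<open>
  The square of the differential of \<open>K \<otimes> K\<close>: the mixed terms cancel because \<open>d\<close> lowers the
  degree of \<open>\<sigma>\<close> by one and so changes the sign.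
\<close>

lemma bilin_diff_bilin_diff:
  assumes \<sigma>: "\<sigma> \<subseteq> {1..m}" and \<tau>: "\<tau> \<subseteq> {1..m}"
  shows "bilin_diff (bilin_diff H) \<sigma> \<tau> = 0"
proof -
  let ?A = "on_basis (\<lambda>\<sigma>'. on_basis (H \<sigma>') (taylor_face \<tau>)) (taylor_face \<sigma>)"
  have 1: "on_basis (\<lambda>\<sigma>'. on_basis (\<lambda>\<sigma>''. H \<sigma>'' \<tau>) (taylor_face \<sigma>')) (taylor_face \<sigma>) = 0"
    by (simp add: on_basis_taylor_face_face[OF \<sigma>] flip: on_basis_on_basis)
  have 2: "on_basis (\<lambda>\<tau>'. on_basis (H \<sigma>) (taylor_face \<tau>')) (taylor_face \<tau>) = 0"
    by (simp add: on_basis_taylor_face_face[OF \<tau>] flip: on_basis_on_basis)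
  have sgn: "(- 1) ^ card \<sigma>' = - ((- 1) ^ card \<sigma> :: ('x, 'k) mpol)" if "\<sigma>' \<in> keys (taylor_face \<sigma>)" for \<sigma>'
    using taylor_face_card(2)[OF \<sigma> that] by simp
  have "on_basis (\<lambda>\<sigma>'. pm_scale ((- 1) ^ card \<sigma>') (on_basis (H \<sigma>') (taylor_face \<tau>))) (taylor_face \<sigma>) =
    on_basis (\<lambda>\<sigma>'. pm_scale (- ((- 1) ^ card \<sigma>)) (on_basis (H \<sigma>') (taylor_face \<tau>))) (taylor_face \<sigma>)"
    by (rule on_basis_cong) (simp only: sgn)
  also have "\<dots> = pm_scale (- ((- 1) ^ card \<sigma>)) ?A" by (rule on_basis_fun_scale)
  finally have 3: "on_basis (\<lambda>\<sigma>'. pm_scale ((- 1) ^ card \<sigma>') (on_basis (H \<sigma>') (taylor_face \<tau>))) (taylor_face \<sigma>) =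
    - pm_scale ((- 1) ^ card \<sigma>) ?A" by (simp add: pm.scale_minus_left)
  have 4: "on_basis (\<lambda>\<tau>'. on_basis (\<lambda>\<sigma>'. H \<sigma>' \<tau>') (taylor_face \<sigma>)) (taylor_face \<tau>) = ?A"
    by (rule on_basis_swap[symmetric])
  have L: "on_basis (\<lambda>\<sigma>'. bilin_diff H \<sigma>' \<tau>) (taylor_face \<sigma>) = - pm_scale ((- 1) ^ card \<sigma>) ?A"
    unfolding bilin_diff_def on_basis_fun_add 1 3 by simp
  have R: "on_basis (bilin_diff H \<sigma>) (taylor_face \<tau>) = ?A"
    unfolding bilin_diff_def on_basis_fun_add on_basis_fun_scale 2 4 by simp
  show ?thesis
    unfolding bilin_diff_def[of "bilin_diff H"] L R by simp
qed

text \<open>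
  The analogue of \<open>null_homotopy\<close> for \<open>K \<otimes> K\<close>, by induction on \<open>|\<sigma>| + |\<tau>|\<close>. Let \<open>L\<close> be
  \<open>bilin_diff\<close>. In the next degree \<open>G - L H\<close> is a cycle, because
  \<open>d(G - L H) = L G - L(d H) = L G - L(G - L H) = L(L H) = 0\<close>. There are only finitely many
  subsets, so finitely many steps are enough.
\<close>

theorem bilinear_null_homotopy:
  assumes G: "\<And>\<sigma> \<tau>. \<sigma> \<subseteq> {1..m} \<Longrightarrow> \<tau> \<subseteq> {1..m} \<Longrightarrow> G \<sigma> \<tau> \<in> subset_module m (card \<sigma> + card \<tau>)"
    and leibniz: "\<And>\<sigma> \<tau>. \<sigma> \<subseteq> {1..m} \<Longrightarrow> \<tau> \<subseteq> {1..m} \<Longrightarrow> on_basis taylor_face (G \<sigma> \<tau>) = bilin_diff G \<sigma> \<tau>"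
    and aug: "taylor_aug I (G {} {}) = I"
  shows "\<exists>H. \<forall>\<sigma> \<tau>. \<sigma> \<subseteq> {1..m} \<longrightarrow> \<tau> \<subseteq> {1..m} \<longrightarrow>
    H \<sigma> \<tau> \<in> subset_module m (Suc (card \<sigma> + card \<tau>)) \<and>
    G \<sigma> \<tau> = on_basis taylor_face (H \<sigma> \<tau>) + bilin_diff H \<sigma> \<tau>"
proof -
  let ?P = "\<lambda>H \<sigma> \<tau>. H \<sigma> \<tau> \<in> subset_module m (Suc (card \<sigma> + card \<tau>)) \<and>
    G \<sigma> \<tau> = on_basis taylor_face (H \<sigma> \<tau>) + bilin_diff H \<sigma> \<tau>"
  have "\<exists>H. \<forall>\<sigma> \<tau>. \<sigma> \<subseteq> {1..m} \<longrightarrow> \<tau> \<subseteq> {1..m} \<longrightarrow> card \<sigma> + card \<tau> < n \<longrightarrow> ?P H \<sigma> \<tau>" for n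
  proof (induction n)
    case (Suc n)
    then obtain H where H: "\<And>\<sigma> \<tau>. \<sigma> \<subseteq> {1..m} \<Longrightarrow> \<tau> \<subseteq> {1..m} \<Longrightarrow> card \<sigma> + card \<tau> < n \<Longrightarrow> ?P H \<sigma> \<tau>" by blast
    have ex: "\<exists>y\<in>subset_module m (Suc n). on_basis taylor_face y = G \<sigma> \<tau> - bilin_diff H \<sigma> \<tau>"
      if \<sigma>: "\<sigma> \<subseteq> {1..m}" and \<tau>: "\<tau> \<subseteq> {1..m}" and n: "card \<sigma> + card \<tau> = n" for \<sigma> \<tau>
    proof -
      let ?z = "G \<sigma> \<tau> - bilin_diff H \<sigma> \<tau>"
      have "?z \<in> (\<lambda>_. taylor_diff E Q) (Suc n) ` subset_module m (Suc n)"
      proof (cases n)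
        case 0
        then have e: "\<sigma> = {}" "\<tau> = {}" using finite_subset[OF \<sigma>] finite_subset[OF \<tau>] n by auto
        have "bilin_diff H \<sigma> \<tau> = 0" by (simp add: e bilin_diff_def)
        then show ?thesis using K.exact_0[of "G {} {}"] aug G[OF \<sigma> \<tau>] e 0 by simp
      next
        case (Suc n')
        have "bilin_diff H \<sigma> \<tau> \<in> subset_module m n"
          unfolding bilin_diff_def
        proof (intro subset_module_closed subset_module_on_basis)
          show "H \<sigma>' \<tau> \<in> subset_module m n" if "\<sigma>' \<in> keys (taylor_face \<sigma>)" for \<sigma>'
            using H[of \<sigma>' \<tau>] taylor_face_card[OF \<sigma> that] \<tau> n by simp
          show "H \<sigma> \<tau>' \<in> subset_module m n" if "\<tau>' \<in> keys (taylor_face \<tau>)" for \<tau>'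
            using H[of \<sigma> \<tau>'] taylor_face_card[OF \<tau> that] \<sigma> n by simp
        qed
        then have z: "?z \<in> subset_module m n" using G[OF \<sigma> \<tau>] n by (intro subset_module_closed) auto
        have "bilin_diff (\<lambda>\<sigma> \<tau>. on_basis taylor_face (H \<sigma> \<tau>)) \<sigma> \<tau> =
            bilin_diff (\<lambda>\<sigma> \<tau>. G \<sigma> \<tau> - bilin_diff H \<sigma> \<tau>) \<sigma> \<tau>"
          by (rule bilin_diff_cong[OF \<sigma> \<tau>]) (use H n in \<open>auto simp: algebra_simps\<close>)
        also have "\<dots> = bilin_diff G \<sigma> \<tau>"
          unfolding bilin_diff_diff bilin_diff_bilin_diff[OF \<sigma> \<tau>] by simp
        finally have "on_basis taylor_face ?z = 0"
          unfolding on_basis_diff leibniz[OF \<sigma> \<tau>] on_basis_bilin_diff by simp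
        then show ?thesis using K.exact[of ?z n'] z Suc by (simp add: taylor_diff_eq)
      qed
      then show ?thesis by (auto simp: taylor_diff_eq)
    qed
    define H' where "H' \<sigma> \<tau> = (if card \<sigma> + card \<tau> < n then H \<sigma> \<tau> else
      SOME y. y \<in> subset_module m (Suc n) \<and> on_basis taylor_face y = G \<sigma> \<tau> - bilin_diff H \<sigma> \<tau>)" for \<sigma> \<tau>
    have "?P H' \<sigma> \<tau>" if \<sigma>: "\<sigma> \<subseteq> {1..m}" and \<tau>: "\<tau> \<subseteq> {1..m}" and n: "card \<sigma> + card \<tau> < Suc n" for \<sigma> \<tau>
    proof -
      have eq: "bilin_diff H' \<sigma> \<tau> = bilin_diff H \<sigma> \<tau>"
        by (rule bilin_diff_cong[OF \<sigma> \<tau>]) (use n in \<open>auto simp: H'_def\<close>)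
      show ?thesis
      proof (cases "card \<sigma> + card \<tau> < n")
        case True
        then show ?thesis using H[OF \<sigma> \<tau> True] unfolding eq by (simp add: H'_def)
      next
        case False
        then have n': "card \<sigma> + card \<tau> = n" using n by simp
        have "H' \<sigma> \<tau> \<in> subset_module m (Suc n) \<and> on_basis taylor_face (H' \<sigma> \<tau>) = G \<sigma> \<tau> - bilin_diff H \<sigma> \<tau>"
          using someI_ex[of "\<lambda>y. y \<in> subset_module m (Suc n) \<and> on_basis taylor_face y = G \<sigma> \<tau> - bilin_diff H \<sigma> \<tau>"]
            ex[OF \<sigma> \<tau> n'] False unfolding H'_def by auto
        then show ?thesis unfolding eq n' by simp
      qed
    qed
    then show ?case by blast
  qed simp
  from this[of "Suc (m + m)"] obtain H
    where H: "\<And>\<sigma> \<tau>. \<sigma> \<subseteq> {1..m} \<Longrightarrow> \<tau> \<subseteq> {1..m} \<Longrightarrow> card \<sigma> + card \<tau> < Suc (m + m) \<Longrightarrow> ?P H \<sigma> \<tau>" by blast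
  have "card \<sigma> + card \<tau> < Suc (m + m)" if "\<sigma> \<subseteq> {1..m}" "\<tau> \<subseteq> {1..m}" for \<sigma> \<tau>
    using card_mono[OF _ that(1)] card_mono[OF _ that(2)] by simp
  with H show ?thesis by blast
qed

end

locale multiplication_lift = resolution s F d \<epsilon> I
  for s :: "'r::comm_ring_1 \<Rightarrow> 'm::ab_group_add \<Rightarrow> 'm" and F d \<epsilon> I +
  fixes \<mu>
  assumes \<mu>: "lifts_multiplication s F d \<epsilon> I \<mu>"
begin

lemma linear_\<mu>_right: "x \<in> F p \<Longrightarrow> linear_map_on s s (F q) (F (p + q)) (\<lambda>y. \<mu> p q x y)"
  and linear_\<mu>_left: "y \<in> F q \<Longrightarrow> linear_map_on s s (F p) (F (p + q)) (\<lambda>x. \<mu> p q x y)"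
  and \<mu>_leibniz: "x \<in> F p \<Longrightarrow> y \<in> F q \<Longrightarrow>
    d (p + q) (\<mu> p q x y) = \<mu> (p - 1) q (d p x) y + s ((- 1) ^ p) (\<mu> p (q - 1) x (d q y))"
  and \<mu>_aug: "x \<in> F 0 \<Longrightarrow> y \<in> F 0 \<Longrightarrow> \<epsilon> x = a +o I \<Longrightarrow> \<epsilon> y = b +o I \<Longrightarrow> \<epsilon> (\<mu> 0 0 x y) = (a * b) +o I"
  using \<mu> by (simp_all add: lifts_multiplication_def)

lemma \<mu>_in: "x \<in> F p \<Longrightarrow> y \<in> F q \<Longrightarrow> \<mu> p q x y \<in> F (p + q)"
  using linear_map_onD(1)[OF linear_\<mu>_right] .

lemma \<mu>_0: "y \<in> F q \<Longrightarrow> \<mu> p q 0 y = 0" "x \<in> F p \<Longrightarrow> \<mu> p q x 0 = 0"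
  using linear_map_on_0[OF linear_\<mu>_left F_closed(1)] linear_map_on_0[OF linear_\<mu>_right F_closed(1)] by blast+

end

text \<open>
  Comparison maps in both directions: \<open>\<phi>\<close> induces the isomorphism on homology, and \<open>\<psi>\<close> gives its inverse and
  carries \<open>\<mu>\<close> over to the Taylor complex.
\<close>

locale taylor_comparison = taylor_resolution Q m E I + F: multiplication_lift s F d \<epsilon> I \<mu>
  for Q :: "nat \<Rightarrow> ('x::{finite,linorder}, 'k::field) mpol" and m E I
    and s :: "('x, 'k) mpol \<Rightarrow> 'm::ab_group_add \<Rightarrow> 'm" and F d \<epsilon> \<mu> +
  fixes \<phi> \<psi>
  assumes \<phi>: "comparison_map s F d \<epsilon> pm_scale (subset_module m) (\<lambda>_. taylor_diff E Q) (taylor_aug I) \<phi>"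
    and \<psi>: "comparison_map pm_scale (subset_module m) (\<lambda>_. taylor_diff E Q) (taylor_aug I) s F d \<epsilon> \<psi>"
begin

lemma linear_\<phi>: "linear_map_on s pm_scale (F p) (subset_module m p) (\<phi> p)"
  and linear_\<psi>: "linear_map_on pm_scale s (subset_module m p) (F p) (\<psi> p)"
  and \<phi>_d: "x \<in> F (Suc p) \<Longrightarrow> \<phi> p (d (Suc p) x) = taylor_diff E Q (\<phi> (Suc p) x)"
  and \<psi>_d: "v \<in> subset_module m (Suc p) \<Longrightarrow> \<psi> p (taylor_diff E Q v) = d (Suc p) (\<psi> (Suc p) v)"
  and \<phi>_aug: "x \<in> F 0 \<Longrightarrow> taylor_aug I (\<phi> 0 x) = \<epsilon> x"
  and \<psi>_aug: "v \<in> subset_module m 0 \<Longrightarrow> \<epsilon> (\<psi> 0 v) = taylor_aug I v"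
  using \<phi> \<psi> by (simp_all add: comparison_map_def)

text \<open>
  The multiplication of \<open>F\<close>, carried to the Taylor complex by the comparison maps.
\<close>

definition transported :: "nat \<Rightarrow> nat \<Rightarrow> (nat set \<Rightarrow>\<^sub>0 ('x, 'k) mpol) \<Rightarrow> (nat set \<Rightarrow>\<^sub>0 ('x, 'k) mpol) \<Rightarrow> (nat set \<Rightarrow>\<^sub>0 ('x, 'k) mpol)"
  where "transported p q v w = \<phi> (p + q) (\<mu> p q (\<psi> p v) (\<psi> q w))"

lemma transported_left: "w \<in> subset_module m q \<Longrightarrow>
    linear_map_on pm_scale pm_scale (subset_module m p) (subset_module m (p + q)) (\<lambda>v. transported p q v w)"
  unfolding transported_def
  by (intro linear_map_on_compose[OF linear_map_on_compose[OF linear_\<psi> F.linear_\<mu>_left] linear_\<phi>] linear_map_onD(1)[OF linear_\<psi>])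

lemma transported_right: "v \<in> subset_module m p \<Longrightarrow>
    linear_map_on pm_scale pm_scale (subset_module m q) (subset_module m (p + q)) (\<lambda>w. transported p q v w)"
  unfolding transported_def
  by (intro linear_map_on_compose[OF linear_map_on_compose[OF linear_\<psi> F.linear_\<mu>_right] linear_\<phi>] linear_map_onD(1)[OF linear_\<psi>])

lemma transported_in:
  "v \<in> subset_module m p \<Longrightarrow> w \<in> subset_module m q \<Longrightarrow> transported p q v w \<in> subset_module m (p + q)"
  using linear_map_onD(1)[OF transported_left] .

lemma transported_0: "w \<in> subset_module m q \<Longrightarrow> transported p q 0 w = 0" "v \<in> subset_module m p \<Longrightarrow> transported p q v 0 = 0"
  using linear_map_on_0[OF transported_left K.F_closed(1)] linear_map_on_0[OF transported_right K.F_closed(1)] by blast+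

text \<open>
  In degree \<open>0\<close> the truncated index \<open>p - 1\<close> is harmless, but it forces a case distinction: then the
  differential, and with it the whole term, is zero.
\<close>

lemma transported_leibniz:
  assumes v: "v \<in> subset_module m p" and w: "w \<in> subset_module m q"
  shows "taylor_diff E Q (transported p q v w) =
    transported (p - 1) q (taylor_diff E Q v) w + pm_scale ((- 1) ^ p) (transported p (q - 1) v (taylor_diff E Q w))"
proof -
  have x: "\<psi> p v \<in> F p" and y: "\<psi> q w \<in> F q" using linear_map_onD(1)[OF linear_\<psi>] v w by blast+
  note L = F.\<mu>_leibniz[OF x y]
  show ?thesis
  proof (cases p)
    case p: 0
    then have dv: "taylor_diff E Q v = 0" using K.d_0 v by simp
    show ?thesis
    proof (cases q)
      case q: 0
      then have dw: "taylor_diff E Q w = 0" using K.d_0 w by simp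
      have "transported 0 0 v w \<in> subset_module m 0" using transported_in[OF v w] p q by simp
      then have "taylor_diff E Q (transported 0 0 v w) = 0" by (rule K.d_0)
      then show ?thesis using transported_0(1)[of w 0 0] transported_0(2)[of v 0 0] v w p q by (simp add: dv dw)
    next
      case q: (Suc q')
      have "d (Suc q') (\<mu> 0 (Suc q') (\<psi> 0 v) (\<psi> (Suc q') w)) = \<mu> 0 q' (\<psi> 0 v) (d (Suc q') (\<psi> (Suc q') w))"
        using L x y p q by (simp add: F.\<mu>_0)
      then have "taylor_diff E Q (transported 0 (Suc q') v w) = transported 0 q' v (taylor_diff E Q w)"
        using \<phi>_d[of "\<mu> 0 (Suc q') (\<psi> 0 v) (\<psi> (Suc q') w)" q'] F.\<mu>_in[OF x y] \<psi>_d[of w q'] w p q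
        by (simp add: transported_def)
      then show ?thesis using transported_0(1)[OF w] by (simp add: p q dv)
    qed
  next
    case p: (Suc p')
    have dx: "d p (\<psi> p v) = \<psi> p' (taylor_diff E Q v)" using \<psi>_d[of v p'] v p by simp
    have dx_in: "\<psi> p' (taylor_diff E Q v) \<in> F p'" using linear_map_onD(1)[OF F.linear_d, of "\<psi> p v" p'] x p dx by simp
    have \<phi>eq: "taylor_diff E Q (transported p q v w) = \<phi> (p' + q) (d (p + q) (\<mu> p q (\<psi> p v) (\<psi> q w)))"
      using \<phi>_d[of "\<mu> p q (\<psi> p v) (\<psi> q w)" "p' + q"] F.\<mu>_in[OF x y] p by (simp add: transported_def)
    show ?thesis
    proof (cases q)
      case q: 0
      have dw: "taylor_diff E Q w = 0" using K.d_0 w q by simp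
      have "d q (\<psi> q w) = 0" using y q by simp
      then show ?thesis using L x \<phi>eq transported_0(2)[OF v, of 0] by (simp add: p q F.\<mu>_0 dw dx[unfolded p] transported_def)
    next
      case q: (Suc q')
      have dy: "d q (\<psi> q w) = \<psi> q' (taylor_diff E Q w)" using \<psi>_d[of w q'] w q by simp
      have dy_in: "\<psi> q' (taylor_diff E Q w) \<in> F q'" using linear_map_onD(1)[OF F.linear_d, of "\<psi> q w" q'] y q dy by simp
      have m1: "\<mu> p' q (\<psi> p' (taylor_diff E Q v)) (\<psi> q w) \<in> F (p' + q)" by (rule F.\<mu>_in[OF dx_in y])
      have m2: "\<mu> p q' (\<psi> p v) (\<psi> q' (taylor_diff E Q w)) \<in> F (p' + q)" using F.\<mu>_in[OF x dy_in] p q by simp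
      have D: "d (p + q) (\<mu> p q (\<psi> p v) (\<psi> q w)) = \<mu> p' q (\<psi> p' (taylor_diff E Q v)) (\<psi> q w) +
          s ((- 1) ^ p) (\<mu> p q' (\<psi> p v) (\<psi> q' (taylor_diff E Q w)))"
        using L dx dy p q by simp
      have e: "p - 1 = p'" "q - 1 = q'" "p + q' = p' + q" using p q by simp_all
      have "taylor_diff E Q (transported p q v w) = \<phi> (p' + q) (\<mu> p' q (\<psi> p' (taylor_diff E Q v)) (\<psi> q w)) +
          pm_scale ((- 1) ^ p) (\<phi> (p' + q) (\<mu> p q' (\<psi> p v) (\<psi> q' (taylor_diff E Q w))))"
        unfolding \<phi>eq D linear_map_onD(2)[OF linear_\<phi> m1 F.F_closed(5)[OF m2]]
          linear_map_onD(3)[OF linear_\<phi> m2] ..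
      then show ?thesis unfolding e by (simp only: transported_def e)
    qed
  qed
qed

definition transported_basis :: "nat set \<Rightarrow> nat set \<Rightarrow> (nat set \<Rightarrow>\<^sub>0 ('x, 'k) mpol)"
  where "transported_basis \<sigma> \<tau> = transported (card \<sigma>) (card \<tau>) (Poly_Mapping.single \<sigma> 1) (Poly_Mapping.single \<tau> 1)"

lemma transported_basis_leibniz:
  assumes \<sigma>: "\<sigma> \<subseteq> {1..m}" and \<tau>: "\<tau> \<subseteq> {1..m}"
  shows "on_basis taylor_face (transported_basis \<sigma> \<tau>) = bilin_diff transported_basis \<sigma> \<tau>"
proof -
  let ?p = "card \<sigma>" and ?q = "card \<tau>" and ?e = "\<lambda>\<sigma>. Poly_Mapping.single \<sigma> (1 :: ('x, 'k) mpol)"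
  have e: "?e \<sigma> \<in> subset_module m ?p" "?e \<tau> \<in> subset_module m ?q"
    by (intro subset_module_single \<sigma> \<tau> refl)+
  have "transported (?p - 1) ?q (taylor_face \<sigma>) (?e \<tau>) = on_basis (\<lambda>\<sigma>'. transported_basis \<sigma>' \<tau>) (taylor_face \<sigma>)"
  proof (cases "?p")
    case 0
    then have "\<sigma> = {}" using finite_subset[OF \<sigma>] by simp
    then show ?thesis using transported_0(1)[OF e(2)] by simp
  next
    case (Suc p')
    have "transported p' ?q (taylor_face \<sigma>) (?e \<tau>) = on_basis (\<lambda>\<sigma>'. transported p' ?q (?e \<sigma>') (?e \<tau>)) (taylor_face \<sigma>)"
      by (rule linear_on_subset_module_on_basis[OF transported_left[OF e(2)] taylor_face_in[OF \<sigma> Suc]])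
    also have "\<dots> = on_basis (\<lambda>\<sigma>'. transported_basis \<sigma>' \<tau>) (taylor_face \<sigma>)"
      by (rule on_basis_cong) (use taylor_face_card(2)[OF \<sigma>] Suc in \<open>simp add: transported_basis_def\<close>)
    finally show ?thesis by (simp add: Suc)
  qed
  moreover have "transported ?p (?q - 1) (?e \<sigma>) (taylor_face \<tau>) = on_basis (transported_basis \<sigma>) (taylor_face \<tau>)"
  proof (cases "?q")
    case 0
    then have "\<tau> = {}" using finite_subset[OF \<tau>] by simp
    then show ?thesis using transported_0(2)[OF e(1)] by simp
  next
    case (Suc q')
    have "transported ?p q' (?e \<sigma>) (taylor_face \<tau>) = on_basis (\<lambda>\<tau>'. transported ?p q' (?e \<sigma>) (?e \<tau>')) (taylor_face \<tau>)"
      by (rule linear_on_subset_module_on_basis[OF transported_right[OF e(1)] taylor_face_in[OF \<tau> Suc]])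
    also have "\<dots> = on_basis (transported_basis \<sigma>) (taylor_face \<tau>)"
      by (rule on_basis_cong) (use taylor_face_card(2)[OF \<tau>] Suc in \<open>simp add: transported_basis_def\<close>)
    finally show ?thesis by (simp add: Suc)
  qed
  ultimately show ?thesis
    using transported_leibniz[OF e]
    by (simp add: transported_basis_def[of \<sigma> \<tau>] bilin_diff_def taylor_diff_single taylor_diff_eq[symmetric])
qed

text \<open>
  Both multiplications send the pair of empty sets to an element over \<open>1\<close>, so their difference is a
  chain map on \<open>K \<otimes> K\<close> over zero.
\<close>

lemma transported_homotopy:
  "\<exists>H. \<forall>\<sigma> \<tau>. \<sigma> \<subseteq> {1..m} \<longrightarrow> \<tau> \<subseteq> {1..m} \<longrightarrow>
    H \<sigma> \<tau> \<in> subset_module m (Suc (card \<sigma> + card \<tau>)) \<and>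
    transported_basis \<sigma> \<tau> = taylor_mult \<sigma> \<tau> + (on_basis taylor_face (H \<sigma> \<tau>) + bilin_diff H \<sigma> \<tau>)"
proof -
  let ?G = "\<lambda>\<sigma> \<tau>. transported_basis \<sigma> \<tau> - taylor_mult \<sigma> \<tau>"
  have "\<exists>H. \<forall>\<sigma> \<tau>. \<sigma> \<subseteq> {1..m} \<longrightarrow> \<tau> \<subseteq> {1..m} \<longrightarrow>
    H \<sigma> \<tau> \<in> subset_module m (Suc (card \<sigma> + card \<tau>)) \<and>
    ?G \<sigma> \<tau> = on_basis taylor_face (H \<sigma> \<tau>) + bilin_diff H \<sigma> \<tau>"
  proof (rule bilinear_null_homotopy)
    fix \<sigma> \<tau> assume \<sigma>: "\<sigma> \<subseteq> {1..m}" and \<tau>: "\<tau> \<subseteq> {1..m}"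
    show "?G \<sigma> \<tau> \<in> subset_module m (card \<sigma> + card \<tau>)" unfolding transported_basis_def
      by (intro subset_module_closed transported_in taylor_mult_in subset_module_single \<sigma> \<tau> refl)
    show "on_basis taylor_face (?G \<sigma> \<tau>) = bilin_diff ?G \<sigma> \<tau>"
      unfolding on_basis_diff bilin_diff_diff transported_basis_leibniz[OF \<sigma> \<tau>] taylor_leibniz[OF \<sigma> \<tau>]
      by (simp add: bilin_diff_def)
  next
    let ?e = "Poly_Mapping.single {} (1 :: ('x, 'k) mpol)"
    have e: "?e \<in> subset_module m 0" by (rule subset_module_single) auto
    have x: "\<psi> 0 ?e \<in> F 0" using linear_map_onD(1)[OF linear_\<psi> e] .
    have "\<epsilon> (\<psi> 0 ?e) = 1 +o I" using \<psi>_aug[OF e] by (simp add: taylor_aug_def)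
    then have "\<epsilon> (\<mu> 0 0 (\<psi> 0 ?e) (\<psi> 0 ?e)) = 1 +o I" using F.\<mu>_aug[OF x x, of 1 1] by simp
    then have 1: "taylor_aug I (transported_basis {} {}) = 1 +o I"
      using \<phi>_aug[of "\<mu> 0 0 (\<psi> 0 ?e) (\<psi> 0 ?e)"] F.\<mu>_in[OF x x] by (simp add: transported_basis_def transported_def)
    have "mult_coeff {} {} = 1" using mult_coeff(1)[of "{}" "{}"] by simp
    then have "taylor_mult {} {} = ?e" by (simp add: taylor_mult_def inversions_def)
    then have 2: "taylor_aug I (taylor_mult {} {}) = 1 +o I" by (simp add: taylor_aug_def)
    have "transported_basis {} {} \<in> subset_module m 0" using transported_in[OF e e] by (simp add: transported_basis_def)
    moreover have "taylor_mult {} {} \<in> subset_module m 0" using taylor_mult_in[of "{}" "{}"] by simp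
    ultimately show "taylor_aug I (?G {} {}) = I" using K.eps_diff_eq 1 2 by simp
  qed
  then obtain H where H: "\<forall>\<sigma> \<tau>. \<sigma> \<subseteq> {1..m} \<longrightarrow> \<tau> \<subseteq> {1..m} \<longrightarrow>
    H \<sigma> \<tau> \<in> subset_module m (Suc (card \<sigma> + card \<tau>)) \<and>
    ?G \<sigma> \<tau> = on_basis taylor_face (H \<sigma> \<tau>) + bilin_diff H \<sigma> \<tau>" by blast
  show ?thesis
  proof (intro exI[of _ H] allI impI conjI)
    fix \<sigma> \<tau> assume st: "\<sigma> \<subseteq> {1..m}" "\<tau> \<subseteq> {1..m}"
    show "H \<sigma> \<tau> \<in> subset_module m (Suc (card \<sigma> + card \<tau>))" using H st by blast
    have "?G \<sigma> \<tau> = on_basis taylor_face (H \<sigma> \<tau>) + bilin_diff H \<sigma> \<tau>" using H st by blast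
    then show "transported_basis \<sigma> \<tau> = taylor_mult \<sigma> \<tau> + (on_basis taylor_face (H \<sigma> \<tau>) + bilin_diff H \<sigma> \<tau>)"
      by (metis add_diff_cancel_left' add.commute diff_add_cancel)
  qed
qed

end

section \<open>Homology of algebras with differential\<close>

text \<open>
  The conditions under which the operations on homology are well defined. Degrees are quotients
  \<open>car p / rel p\<close>, so equations hold only modulo \<open>rel\<close> where representatives matter. Of the Leibniz rule only its
  consequences for cycles and boundaries are recorded.
\<close>

locale chain_algebra =
  fixes X :: "('k, 'a::ab_group_add) dga"
  assumes car_0: "0 \<in> car X p" and car_diff: "z \<in> car X p \<Longrightarrow> w \<in> car X p \<Longrightarrow> z - w \<in> car X p"
    and rel_0: "0 \<in> rel X p" and rel_diff: "z \<in> rel X p \<Longrightarrow> w \<in> rel X p \<Longrightarrow> z - w \<in> rel X p"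
    and rel_car: "rel X p \<subseteq> car X p"
    and diff_car: "z \<in> car X (Suc p) \<Longrightarrow> diff X (Suc p) z \<in> car X p"
    and diff_diff: "diff X p (z - w) = diff X p z - diff X p w"
    and diff_rel: "z \<in> rel X (Suc p) \<Longrightarrow> diff X (Suc p) z \<in> rel X p"
    and diff_square: "z \<in> car X (Suc (Suc p)) \<Longrightarrow> diff X (Suc p) (diff X (Suc (Suc p)) z) \<in> rel X p"
    and scal_car: "z \<in> car X p \<Longrightarrow> scal X c z \<in> car X p"
    and scal_diff: "scal X c (z - w) = scal X c z - scal X c w"
    and scal_rel: "z \<in> rel X p \<Longrightarrow> scal X c z \<in> rel X p"
    and scal_commute: "diff X p (scal X c z) = scal X c (diff X p z)"
    and unit_car: "unit X \<in> car X 0"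
    and mult_diff_left: "mult X p q (z - z') w = mult X p q z w - mult X p q z' w"
    and mult_diff_right: "mult X p q z (w - w') = mult X p q z w - mult X p q z w'"
    and mult_cycles: "z \<in> cycles X p \<Longrightarrow> w \<in> cycles X q \<Longrightarrow> mult X p q z w \<in> cycles X (p + q)"
    and mult_boundaries_left: "z \<in> boundaries X p \<Longrightarrow> w \<in> cycles X q \<Longrightarrow> mult X p q z w \<in> boundaries X (p + q)"
    and mult_boundaries_right: "z \<in> cycles X p \<Longrightarrow> w \<in> boundaries X q \<Longrightarrow> mult X p q z w \<in> boundaries X (p + q)"
begin

lemma diff_0: "diff X p 0 = 0" and scal_0: "scal X c 0 = 0"
  using diff_diff[of p 0 0] scal_diff[of c 0 0] by simp_all

lemma cycles_0: "0 \<in> cycles X p"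
  by (simp add: cycles_def car_0 rel_0 diff_0)

lemma cycles_diff: "z \<in> cycles X p \<Longrightarrow> w \<in> cycles X p \<Longrightarrow> z - w \<in> cycles X p"
  by (auto simp: cycles_def car_diff rel_diff diff_diff)

lemma cycles_add: "z \<in> cycles X p \<Longrightarrow> w \<in> cycles X p \<Longrightarrow> z + w \<in> cycles X p"
  using cycles_diff[of z p "0 - w"] cycles_diff[OF cycles_0, of w p] by simp

lemma boundariesE:
  assumes "b \<in> boundaries X p"
  obtains z r where "z \<in> car X (Suc p)" "r \<in> rel X p" "b = diff X (Suc p) z + r"
  using assms by (auto simp: boundaries_def elim!: set_plus_elim)

lemma boundariesI: "z \<in> car X (Suc p) \<Longrightarrow> r \<in> rel X p \<Longrightarrow> diff X (Suc p) z + r \<in> boundaries X p"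
  unfolding boundaries_def by (intro set_plus_intro imageI)

lemma rel_boundaries: "r \<in> rel X p \<Longrightarrow> r \<in> boundaries X p"
  using boundariesI[OF car_0] by (simp add: diff_0)

lemma boundaries_0: "0 \<in> boundaries X p"
  by (rule rel_boundaries[OF rel_0])

lemma boundaries_diff: "a \<in> boundaries X p \<Longrightarrow> b \<in> boundaries X p \<Longrightarrow> a - b \<in> boundaries X p"
proof (elim boundariesE)
  fix z r z' r' assume *: "z \<in> car X (Suc p)" "r \<in> rel X p" "a = diff X (Suc p) z + r"
    "z' \<in> car X (Suc p)" "r' \<in> rel X p" "b = diff X (Suc p) z' + r'"
  then have "a - b = diff X (Suc p) (z - z') + (r - r')" by (simp add: diff_diff)
  with * show "a - b \<in> boundaries X p" by (simp only: boundariesI car_diff rel_diff)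
qed

lemma boundaries_minus: "a \<in> boundaries X p \<Longrightarrow> - a \<in> boundaries X p"
  using boundaries_diff[OF boundaries_0] by simp

lemma boundaries_add: "a \<in> boundaries X p \<Longrightarrow> b \<in> boundaries X p \<Longrightarrow> a + b \<in> boundaries X p"
  using boundaries_diff[OF _ boundaries_minus] by fastforce

lemma boundaries_cycles: "b \<in> boundaries X p \<Longrightarrow> b \<in> cycles X p"
proof (elim boundariesE)
  fix z r assume z: "z \<in> car X (Suc p)" and r: "r \<in> rel X p" and b: "b = diff X (Suc p) z + r"
  have "diff X (Suc p) z \<in> cycles X p"
    using diff_car[OF z] diff_square z by (cases p) (auto simp: cycles_def)
  moreover have "r \<in> cycles X p"
    using r rel_car diff_rel by (cases p) (auto simp: cycles_def)
  ultimately show ?thesis unfolding b by (rule cycles_add)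
qed

lemma mem_hclass: "w \<in> hclass X p z \<longleftrightarrow> w - z \<in> boundaries X p"
  unfolding hclass_def elt_set_plus_def by (force simp: algebra_simps)

lemma hclass_eq_iff: "hclass X p z = hclass X p w \<longleftrightarrow> z - w \<in> boundaries X p"
proof
  assume "hclass X p z = hclass X p w"
  moreover have "z \<in> hclass X p z" by (simp add: mem_hclass boundaries_0)
  ultimately show "z - w \<in> boundaries X p" by (simp add: mem_hclass)
next
  assume *: "z - w \<in> boundaries X p"
  have "u - z \<in> boundaries X p \<longleftrightarrow> u - w \<in> boundaries X p" for u
    using boundaries_add[OF _ *, of "u - z"] boundaries_diff[OF _ *, of "u - w"] by auto
  then show "hclass X p z = hclass X p w" by (auto simp: mem_hclass)
qed

lemma hclass_self: "z \<in> hclass X p z"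
  by (simp add: mem_hclass boundaries_0)

lemma hclass_add: "hclass X p z + hclass X p w = hclass X p (z + w)"
proof
  show "hclass X p z + hclass X p w \<subseteq> hclass X p (z + w)"
  proof
    fix u assume "u \<in> hclass X p z + hclass X p w"
    then obtain a b where "u = a + b" "a - z \<in> boundaries X p" "b - w \<in> boundaries X p"
      by (auto elim!: set_plus_elim simp: mem_hclass)
    then show "u \<in> hclass X p (z + w)"
      using boundaries_add[of "a - z" p "b - w"] by (simp add: mem_hclass algebra_simps)
  qed
  show "hclass X p (z + w) \<subseteq> hclass X p z + hclass X p w"
  proof
    fix u assume "u \<in> hclass X p (z + w)"
    then have "u - w \<in> hclass X p z" by (simp add: mem_hclass algebra_simps)
    from set_plus_intro[OF this hclass_self[of w p]] show "u \<in> hclass X p z + hclass X p w" by simp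
  qed
qed

lemma scal_boundaries: "b \<in> boundaries X p \<Longrightarrow> scal X c b \<in> boundaries X p"
proof (elim boundariesE)
  fix z r assume z: "z \<in> car X (Suc p)" and r: "r \<in> rel X p" and b: "b = diff X (Suc p) z + r"
  have "scal X c (diff X (Suc p) z - (0 - r)) = scal X c (diff X (Suc p) z) - (0 - scal X c r)"
    by (simp only: scal_diff scal_0)
  then have "scal X c b = diff X (Suc p) (scal X c z) + scal X c r" by (simp add: b scal_commute)
  then show ?thesis using boundariesI[OF scal_car[OF z] scal_rel[OF r]] by simp
qed

lemma scal_cycles: "z \<in> cycles X p \<Longrightarrow> scal X c z \<in> cycles X p"
  by (auto simp: cycles_def scal_car scal_rel scal_commute)

lemma hscal_hclass: "hscal X p c (hclass X p z) = hclass X p (scal X c z)"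
proof -
  have "hclass X p (scal X c w) = hclass X p (scal X c z)" if "w \<in> hclass X p z" for w
    using that scal_boundaries[of "w - z"] by (simp add: mem_hclass hclass_eq_iff scal_diff)
  then show ?thesis unfolding hscal_def using hclass_self[of z p] by blast
qed

lemma mult_cong:
  assumes z: "z \<in> cycles X p" "z' - z \<in> boundaries X p" and w: "w \<in> cycles X q" "w' - w \<in> boundaries X q"
  shows "mult X p q z' w' - mult X p q z w \<in> boundaries X (p + q)"
proof -
  have w': "w' \<in> cycles X q" using cycles_add[OF w(1) boundaries_cycles[OF w(2)]] by simp
  have "mult X p q z' w' - mult X p q z w' \<in> boundaries X (p + q)"
    using mult_boundaries_left[OF z(2) w'] by (simp add: mult_diff_left)
  moreover have "mult X p q z w' - mult X p q z w \<in> boundaries X (p + q)"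
    using mult_boundaries_right[OF z(1) w(2)] by (simp add: mult_diff_right)
  ultimately show ?thesis using boundaries_add by fastforce
qed

lemma hmult_hclass:
  assumes z: "z \<in> cycles X p" and w: "w \<in> cycles X q"
  shows "hmult X p q (hclass X p z) (hclass X q w) = hclass X (p + q) (mult X p q z w)"
proof -
  have "hclass X (p + q) (mult X p q z' w') = hclass X (p + q) (mult X p q z w)"
    if "z' \<in> hclass X p z" "w' \<in> hclass X q w" for z' w'
    using that mult_cong[OF z _ w] by (simp add: mem_hclass hclass_eq_iff)
  then show ?thesis unfolding hmult_def using hclass_self[of z p] hclass_self[of w q] by blast
qed

lemma unit_cycle: "unit X \<in> cycles X 0"
  by (simp add: cycles_def unit_car)

lemma homologyE: "\<alpha> \<in> homology X p \<Longrightarrow> \<exists>z\<in>cycles X p. \<alpha> = hclass X p z"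
  by (auto simp: homology_def)

lemma homologyI: "z \<in> cycles X p \<Longrightarrow> hclass X p z \<in> homology X p"
  by (simp add: homology_def)

lemma hops_closed: "hops_closed X"
  unfolding hops_closed_def
proof (intro conjI allI ballI)
  show "\<alpha> + \<beta> \<in> homology X p" if "\<alpha> \<in> homology X p" "\<beta> \<in> homology X p" for p \<alpha> \<beta>
    using homologyE[OF that(1)] homologyE[OF that(2)] by (auto simp: hclass_add intro!: homologyI cycles_add)
  show "hscal X p c \<alpha> \<in> homology X p" if "\<alpha> \<in> homology X p" for p c \<alpha>
    using homologyE[OF that] by (auto simp: hscal_hclass intro!: homologyI scal_cycles)
  show "hmult X p q \<alpha> \<beta> \<in> homology X (p + q)" if "\<alpha> \<in> homology X p" "\<beta> \<in> homology X q" for p q \<alpha> \<beta>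
    using homologyE[OF that(1)] homologyE[OF that(2)] by (auto simp: hmult_hclass intro!: homologyI mult_cycles)
  show "hunit X \<in> homology X 0" unfolding hunit_def by (rule homologyI[OF unit_cycle])
qed

end

text \<open>
  A map on representatives that respects cycles, boundaries and the operations up to boundaries
  induces an isomorphism if it reflects boundaries and reaches every class.
\<close>

theorem homology_algebra_iso_induced:
  fixes X :: "('k, 'a::ab_group_add) dga" and Y :: "('k, 'b::ab_group_add) dga"
  assumes "chain_algebra X" "chain_algebra Y"
    and f_diff: "\<And>p z w. f p (z - w) = f p z - f p w"
    and f_cycles: "\<And>p z. z \<in> cycles X p \<Longrightarrow> f p z \<in> cycles Y p"
    and f_boundaries: "\<And>p z. z \<in> boundaries X p \<Longrightarrow> f p z \<in> boundaries Y p"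
    and f_scal: "\<And>p c z. z \<in> cycles X p \<Longrightarrow> f p (scal X c z) - scal Y c (f p z) \<in> boundaries Y p"
    and f_mult: "\<And>p q z w. z \<in> cycles X p \<Longrightarrow> w \<in> cycles X q \<Longrightarrow>
      f (p + q) (mult X p q z w) - mult Y p q (f p z) (f q w) \<in> boundaries Y (p + q)"
    and f_unit: "f 0 (unit X) - unit Y \<in> boundaries Y 0"
    and f_inj: "\<And>p z. z \<in> cycles X p \<Longrightarrow> f p z \<in> boundaries Y p \<Longrightarrow> z \<in> boundaries X p"
    and f_surj: "\<And>p w. w \<in> cycles Y p \<Longrightarrow> \<exists>z\<in>cycles X p. f p z - w \<in> boundaries Y p"
  shows "\<exists>h. homology_algebra_iso X Y h \<and> (\<forall>p. \<forall>z\<in>cycles X p. h p (hclass X p z) = hclass Y p (f p z))"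
proof -
  interpret X: chain_algebra X by fact
  interpret Y: chain_algebra Y by fact
  have f_eq: "hclass X p z = hclass X p w \<longleftrightarrow> hclass Y p (f p z) = hclass Y p (f p w)"
    if "z \<in> cycles X p" "w \<in> cycles X p" for p z w
    unfolding X.hclass_eq_iff Y.hclass_eq_iff f_diff[symmetric]
    using f_boundaries f_inj X.cycles_diff[OF that] by blast
  define h where "h p \<alpha> = hclass Y p (f p (SOME z. z \<in> cycles X p \<and> \<alpha> = hclass X p z))" for p \<alpha>
  have h: "h p (hclass X p z) = hclass Y p (f p z)" if z: "z \<in> cycles X p" for p z
  proof -
    have "\<exists>w. w \<in> cycles X p \<and> hclass X p z = hclass X p w" using z by blast
    from someI_ex[OF this] f_eq[OF z] show ?thesis unfolding h_def by metis
  qed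
  have f_add: "f p (z + w) = f p z + f p w" for p z w
    using f_diff[of p "z + w" w] by (simp add: algebra_simps)
  have "homology_algebra_iso X Y h"
    unfolding homology_algebra_iso_def
  proof (intro conjI allI ballI X.hops_closed Y.hops_closed)
    fix p
    show "bij_betw (h p) (homology X p) (homology Y p)"
    proof (rule bij_betwI')
      fix \<alpha> \<beta> assume "\<alpha> \<in> homology X p" "\<beta> \<in> homology X p"
      then show "h p \<alpha> = h p \<beta> \<longleftrightarrow> \<alpha> = \<beta>"
        using X.homologyE[of \<alpha> p] X.homologyE[of \<beta> p] h f_eq by metis
    next
      fix \<alpha> assume "\<alpha> \<in> homology X p"
      then show "h p \<alpha> \<in> homology Y p" using X.homologyE[of \<alpha> p] h f_cycles Y.homologyI by metis
    next
      fix \<beta> assume "\<beta> \<in> homology Y p"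
      then obtain w where w: "w \<in> cycles Y p" "\<beta> = hclass Y p w" using Y.homologyE by blast
      then obtain z where z: "z \<in> cycles X p" "f p z - w \<in> boundaries Y p" using f_surj by blast
      then have "\<beta> = h p (hclass X p z)" using w by (simp add: h Y.hclass_eq_iff[symmetric])
      then show "\<exists>\<alpha>\<in>homology X p. \<beta> = h p \<alpha>" using X.homologyI[OF z(1)] by blast
    qed
  next
    fix p \<alpha> \<beta> assume "\<alpha> \<in> homology X p" "\<beta> \<in> homology X p"
    then obtain z w where "z \<in> cycles X p" "\<alpha> = hclass X p z" "w \<in> cycles X p" "\<beta> = hclass X p w"
      using X.homologyE by metis
    then show "h p (\<alpha> + \<beta>) = h p \<alpha> + h p \<beta>"
      by (simp add: X.hclass_add Y.hclass_add h X.cycles_add f_add)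
  next
    fix p c \<alpha> assume "\<alpha> \<in> homology X p"
    then obtain z where "z \<in> cycles X p" "\<alpha> = hclass X p z" using X.homologyE by metis
    then show "h p (hscal X p c \<alpha>) = hscal Y p c (h p \<alpha>)"
      by (simp add: X.hscal_hclass Y.hscal_hclass h X.scal_cycles Y.hclass_eq_iff f_scal)
  next
    fix p q \<alpha> \<beta> assume "\<alpha> \<in> homology X p" "\<beta> \<in> homology X q"
    then obtain z w where "z \<in> cycles X p" "\<alpha> = hclass X p z" "w \<in> cycles X q" "\<beta> = hclass X q w"
      using X.homologyE by metis
    then show "h (p + q) (hmult X p q \<alpha> \<beta>) = hmult Y p q (h p \<alpha>) (h q \<beta>)"
      by (simp add: X.hmult_hclass Y.hmult_hclass h X.mult_cycles f_cycles Y.hclass_eq_iff f_mult)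
  next
    show "h 0 (hunit X) = hunit Y"
      unfolding hunit_def using f_unit by (simp add: h X.unit_cycle Y.hclass_eq_iff)
  qed
  with h show ?thesis by blast
qed

section \<open>Tensor products with the residue field\<close>

lemma module_frag_cmul: "module (frag_cmul :: int \<Rightarrow> ('a \<Rightarrow>\<^sub>0 int) \<Rightarrow> _)"
  by standard (simp_all add: frag_cmul_distrib frag_cmul_distrib2)

lemma frag_extend_fun_diff: "frag_extend (\<lambda>x. f x - g x) z = frag_extend f z - frag_extend g z"
  by (induction z rule: frag_induction[OF subset_UNIV]) (simp_all add: frag_extend_diff algebra_simps)

lemma to_delta_conv:
  "to_delta \<chi> p z = (\<Sum>k\<in>keys z. pm_scale (of_int (lookup z k) * snd k) (const_reduce (\<chi> p (fst k))))"
  by (simp add: to_delta_def const_reduce_def case_prod_unfold)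

lemma to_delta_0 [simp]: "to_delta \<chi> p 0 = 0"
  by (simp add: to_delta_conv)

lemma to_delta_of [simp]: "to_delta \<chi> p (frag_of (x, a)) = pm_scale a (const_reduce (\<chi> p x))"
  by (simp add: to_delta_conv)

lemma to_delta_add: "to_delta \<chi> p (z + w) = to_delta \<chi> p z + to_delta \<chi> p w"
  unfolding to_delta_conv
  by (rule setsum_keys_plus_distrib) (simp_all add: distrib_right pm.scale_left_distrib)

lemma to_delta_diff: "to_delta \<chi> p (z - w) = to_delta \<chi> p z - to_delta \<chi> p w"
  using to_delta_add[of \<chi> p "z - w" w] by simp

lemma to_delta_sum: "to_delta \<chi> p (sum g A) = (\<Sum>a\<in>A. to_delta \<chi> p (g a))"
  by (induction A rule: infinite_finite_induct) (simp_all add: to_delta_add)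

text \<open>
  The map \<open>g \<otimes> 1\<close> on formal sums of tensors.
\<close>

definition push :: "('m \<Rightarrow> 'n) \<Rightarrow> ('m \<times> 'k \<Rightarrow>\<^sub>0 int) \<Rightarrow> ('n \<times> 'k \<Rightarrow>\<^sub>0 int)"
  where "push g = frag_extend (\<lambda>(x, a). frag_of (g x, a))"

lemma push_0 [simp]: "push g 0 = 0"
  and push_of [simp]: "push g (frag_of (x, a)) = frag_of (g x, a)"
  and push_diff: "push g (z - w) = push g z - push g w"
  by (simp_all add: push_def frag_extend_diff)

lemma push_push: "push f (push g z) = push (\<lambda>x. f (g x)) z"
proof (induction z rule: frag_induction[OF subset_UNIV])
  case (2 x)
  then show ?case by (cases x) simp
qed (simp_all add: push_diff)

lemma to_delta_push: "to_delta \<chi> p (push g z) = to_delta (\<lambda>q x. \<chi> p (g x)) q z"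
proof (induction z rule: frag_induction[OF subset_UNIV])
  case (2 x)
  then show ?case by (cases x) simp
qed (simp_all add: push_diff to_delta_diff)

lemma tensor_free_induct [consumes 1, case_names zero one diff]:
  assumes "z \<in> tensor_free M N" "P 0" "\<And>x a. x \<in> M \<Longrightarrow> a \<in> N \<Longrightarrow> P (frag_of (x, a))"
    "\<And>z w. P z \<Longrightarrow> P w \<Longrightarrow> P (z - w)"
  shows "P z"
  using assms(1) unfolding tensor_free_def mem_Collect_eq
  by (rule frag_induction) (use assms(2-) in auto)

lemma tensor_free_closed: "0 \<in> tensor_free M N" "x \<in> M \<Longrightarrow> a \<in> N \<Longrightarrow> frag_of (x, a) \<in> tensor_free M N"
  "z \<in> tensor_free M N \<Longrightarrow> w \<in> tensor_free M N \<Longrightarrow> z - w \<in> tensor_free M N"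
  "z \<in> tensor_free M N \<Longrightarrow> w \<in> tensor_free M N \<Longrightarrow> z + w \<in> tensor_free M N"
  using keys_diff[of z w] keys_add[of z w] by (auto simp: tensor_free_def)

lemma tensor_free_sum: "(\<And>a. a \<in> A \<Longrightarrow> g a \<in> tensor_free M N) \<Longrightarrow> sum g A \<in> tensor_free M N"
  by (induction A rule: infinite_finite_induct) (simp_all add: tensor_free_closed)

lemma tensor_rel_induct [consumes 1, case_names zero add_left add_right scale diff]:
  assumes z: "z \<in> tensor_rel s s' M N" and zero: "P 0"
    and "\<And>x x' y. x \<in> M \<Longrightarrow> x' \<in> M \<Longrightarrow> y \<in> N \<Longrightarrow> P (frag_of (x + x', y) - frag_of (x, y) - frag_of (x', y))"
    and "\<And>x y y'. x \<in> M \<Longrightarrow> y \<in> N \<Longrightarrow> y' \<in> N \<Longrightarrow> P (frag_of (x, y + y') - frag_of (x, y) - frag_of (x, y'))"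
    and "\<And>r x y. x \<in> M \<Longrightarrow> y \<in> N \<Longrightarrow> P (frag_of (s r x, y) - frag_of (x, s' r y))"
    and diff: "\<And>z w. P z \<Longrightarrow> P w \<Longrightarrow> P (z - w)"
  shows "P z"
  using z unfolding tensor_rel_def
proof (induction rule: module.span_induct_alt[OF module_frag_cmul, consumes 1, case_names base step])
  case (step c x y)
  have "P x" using step.hyps(1) assms(3-5) by blast
  then have "P (frag_cmul c x)" by (intro frag_closure_minus_cmul[of P]) (use zero diff in auto)
  then have "P (frag_cmul c x - (0 - y))" by (intro diff zero step)
  then show ?case by simp
qed (rule zero)

text \<open>
  For a resolution \<open>F\<close>, the group \<open>F p \<otimes> k\<close> is the quotient of the free group \<open>C p\<close> by its subgroup \<open>T p\<close>
  of relations.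
\<close>

locale tensor_resolution = resolution s F d \<epsilon> I
  for s :: "('x::linorder, 'k::field) mpol \<Rightarrow> 'm::ab_group_add \<Rightarrow> 'm" and F d \<epsilon> I
begin

abbreviation T :: "nat \<Rightarrow> ('m \<times> 'k \<Rightarrow>\<^sub>0 int) set"
  where "T p \<equiv> tensor_rel s residue_scale (F p) UNIV"

abbreviation C :: "nat \<Rightarrow> ('m \<times> 'k \<Rightarrow>\<^sub>0 int) set"
  where "C p \<equiv> tensor_free (F p) UNIV"

lemma T_0: "0 \<in> T p" and T_diff: "z \<in> T p \<Longrightarrow> w \<in> T p \<Longrightarrow> z - w \<in> T p"
  and T_add: "z \<in> T p \<Longrightarrow> w \<in> T p \<Longrightarrow> z + w \<in> T p"
  and T_minus: "z \<in> T p \<Longrightarrow> - z \<in> T p"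
  unfolding tensor_rel_def
  using module.span_zero[OF module_frag_cmul] module.span_diff[OF module_frag_cmul]
    module.span_add[OF module_frag_cmul] module.span_neg[OF module_frag_cmul] by blast+

lemma T_sum: "(\<And>a. a \<in> A \<Longrightarrow> g a \<in> T p) \<Longrightarrow> sum g A \<in> T p"
  by (induction A rule: infinite_finite_induct) (simp_all add: T_0 T_add)

lemma T_add_left: "x \<in> F p \<Longrightarrow> x' \<in> F p \<Longrightarrow> frag_of (x + x', a) - frag_of (x, a) - frag_of (x', a) \<in> T p"
  and T_add_right: "x \<in> F p \<Longrightarrow> frag_of (x, a + b) - frag_of (x, a) - frag_of (x, b) \<in> T p"
  and T_residue: "x \<in> F p \<Longrightarrow> frag_of (s r x, a) - frag_of (x, residue_scale r a) \<in> T p"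
  unfolding tensor_rel_def by (rule module.span_base[OF module_frag_cmul]; blast)+

lemma T_scale: "x \<in> F p \<Longrightarrow> frag_of (s r x, a) - frag_of (x, const_coeff r * a) \<in> T p"
  using T_residue[of x p r a] by (simp only: residue_scale_def)

lemma T_zero_left: "frag_of (0, a) \<in> T p"
  using T_minus[OF T_add_left[OF F_closed(1) F_closed(1), of a p]] by simp

lemma T_zero_right: "x \<in> F p \<Longrightarrow> frag_of (x, 0) \<in> T p"
  using T_minus[OF T_add_right[of x p 0 0]] by simp

lemma T_C: "z \<in> T p \<Longrightarrow> z \<in> C p"
  by (induction rule: tensor_rel_induct) (auto intro!: tensor_free_closed F_closed)

lemma T_diff_right: "x \<in> F p \<Longrightarrow> frag_of (x, a - b) - (frag_of (x, a) - frag_of (x, b)) \<in> T p"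
  using T_minus[OF T_add_right[of x p "a - b" b]] by (simp add: algebra_simps)

lemma T_sum_left:
  "finite B \<Longrightarrow> (\<And>b. b \<in> B \<Longrightarrow> g b \<in> F p) \<Longrightarrow> frag_of (sum g B, a) - (\<Sum>b\<in>B. frag_of (g b, a)) \<in> T p"
proof (induction B rule: finite_induct)
  case (insert b B)
  have "sum g B \<in> F p" using insert.prems by (intro subspace_sum[OF subspace_F]) auto
  then have "frag_of (g b + sum g B, a) - frag_of (g b, a) - frag_of (sum g B, a) \<in> T p"
    using insert.prems by (intro T_add_left) auto
  from T_add[OF this insert.IH] insert show ?case by (simp add: algebra_simps)
qed (simp add: T_zero_left)

lemma push_C: "(\<And>x. x \<in> F p \<Longrightarrow> g x \<in> F q) \<Longrightarrow> z \<in> C p \<Longrightarrow> push g z \<in> C q"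
  by (erule tensor_free_induct) (auto simp: push_diff intro: tensor_free_closed)

lemma push_T:
  assumes g: "linear_map_on s s (F p) (F q) g" and z: "z \<in> T p"
  shows "push g z \<in> T q"
  using z
  by (induction rule: tensor_rel_induct)
    (auto simp: push_diff T_0 linear_map_onD[OF g] intro: T_diff T_add_left T_add_right T_residue)

lemma push_cong: "z \<in> C p \<Longrightarrow> (\<And>x. x \<in> F p \<Longrightarrow> f x = g x) \<Longrightarrow> push f z = push g z"
  by (induction rule: tensor_free_induct) (auto simp: push_diff)

lemma push_add:
  assumes "z \<in> C p" "\<And>x. x \<in> F p \<Longrightarrow> f x \<in> F q" "\<And>x. x \<in> F p \<Longrightarrow> g x \<in> F q"
  shows "push (\<lambda>x. f x + g x) z - (push f z + push g z) \<in> T q"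
  using assms(1)
proof (induction rule: tensor_free_induct)
  case (one x a)
  then show ?case using T_add_left[of "f x" q "g x" a] assms by (simp add: algebra_simps)
next
  case (diff z w)
  from T_diff[OF this] show ?case by (simp add: push_diff algebra_simps)
qed (simp add: T_0)

lemma push_id: "push (\<lambda>x. x) z = z"
proof (induction z rule: frag_induction[OF subset_UNIV])
  case (2 x)
  then show ?case by (cases x) simp
qed (simp_all add: push_diff)

text \<open>
  The map to \<open>\<Delta>(D)\<close> is defined on formal sums; here it is seen to be defined on tensors. The relation
  \<open>r x \<otimes> a = x \<otimes> r a\<close> is respected since the polynomial \<open>r\<close> acts on \<open>k\<close> by its constant coefficient.
\<close>

lemma to_delta_T:
  assumes \<chi>: "linear_map_on s pm_scale (F p) N (\<chi> p)" and z: "z \<in> T p"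
  shows "to_delta \<chi> p z = 0"
  using z
  by (induction rule: tensor_rel_induct)
    (auto simp: to_delta_diff linear_map_onD[OF \<chi>] const_reduce_add const_reduce_scale pm.scale_right_distrib
      pm.scale_left_distrib residue_scale_def mult.commute)

lemma to_delta_in:
  "(\<And>x. x \<in> F p \<Longrightarrow> \<chi> p x \<in> subset_module m q) \<Longrightarrow> z \<in> C p \<Longrightarrow> to_delta \<chi> p z \<in> subset_module m q"
  by (erule tensor_free_induct)
    (auto simp: to_delta_diff intro: subset_module_closed subset_module_const_reduce)

lemma to_delta_cong: "z \<in> C p \<Longrightarrow> (\<And>x. x \<in> F p \<Longrightarrow> \<chi> p x = \<chi>' q x) \<Longrightarrow> to_delta \<chi> p z = to_delta \<chi>' q z"
  by (induction rule: tensor_free_induct) (auto simp: to_delta_diff)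

lemma to_delta_fun_diff: "to_delta (\<lambda>p x. f p x - g p x) p z = to_delta f p z - to_delta g p z"
  by (simp add: to_delta_conv const_reduce_diff pm.scale_right_diff_distrib sum_subtractf)

lemma to_delta_fun_add: "to_delta (\<lambda>p x. f p x + g p x) p z = to_delta f p z + to_delta g p z"
  by (simp add: to_delta_conv const_reduce_add pm.scale_right_distrib sum.distrib)

end

section \<open>The algebra of the lattice\<close>

text \<open>
  A section of the reduction modulo the variables.
\<close>

definition const_lift :: "('b \<Rightarrow>\<^sub>0 'k) \<Rightarrow> ('b \<Rightarrow>\<^sub>0 ('x, 'k::comm_ring_1) mpol)"
  where "const_lift = Poly_Mapping.map (Poly_Mapping.single 0)"

lemma lookup_const_lift: "lookup (const_lift v) b = Poly_Mapping.single 0 (lookup v b)"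
  by (simp add: const_lift_def lookup_map)

lemma const_reduce_lift [simp]: "const_reduce (const_lift v) = v"
  by (rule poly_mapping_eqI) (simp add: lookup_const_lift)

lemma keys_const_lift: "keys (const_lift v) \<subseteq> keys v"
  by (auto simp: in_keys_iff lookup_const_lift)

lemma const_lift_in: "v \<in> subset_module m p \<Longrightarrow> const_lift v \<in> subset_module m p"
  unfolding subset_module_def using keys_const_lift[of v] by blast

lemma on_basis_cong_subsets:
  assumes "v \<in> subset_module m p" "\<And>\<sigma>. \<sigma> \<subseteq> {1..m} \<Longrightarrow> card \<sigma> = p \<Longrightarrow> f \<sigma> = g \<sigma>"
  shows "on_basis f v = on_basis g v"
  by (rule on_basis_cong) (use subset_module_keys[OF assms(1)] assms(2) in blast)

lemma bilin_cong_subsets: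
  assumes "v \<in> subset_module m p" "w \<in> subset_module m q"
    and "\<And>\<sigma> \<tau>. \<sigma> \<subseteq> {1..m} \<Longrightarrow> card \<sigma> = p \<Longrightarrow> \<tau> \<subseteq> {1..m} \<Longrightarrow> card \<tau> = q \<Longrightarrow> f \<sigma> \<tau> = g \<sigma> \<tau>"
  shows "bilin f v w = bilin g v w"
proof (rule bilin_cong)
  fix \<sigma> \<tau> assume "\<sigma> \<in> keys v" "\<tau> \<in> keys w"
  from subset_module_keys[OF assms(1) this(1)] subset_module_keys[OF assms(2) this(2)]
  show "f \<sigma> \<tau> = g \<sigma> \<tau>" by (intro assms(3)) simp_all
qed

lemma bilin_in:
  "(\<And>\<sigma> \<tau>. \<sigma> \<in> keys v \<Longrightarrow> \<tau> \<in> keys w \<Longrightarrow> H \<sigma> \<tau> \<in> subset_module m r) \<Longrightarrow> bilin H v w \<in> subset_module m r"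
  unfolding bilin_def by (intro subset_module_on_basis) auto

context taylor_resolution
begin

text \<open>
  The complex \<open>\<Delta>(D)\<close> is the Taylor complex modulo the variables. With \<open>const_lift\<close>, its
  properties follow from those of the Taylor complex.
\<close>

lemma const_reduce_taylor_diff:
  assumes "v \<in> subset_module m p"
  shows "const_reduce (taylor_diff E Q v) = on_basis delta_face (const_reduce v)"
proof -
  have "const_reduce (taylor_diff E Q v) = on_basis (\<lambda>\<sigma>. const_reduce (taylor_face \<sigma>)) (const_reduce v)"
    by (simp add: taylor_diff_eq const_reduce_on_basis)
  also have "\<dots> = on_basis delta_face (const_reduce v)"
    by (rule on_basis_cong_subsets[OF subset_module_const_reduce[OF assms]]) (rule const_reduce_taylor_face)
  finally show ?thesis .
qed

lemma delta_diff_conv: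
  fixes v :: "nat set \<Rightarrow>\<^sub>0 'k"
  assumes "v \<in> subset_module m p" shows "delta_diff E Q v = const_reduce (taylor_diff E Q (const_lift v))"
  using const_reduce_taylor_diff[OF const_lift_in[OF assms]] by (simp add: delta_diff_eq)

lemma delta_diff_in:
  fixes v :: "nat set \<Rightarrow>\<^sub>0 'k"
  assumes "v \<in> subset_module m (Suc p)" shows "delta_diff E Q v \<in> subset_module m p"
  unfolding delta_diff_conv[OF assms]
  by (intro subset_module_const_reduce linear_map_onD(1)[OF K.linear_d] const_lift_in assms)

lemma delta_diff_0:
  fixes v :: "nat set \<Rightarrow>\<^sub>0 'k"
  assumes "v \<in> subset_module m 0" shows "delta_diff E Q v = 0"
  using K.d_0[OF const_lift_in[OF assms]] by (simp add: delta_diff_conv[OF assms])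

lemma delta_diff_diff: "delta_diff E Q (v - w) = delta_diff E Q v - delta_diff E Q w"
  and delta_diff_scale: "delta_diff E Q (pm_scale c v) = pm_scale c (delta_diff E Q v)"
  and delta_diff_zero: "delta_diff E Q (0 :: nat set \<Rightarrow>\<^sub>0 'k) = 0"
  for v w :: "nat set \<Rightarrow>\<^sub>0 'k"
  by (simp_all add: delta_diff_eq on_basis_diff on_basis_scale)

lemma delta_diff_delta_diff:
  fixes v :: "nat set \<Rightarrow>\<^sub>0 'k"
  assumes "v \<in> subset_module m (Suc p)" shows "delta_diff E Q (delta_diff E Q v) = 0"
proof -
  have "delta_diff E Q (delta_diff E Q v) = on_basis delta_face (const_reduce (taylor_diff E Q (const_lift v)))"
    unfolding delta_diff_conv[OF assms] by (simp add: delta_diff_eq)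
  also have "\<dots> = const_reduce (taylor_diff E Q (taylor_diff E Q (const_lift v)))"
    by (rule const_reduce_taylor_diff[symmetric]) (rule linear_map_onD(1)[OF K.linear_d const_lift_in[OF assms]])
  also have "\<dots> = 0" using K.d_d[OF const_lift_in[OF assms]] by simp
  finally show ?thesis .
qed

lemma bilin_bilin_diff:
  assumes "v \<in> subset_module m p"
  shows "bilin (bilin_diff H) v w =
    bilin H (taylor_diff E Q v) w + pm_scale ((- 1) ^ p) (bilin H v (taylor_diff E Q w))"
proof -
  have "bilin (\<lambda>\<sigma> \<tau>. pm_scale ((- 1) ^ card \<sigma>) (on_basis (H \<sigma>) (taylor_face \<tau>))) v w =
      bilin (\<lambda>\<sigma> \<tau>. pm_scale ((- 1) ^ p) (on_basis (H \<sigma>) (taylor_face \<tau>))) v w"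
    unfolding bilin_def by (rule on_basis_cong_subsets[OF assms]) simp
  also have "\<dots> = pm_scale ((- 1) ^ p) (bilin H v (taylor_diff E Q w))"
    unfolding bilin_fun_scale bilin_on_basis_right taylor_diff_eq ..
  finally show ?thesis
    unfolding bilin_diff_def bilin_fun_add bilin_on_basis_left taylor_diff_eq by simp
qed

abbreviation delta_mult :: "(nat set \<Rightarrow>\<^sub>0 'k) \<Rightarrow> (nat set \<Rightarrow>\<^sub>0 'k) \<Rightarrow> (nat set \<Rightarrow>\<^sub>0 'k)"
  where "delta_mult \<equiv> bilin (delta_basis_mult E Q)"

lemma const_reduce_taylor_mult_bilin:
  assumes "v \<in> subset_module m p" "w \<in> subset_module m q"
  shows "const_reduce (bilin taylor_mult v w) = delta_mult (const_reduce v) (const_reduce w)"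
  unfolding const_reduce_bilin
  by (rule bilin_cong_subsets[OF assms[THEN subset_module_const_reduce]]) (rule const_reduce_taylor_mult)

lemma bilin_taylor_mult_in:
  assumes "v \<in> subset_module m p" "w \<in> subset_module m q"
  shows "bilin taylor_mult v w \<in> subset_module m (p + q)"
proof (rule bilin_in)
  fix \<sigma> \<tau> assume "\<sigma> \<in> keys v" "\<tau> \<in> keys w"
  then have "\<sigma> \<subseteq> {1..m} \<and> card \<sigma> = p" "\<tau> \<subseteq> {1..m} \<and> card \<tau> = q"
    using subset_module_keys assms by blast+
  then show "taylor_mult \<sigma> \<tau> \<in> subset_module m (p + q)" using taylor_mult_in[of \<sigma> \<tau>] by simp
qed

lemma delta_mult_in:
  assumes "v \<in> subset_module m p" "w \<in> subset_module m q" shows "delta_mult v w \<in> subset_module m (p + q)"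
  using subset_module_const_reduce[OF bilin_taylor_mult_in[OF assms[THEN const_lift_in]]]
    const_reduce_taylor_mult_bilin[OF assms[THEN const_lift_in]] by simp

lemma taylor_diff_in: "v \<in> subset_module m p \<Longrightarrow> taylor_diff E Q v \<in> subset_module m (p - 1)"
  using linear_map_onD(1)[OF K.linear_d'] .

text \<open>
  The Leibniz rule of Taylor's multiplication, modulo the variables.
\<close>

lemma delta_leibniz:
  assumes v: "v \<in> subset_module m p" and w: "w \<in> subset_module m q"
  shows "delta_diff E Q (delta_mult v w) =
    delta_mult (delta_diff E Q v) w + pm_scale ((- 1) ^ p) (delta_mult v (delta_diff E Q w))"
proof -
  let ?v = "const_lift v :: nat set \<Rightarrow>\<^sub>0 ('x, 'k) mpol" and ?w = "const_lift w :: nat set \<Rightarrow>\<^sub>0 ('x, 'k) mpol"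
  note v' = const_lift_in[OF v] and w' = const_lift_in[OF w]
  have "taylor_diff E Q (bilin taylor_mult ?v ?w) = bilin (\<lambda>\<sigma> \<tau>. on_basis taylor_face (taylor_mult \<sigma> \<tau>)) ?v ?w"
    by (simp add: taylor_diff_eq bilin_on_basis)
  also have "\<dots> = bilin (bilin_diff taylor_mult) ?v ?w"
    by (rule bilin_cong_subsets[OF v' w']) (simp only: taylor_leibniz bilin_diff_def)
  also have "\<dots> = bilin taylor_mult (taylor_diff E Q ?v) ?w +
      pm_scale ((- 1) ^ p) (bilin taylor_mult ?v (taylor_diff E Q ?w))"
    by (rule bilin_bilin_diff[OF v'])
  finally have "const_reduce (taylor_diff E Q (bilin taylor_mult ?v ?w)) =
      delta_mult (delta_diff E Q v) w + pm_scale ((- 1) ^ p) (delta_mult v (delta_diff E Q w))"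
    by (simp add: const_reduce_add const_reduce_scale const_coeff_sign
      const_reduce_taylor_mult_bilin[OF taylor_diff_in[OF v'] w'] const_reduce_taylor_mult_bilin[OF v' taylor_diff_in[OF w']]
      delta_diff_conv[OF v] delta_diff_conv[OF w])
  moreover have "const_reduce (taylor_diff E Q (bilin taylor_mult ?v ?w)) = delta_diff E Q (delta_mult v w)"
    unfolding const_reduce_taylor_diff[OF bilin_taylor_mult_in[OF v' w']] const_reduce_taylor_mult_bilin[OF v' w']
    by (simp add: delta_diff_eq)
  ultimately show ?thesis by simp
qed

abbreviation "Delta \<equiv> delta_dga E Q m"

lemma Delta_simps:
  "car Delta = subset_module m" "rel Delta p = {0}" "diff Delta p = delta_diff E Q" "scal Delta = pm_scale"
  "mult Delta p q = delta_mult" "unit Delta = Poly_Mapping.single {} 1"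
  by (simp_all add: delta_dga_def bilin_def fun_eq_iff)

lemma Delta_cycles: "z \<in> cycles Delta p \<longleftrightarrow> z \<in> subset_module m p \<and> delta_diff E Q z = 0"
  by (auto simp: cycles_def Delta_simps delta_diff_0)

lemma Delta_boundaries: "b \<in> boundaries Delta p \<longleftrightarrow> (\<exists>z\<in>subset_module m (Suc p). b = delta_diff E Q z)"
  by (auto simp: boundaries_def Delta_simps set_plus_def)

lemma Delta_chain_algebra: "chain_algebra Delta"
proof
  fix p q z w c
  show "mult Delta p q z w \<in> cycles Delta (p + q)" if "z \<in> cycles Delta p" "w \<in> cycles Delta q"
    using that delta_leibniz[of z p w q] delta_mult_in[of z p w q] by (simp add: Delta_cycles Delta_simps)
  show "mult Delta p q z w \<in> boundaries Delta (p + q)" if "z \<in> boundaries Delta p" "w \<in> cycles Delta q"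
  proof -
    obtain u where u: "u \<in> subset_module m (Suc p)" "z = delta_diff E Q u"
      using \<open>z \<in> boundaries Delta p\<close> by (auto simp: Delta_boundaries)
    have "delta_mult z w = delta_diff E Q (delta_mult u w)"
      using delta_leibniz[OF u(1), of w q] that(2) by (simp add: Delta_cycles u(2))
    moreover have "delta_mult u w \<in> subset_module m (Suc (p + q))"
      using delta_mult_in[OF u(1), of w q] that(2) by (simp add: Delta_cycles)
    ultimately show ?thesis by (auto simp: Delta_boundaries Delta_simps)
  qed
  show "mult Delta p q z w \<in> boundaries Delta (p + q)" if "z \<in> cycles Delta p" "w \<in> boundaries Delta q"
  proof -
    obtain u where u: "u \<in> subset_module m (Suc q)" "w = delta_diff E Q u"
      using \<open>w \<in> boundaries Delta q\<close> by (auto simp: Delta_boundaries)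
    have z: "z \<in> subset_module m p" "delta_diff E Q z = 0" using that by (auto simp: Delta_cycles)
    have "delta_diff E Q (delta_mult z u) = pm_scale ((- 1) ^ p) (delta_mult z w)"
      using delta_leibniz[OF z(1) u(1)] by (simp add: z(2) u(2))
    then have "pm_scale ((- 1) ^ p) (delta_diff E Q (delta_mult z u)) = delta_mult z w"
      by (simp flip: power_mult_distrib)
    then have "delta_mult z w = delta_diff E Q (pm_scale ((- 1) ^ p) (delta_mult z u))"
      by (simp add: delta_diff_eq on_basis_scale)
    moreover have "pm_scale ((- 1) ^ p) (delta_mult z u) \<in> subset_module m (Suc (p + q))"
      using delta_mult_in[OF z(1) u(1)] by (auto intro: subset_module_closed)
    ultimately show ?thesis by (auto simp: Delta_boundaries Delta_simps)
  qed
qed (auto simp: Delta_simps delta_diff_delta_diff delta_diff_diff delta_diff_scale delta_diff_zero pm.scale_right_diff_distrib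
    bilin_def on_basis_fun_diff on_basis_diff subset_module_single
    intro: subset_module_closed delta_diff_in)

end

section \<open>The Tor algebra\<close>

locale tensor_algebra = tensor_resolution s F d \<epsilon> I + multiplication_lift s F d \<epsilon> I \<mu>
  for s :: "('x::linorder, 'k::field) mpol \<Rightarrow> 'm::ab_group_add \<Rightarrow> 'm" and F d \<epsilon> I \<mu>
begin

lemma residue_scale_mult: "c * residue_scale r a = residue_scale r (c * a)" "residue_scale r a * c = residue_scale r (a * c)"
  for a c :: 'k
  by (simp_all add: residue_scale_def)

abbreviation "Tor \<equiv> tor_dga s F d \<epsilon> I \<mu>"

definition tmult :: "nat \<Rightarrow> nat \<Rightarrow> ('m \<times> 'k \<Rightarrow>\<^sub>0 int) \<Rightarrow> ('m \<times> 'k \<Rightarrow>\<^sub>0 int) \<Rightarrow> ('m \<times> 'k \<Rightarrow>\<^sub>0 int)"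
  where "tmult p q z w = frag_extend (\<lambda>(x, a). frag_extend (\<lambda>(y, b). frag_of (\<mu> p q x y, a * b)) w) z"

definition tscal :: "'k \<Rightarrow> ('m \<times> 'k \<Rightarrow>\<^sub>0 int) \<Rightarrow> ('m \<times> 'k \<Rightarrow>\<^sub>0 int)"
  where "tscal c = frag_extend (\<lambda>(x, a). frag_of (x, c * a))"

lemma Tor_simps:
  "car Tor p = C p" "rel Tor p = T p" "diff Tor p = push (d p)" "scal Tor = tscal"
  "mult Tor p q = tmult p q" "unit Tor = frag_of (SOME e. e \<in> F 0 \<and> \<epsilon> e = 1 +o I, 1)"
  by (simp_all add: tor_dga_def push_def tmult_def tscal_def fun_eq_iff)

lemma tmult_of [simp]: "tmult p q (frag_of (x, a)) (frag_of (y, b)) = frag_of (\<mu> p q x y, a * b)"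
  and tmult_diff_left: "tmult p q (z - z') w = tmult p q z w - tmult p q z' w"
  and tmult_diff_right: "tmult p q z (w - w') = tmult p q z w - tmult p q z w'"
  and tmult_0 [simp]: "tmult p q 0 w = 0" "tmult p q z 0 = 0"
  by (simp_all add: tmult_def frag_extend_diff frag_extend_fun_diff case_prod_unfold frag_extend_eq_0)

lemma tscal_of [simp]: "tscal c (frag_of (x, a)) = frag_of (x, c * a)"
  and tscal_diff: "tscal c (z - w) = tscal c z - tscal c w"
  and tscal_0 [simp]: "tscal c 0 = 0"
  by (simp_all add: tscal_def frag_extend_diff)

lemma tscal_C: "z \<in> C p \<Longrightarrow> tscal c z \<in> C p"
  by (induction rule: tensor_free_induct) (auto simp: tscal_diff intro: tensor_free_closed)

lemma tscal_T: "z \<in> T p \<Longrightarrow> tscal c z \<in> T p"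
proof (induction rule: tensor_rel_induct)
  case (scale r x a)
  then show ?case using T_residue[of x p r "c * a"]
    by (simp add: tscal_diff residue_scale_mult)
qed (auto simp: tscal_diff distrib_left intro: T_0 T_diff T_add_left T_add_right)

lemma push_tscal: "push g (tscal c z) = tscal c (push g z)"
proof (induction z rule: frag_induction[OF subset_UNIV])
  case (2 x)
  then show ?case by (cases x) simp
qed (simp_all add: push_diff tscal_diff)

lemma tmult_C: "z \<in> C p \<Longrightarrow> w \<in> C q \<Longrightarrow> tmult p q z w \<in> C (p + q)"
proof (induction z rule: tensor_free_induct)
  case (one x a)
  from one(3) show ?case
    by (induction rule: tensor_free_induct)
      (use one(1) in \<open>auto simp: tmult_diff_right intro: tensor_free_closed \<mu>_in\<close>)
qed (auto simp: tmult_diff_left intro: tensor_free_closed)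

lemma tmult_T_leftI:
  assumes "w \<in> C q" "\<And>y b. y \<in> F q \<Longrightarrow> tmult p q z (frag_of (y, b)) \<in> T r"
  shows "tmult p q z w \<in> T r"
  using assms(1)
  by (induction rule: tensor_free_induct) (auto simp: tmult_diff_right T_0 assms(2) intro: T_diff)

lemma tmult_T_rightI:
  assumes "z \<in> C p" "\<And>x a. x \<in> F p \<Longrightarrow> tmult p q (frag_of (x, a)) w \<in> T r"
  shows "tmult p q z w \<in> T r"
  using assms(1)
  by (induction rule: tensor_free_induct) (auto simp: tmult_diff_left T_0 assms(2) intro: T_diff)

lemma tmult_T_left: 
  assumes "z \<in> T p" "w \<in> C q" shows "tmult p q z w \<in> T (p + q)"
proof (rule tmult_T_leftI[OF assms(2)])
  fix y b assume y: "y \<in> F q"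
  note l = linear_map_onD[OF linear_\<mu>_left[OF y]]
  from assms(1) show "tmult p q z (frag_of (y, b)) \<in> T (p + q)"
  proof (induction rule: tensor_rel_induct)
    case (scale r x a)
    then show ?case using T_residue[of "\<mu> p q x y" "p + q" r "a * b"]
      by (simp add: tmult_diff_left residue_scale_mult l)
  qed (auto simp: tmult_diff_left T_0 l distrib_right intro: T_diff T_add_left T_add_right)
qed

lemma tmult_T_right: 
  assumes "z \<in> C p" "w \<in> T q" shows "tmult p q z w \<in> T (p + q)"
proof (rule tmult_T_rightI[OF assms(1)])
  fix x a assume x: "x \<in> F p"
  note l = linear_map_onD[OF linear_\<mu>_right[OF x]]
  from assms(2) show "tmult p q (frag_of (x, a)) w \<in> T (p + q)"
  proof (induction rule: tensor_rel_induct)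
    case (scale r y b)
    then show ?case using T_residue[of "\<mu> p q x y" "p + q" r "a * b"]
      by (simp add: tmult_diff_right residue_scale_mult l)
  qed (auto simp: tmult_diff_right T_0 l distrib_left intro: T_diff T_add_left T_add_right)
qed

lemma T_sign:
  assumes "x \<in> F p" shows "frag_of (s ((- 1) ^ n) x, a) - frag_cmul ((- 1) ^ n) (frag_of (x, a)) \<in> T p"
proof (cases "even n")
  case False
  have "frag_of (x + - x, a) - frag_of (x, a) - frag_of (- x, a) \<in> T p"
    by (intro T_add_left assms F_closed)
  from T_minus[OF T_diff[OF this T_zero_left[of a p]]] show ?thesis using False by (simp add: scale_minus_left algebra_simps)
qed (simp add: T_0)

text \<open>
  Modulo relations, since signs have to be moved from the module to the integer coefficients of a formal
  sum.
\<close>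

lemma tmult_leibniz:
  assumes z: "z \<in> C p" and w: "w \<in> C q"
  shows "push (d (p + q)) (tmult p q z w) -
    (tmult (p - 1) q (push (d p) z) w + frag_cmul ((- 1) ^ p) (tmult p (q - 1) z (push (d q) w))) \<in> T (p + q - 1)"
    (is "?L z w \<in> _")
proof -
  have Ll: "?L (z - z') w = ?L z w - ?L z' w" for z z' w
    by (simp add: tmult_diff_left push_diff module.scale_right_diff_distrib[OF module_frag_cmul] algebra_simps)
  have Lr: "?L z (w - w') = ?L z w - ?L z w'" for z w w'
    by (simp add: tmult_diff_right push_diff module.scale_right_diff_distrib[OF module_frag_cmul] algebra_simps)
  have L1: "?L (frag_of (x, a)) (frag_of (y, b)) \<in> T (p + q - 1)" if x: "x \<in> F p" and y: "y \<in> F q" for x y a b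
  proof -
    let ?A = "\<mu> (p - 1) q (d p x) y" and ?B = "\<mu> p (q - 1) x (d q y)"
    have A: "?A \<in> F (p + q - 1)"
    proof (cases p)
      case (Suc p')
      then show ?thesis using \<mu>_in[OF linear_map_onD(1)[OF linear_d'[of p] x] y] by simp
    qed (use x y in \<open>simp add: \<mu>_0 F_closed\<close>)
    have B: "?B \<in> F (p + q - 1)"
    proof (cases q)
      case (Suc q')
      then show ?thesis using \<mu>_in[OF x linear_map_onD(1)[OF linear_d'[of q] y]] by simp
    qed (use x y in \<open>simp add: \<mu>_0 F_closed\<close>)
    have "frag_of (?A + s ((- 1) ^ p) ?B, a * b) - frag_of (?A, a * b) - frag_of (s ((- 1) ^ p) ?B, a * b) \<in> T (p + q - 1)"
      by (intro T_add_left A F_closed B)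
    from T_add[OF this T_sign[OF B, of p "a * b"]] show ?thesis
      by (simp add: \<mu>_leibniz[OF x y] algebra_simps)
  qed
  from z show ?thesis
  proof (induction rule: tensor_free_induct)
    case zero
    show ?case by (simp add: T_0)
  next
    case (one x a)
    from w show ?case
    proof (induction rule: tensor_free_induct)
      case zero
      show ?case by (simp add: T_0)
    next
      case (one y b)
      then show ?case by (intro L1 \<open>x \<in> F p\<close>)
    next
      case (diff w w')
      then show ?case unfolding Lr by (rule T_diff)
    qed
  next
    case (diff z z')
    then show ?case unfolding Ll by (rule T_diff)
  qed
qed

lemma Tor_cycles: "z \<in> cycles Tor p \<longleftrightarrow> z \<in> C p \<and> (p = 0 \<or> push (d p) z \<in> T (p - 1))"
  by (simp add: cycles_def Tor_simps)

text \<open>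
  The differential of a cycle is zero in \<open>F \<otimes> k\<close>, so it annihilates everything. In degree \<open>0\<close> the
  index \<open>p - 1\<close> is truncated and the argument is different: the differential is then zero in \<open>F\<close> itself.
\<close>

lemma tmult_diff_cycle_left:
  assumes z: "z \<in> cycles Tor p" and w: "w \<in> C q"
  shows "tmult (p - 1) q (push (d p) z) w \<in> T (p + q - 1)"
proof (cases p)
  case 0
  have "z \<in> C 0" using z 0 by (simp add: Tor_cycles)
  then have "tmult 0 q (push (d 0) z) w \<in> T (p + q - 1)"
  proof (induction rule: tensor_free_induct)
    case (one x a)
    show ?case by (rule tmult_T_leftI[OF w]) (use one in \<open>simp add: \<mu>_0 T_zero_left\<close>)
  qed (auto simp: push_diff tmult_diff_left T_0 intro: T_diff)
  then show ?thesis using 0 by simp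
next
  case (Suc p')
  then show ?thesis using z tmult_T_left[of "push (d p) z" p' w q] w by (simp add: Tor_cycles)
qed

lemma tmult_diff_cycle_right:
  assumes z: "z \<in> C p" and w: "w \<in> cycles Tor q"
  shows "tmult p (q - 1) z (push (d q) w) \<in> T (p + q - 1)"
proof (cases q)
  case 0
  have "w \<in> C 0" using w 0 by (simp add: Tor_cycles)
  then have "tmult p 0 z (push (d 0) w) \<in> T (p + q - 1)"
  proof (induction rule: tensor_free_induct)
    case (one y b)
    show ?case by (rule tmult_T_rightI[OF z]) (use one in \<open>simp add: \<mu>_0 T_zero_left\<close>)
  qed (auto simp: push_diff tmult_diff_right T_0 intro: T_diff)
  then show ?thesis using 0 by simp
next
  case (Suc q')
  then show ?thesis using w tmult_T_right[of z p "push (d q) w" q'] z by (simp add: Tor_cycles)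
qed

lemma T_cmul: "z \<in> T p \<Longrightarrow> frag_cmul c z \<in> T p"
  unfolding tensor_rel_def by (rule module.span_scale[OF module_frag_cmul])

lemma T_add_cancel: "z - w \<in> T p \<Longrightarrow> w \<in> T p \<Longrightarrow> z \<in> T p"
  using T_add[of "z - w" p w] by simp

lemma push_d_C: "z \<in> C (Suc p) \<Longrightarrow> push (d (Suc p)) z \<in> C p"
  by (rule push_C[OF linear_map_onD(1)[OF linear_d]])

lemma Tor_boundaryI: "z \<in> C (Suc p) \<Longrightarrow> b - push (d (Suc p)) z \<in> T p \<Longrightarrow> b \<in> boundaries Tor p"
  using set_plus_intro[of "push (d (Suc p)) z" "push (d (Suc p)) ` C (Suc p)" "b - push (d (Suc p)) z" "T p"]
  by (simp add: boundaries_def Tor_simps)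

lemma Tor_boundaryE:
  assumes "b \<in> boundaries Tor p"
  obtains z where "z \<in> C (Suc p)" "b - push (d (Suc p)) z \<in> T p"
  using assms by (auto simp: boundaries_def Tor_simps elim!: set_plus_elim)

lemma Tor_mult_cycles:
  assumes z: "z \<in> cycles Tor p" and w: "w \<in> cycles Tor q"
  shows "tmult p q z w \<in> cycles Tor (p + q)"
proof -
  have zC: "z \<in> C p" and wC: "w \<in> C q" using z w by (simp_all add: Tor_cycles)
  have "push (d (p + q)) (tmult p q z w) \<in> T (p + q - 1)"
    by (rule T_add_cancel[OF tmult_leibniz[OF zC wC]])
      (intro T_add T_cmul tmult_diff_cycle_left[OF z wC] tmult_diff_cycle_right[OF zC w])
  then show ?thesis using tmult_C[OF zC wC] by (simp add: Tor_cycles)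
qed

text \<open>
  If \<open>z = d u\<close> and \<open>w\<close> is a cycle, then \<open>z w = d(u w)\<close> by the Leibniz rule, all modulo relations.
\<close>

lemma Tor_mult_boundary_left:
  assumes z: "z \<in> boundaries Tor p" and w: "w \<in> cycles Tor q"
  shows "tmult p q z w \<in> boundaries Tor (p + q)"
proof -
  have wC: "w \<in> C q" using w by (simp add: Tor_cycles)
  obtain u where u: "u \<in> C (Suc p)" "z - push (d (Suc p)) u \<in> T p" using z by (rule Tor_boundaryE)
  have "push (d (Suc p + q)) (tmult (Suc p) q u w) - tmult p q (push (d (Suc p)) u) w -
      frag_cmul ((- 1) ^ Suc p) (tmult (Suc p) (q - 1) u (push (d q) w)) \<in> T (p + q)"
    using tmult_leibniz[OF u(1) wC] by (simp add: algebra_simps)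
  from T_add_cancel[OF this T_cmul] tmult_diff_cycle_right[OF u(1) w]
  have 1: "push (d (Suc (p + q))) (tmult (Suc p) q u w) - tmult p q (push (d (Suc p)) u) w \<in> T (p + q)" by simp
  have 2: "tmult p q z w - tmult p q (push (d (Suc p)) u) w \<in> T (p + q)"
    using tmult_T_left[OF u(2) wC] by (simp add: tmult_diff_left)
  show ?thesis
  proof (rule Tor_boundaryI)
    show "tmult (Suc p) q u w \<in> C (Suc (p + q))" using tmult_C[OF u(1) wC] by simp
    show "tmult p q z w - push (d (Suc (p + q))) (tmult (Suc p) q u w) \<in> T (p + q)"
      using T_diff[OF 2 1] by (simp add: algebra_simps)
  qed
qed

lemma Tor_mult_boundary_right:
  assumes z: "z \<in> cycles Tor p" and w: "w \<in> boundaries Tor q"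
  shows "tmult p q z w \<in> boundaries Tor (p + q)"
proof -
  have zC: "z \<in> C p" using z by (simp add: Tor_cycles)
  obtain u where u: "u \<in> C (Suc q)" "w - push (d (Suc q)) u \<in> T q" using w by (rule Tor_boundaryE)
  let ?B = "tmult p q z (push (d (Suc q)) u)" and ?e = "(- 1) ^ p :: int"
  have "(push (d (p + Suc q)) (tmult p (Suc q) z u) - frag_cmul ?e ?B) -
      tmult (p - 1) (Suc q) (push (d p) z) u \<in> T (p + q)"
    using tmult_leibniz[OF zC u(1)] by (simp add: algebra_simps)
  from T_add_cancel[OF this] tmult_diff_cycle_left[OF z u(1)]
  have "push (d (Suc (p + q))) (tmult p (Suc q) z u) - frag_cmul ?e ?B \<in> T (p + q)" by simp
  from T_cmul[OF this, of ?e]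
  have 1: "frag_cmul ?e (push (d (Suc (p + q))) (tmult p (Suc q) z u)) - ?B \<in> T (p + q)"
    by (simp add: module.scale_right_diff_distrib[OF module_frag_cmul] flip: power_mult_distrib)
  have push_cmul: "frag_cmul ?e (push g v) = push g (frag_cmul ?e v)" for g :: "'m \<Rightarrow> 'm" and v :: "'m \<times> 'k \<Rightarrow>\<^sub>0 int"
    by (simp add: push_def frag_extend_cmul)
  have 2: "tmult p q z w - ?B \<in> T (p + q)"
    using tmult_T_right[OF zC u(2)] by (simp add: tmult_diff_right)
  show ?thesis
  proof (rule Tor_boundaryI)
    have "tmult p (Suc q) z u \<in> C (Suc (p + q))" using tmult_C[OF zC u(1)] by simp
    then show "frag_cmul ?e (tmult p (Suc q) z u) \<in> C (Suc (p + q))"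
      using keys_cmul by (fastforce simp: tensor_free_def)
    show "tmult p q z w - push (d (Suc (p + q))) (frag_cmul ?e (tmult p (Suc q) z u)) \<in> T (p + q)"
      using T_diff[OF 2 1] by (simp add: push_cmul algebra_simps)
  qed
qed

lemma unit_rep: "(SOME e. e \<in> F 0 \<and> \<epsilon> e = 1 +o I) \<in> F 0" "\<epsilon> (SOME e. e \<in> F 0 \<and> \<epsilon> e = 1 +o I) = 1 +o I"
  using someI_ex[of "\<lambda>e. e \<in> F 0 \<and> \<epsilon> e = 1 +o I"] eps_surj[of 1] by blast+

lemma push_d_d: "z \<in> C (Suc (Suc p)) \<Longrightarrow> push (d (Suc p)) (push (d (Suc (Suc p))) z) \<in> T p"
proof (induction rule: tensor_free_induct)
  case (one x a)
  then show ?case using d_d[OF one(1)] by (simp add: T_zero_left)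
qed (auto simp: push_diff T_0 intro: T_diff)

lemma Tor_chain_algebra: "chain_algebra Tor"
proof
  show "rel Tor p \<subseteq> car Tor p" for p by (auto simp: Tor_simps T_C)
  show "unit Tor \<in> car Tor 0" unfolding Tor_simps by (intro tensor_free_closed unit_rep UNIV_I)
  show "mult Tor p q z w \<in> cycles Tor (p + q)" if "z \<in> cycles Tor p" "w \<in> cycles Tor q" for p q z w
    using Tor_mult_cycles[OF that] by (simp add: Tor_simps)
  show "mult Tor p q z w \<in> boundaries Tor (p + q)" if "z \<in> boundaries Tor p" "w \<in> cycles Tor q" for p q z w
    using Tor_mult_boundary_left[OF that] by (simp add: Tor_simps)
  show "mult Tor p q z w \<in> boundaries Tor (p + q)" if "z \<in> cycles Tor p" "w \<in> boundaries Tor q" for p q z w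
    using Tor_mult_boundary_right[OF that] by (simp add: Tor_simps)
qed (simp_all add: Tor_simps tensor_free_closed T_0 T_diff push_d_C push_diff push_T[OF linear_d] push_d_d
    tscal_C tscal_diff tscal_T push_tscal tmult_diff_left tmult_diff_right)

end

section \<open>The isomorphism\<close>

text \<open>
  The two cases of the homotopy formula in one, with the term missing in degree \<open>0\<close>.
\<close>

lemma comparison_homotopy_uniform:
  assumes "resolution s F d \<epsilon> I" "resolution s' F' d' \<epsilon>' I"
    and "comparison_map s F d \<epsilon> s' F' d' \<epsilon>' f" "comparison_map s F d \<epsilon> s' F' d' \<epsilon>' g"
  obtains h where "\<And>p. linear_map_on s s' (F p) (F' (Suc p)) (h p)"
    "\<And>p x. x \<in> F p \<Longrightarrow> f p x - g p x = d' (Suc p) (h p x) + (if p = 0 then 0 else h (p - 1) (d p x))"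
proof -
  obtain h where h: "\<And>p. linear_map_on s s' (F p) (F' (Suc p)) (h p)"
    "\<forall>x\<in>F 0. f 0 x - g 0 x = d' 1 (h 0 x)"
    "\<forall>p. \<forall>x\<in>F (Suc p). f (Suc p) x - g (Suc p) x = d' (Suc (Suc p)) (h (Suc p) x) + h p (d (Suc p) x)"
    using comparison_homotopy[OF assms] by blast
  have "f p x - g p x = d' (Suc p) (h p x) + (if p = 0 then 0 else h (p - 1) (d p x))" if "x \<in> F p" for p x
    using h(2,3) that by (cases p) auto
  with h(1) show ?thesis by (rule that)
qed

lemma const_reduce_linear:
  fixes L :: "(nat set \<Rightarrow>\<^sub>0 ('x, 'k::comm_ring_1) mpol) \<Rightarrow> (nat set \<Rightarrow>\<^sub>0 ('x, 'k) mpol)"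
  assumes "linear_map_on pm_scale pm_scale (subset_module m p) N L" "v \<in> subset_module m p"
  shows "const_reduce (L v) = on_basis (\<lambda>\<sigma>. const_reduce (L (Poly_Mapping.single \<sigma> 1))) (const_reduce v)"
  unfolding linear_on_subset_module_on_basis[OF assms] by (rule const_reduce_on_basis)

context taylor_comparison
begin

sublocale R: tensor_algebra s F d \<epsilon> I \<mu>
  by unfold_locales

sublocale Y: chain_algebra Delta
  by (rule Delta_chain_algebra)

sublocale X: chain_algebra R.Tor
  by (rule R.Tor_chain_algebra)

lemma delta_diff_to_delta:
  assumes "\<And>x. x \<in> F p \<Longrightarrow> \<chi> p x \<in> subset_module m q" "z \<in> R.C p"
  shows "delta_diff E Q (to_delta \<chi> p z) = to_delta (\<lambda>p x. taylor_diff E Q (\<chi> p x)) p z"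
  using assms(2)
proof (induction rule: tensor_free_induct)
  case (one x a)
  then show ?case
    using const_reduce_taylor_diff[OF assms(1)] by (simp add: delta_diff_scale) (simp add: delta_diff_eq)
qed (simp_all add: delta_diff_zero to_delta_diff delta_diff_diff)

text \<open>
  If \<open>\<chi> = d h + h d\<close>, then on a cycle the second term is zero modulo the relations, and the first
  gives a boundary.
\<close>

lemma to_delta_homotopy:
  assumes h: "\<And>p. linear_map_on s pm_scale (F p) (subset_module m (Suc p)) (h p)"
    and \<chi>: "\<And>p x. x \<in> F p \<Longrightarrow>
      \<chi> p x = taylor_diff E Q (h p x) + (if p = 0 then 0 else h (p - 1) (d p x))"
    and z: "z \<in> cycles R.Tor p"
  shows "to_delta \<chi> p z \<in> boundaries Delta p"
proof -
  have zC: "z \<in> R.C p" using z by (simp add: R.Tor_cycles)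
  let ?k = "\<lambda>p x. if p = 0 then 0 else h (p - 1) (d p x)"
  have "to_delta ?k p z = 0"
  proof (cases p)
    case 0
    then show ?thesis by (simp add: to_delta_conv)
  next
    case (Suc p')
    have "to_delta ?k p z = to_delta (\<lambda>q x. h p' (d p x)) p z"
      by (rule R.to_delta_cong[OF zC]) (simp add: Suc)
    also have "\<dots> = to_delta h p' (push (d p) z)" by (rule to_delta_push[symmetric])
    also have "\<dots> = 0" using R.to_delta_T[where \<chi> = h, OF h] z Suc by (simp add: R.Tor_cycles)
    finally show ?thesis .
  qed
  moreover have "to_delta \<chi> p z = to_delta (\<lambda>p x. taylor_diff E Q (h p x) + ?k p x) p z"
    by (rule R.to_delta_cong[OF zC]) (rule \<chi>)
  ultimately have "to_delta \<chi> p z = delta_diff E Q (to_delta h p z)"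
    using delta_diff_to_delta[OF linear_map_onD(1)[OF h] zC]
    by (simp only: R.to_delta_fun_add add_0_right)
  moreover have "to_delta h p z \<in> subset_module m (Suc p)"
    by (rule R.to_delta_in[OF linear_map_onD(1)[OF h] zC])
  ultimately show ?thesis unfolding Delta_boundaries by blast
qed

lemma to_delta_comparison_unique:
  assumes \<phi>': "comparison_map s F d \<epsilon> pm_scale (subset_module m) (\<lambda>_. taylor_diff E Q) (taylor_aug I) \<phi>'"
    and z: "z \<in> cycles R.Tor p"
  shows "to_delta \<phi> p z - to_delta \<phi>' p z \<in> boundaries Delta p"
proof -
  obtain h where h: "\<And>p. linear_map_on s pm_scale (F p) (subset_module m (Suc p)) (h p)"
    "\<And>p x. x \<in> F p \<Longrightarrow> \<phi> p x - \<phi>' p x = taylor_diff E Q (h p x) + (if p = 0 then 0 else h (p - 1) (d p x))"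
    by (rule comparison_homotopy_uniform[OF F.resolution_axioms K.resolution_axioms \<phi> \<phi>']) blast
  have "to_delta (\<lambda>p x. \<phi> p x - \<phi>' p x) p z \<in> boundaries Delta p"
    by (rule to_delta_homotopy[OF h z])
  then show ?thesis by (simp only: R.to_delta_fun_diff)
qed

lemma to_delta_\<phi>_in: "z \<in> R.C p \<Longrightarrow> to_delta \<phi> p z \<in> subset_module m p"
  by (rule R.to_delta_in[OF linear_map_onD(1)[OF linear_\<phi>]])

lemma to_delta_\<phi>_T: "z \<in> R.T p \<Longrightarrow> to_delta \<phi> p z = 0"
  by (rule R.to_delta_T[where \<chi> = \<phi>, OF linear_\<phi>])

lemma to_delta_\<phi>_push_d:
  assumes "z \<in> R.C (Suc p)"
  shows "to_delta \<phi> p (push (d (Suc p)) z) = delta_diff E Q (to_delta \<phi> (Suc p) z)"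
proof -
  have "to_delta \<phi> p (push (d (Suc p)) z) = to_delta (\<lambda>q x. \<phi> p (d (Suc p) x)) (Suc p) z"
    by (rule to_delta_push)
  also have "\<dots> = to_delta (\<lambda>p x. taylor_diff E Q (\<phi> p x)) (Suc p) z"
    by (rule R.to_delta_cong[OF assms]) (simp add: \<phi>_d)
  also have "\<dots> = delta_diff E Q (to_delta \<phi> (Suc p) z)"
    by (rule delta_diff_to_delta[OF linear_map_onD(1)[OF linear_\<phi>] assms, symmetric])
  finally show ?thesis .
qed

lemma to_delta_cycles: "z \<in> cycles R.Tor p \<Longrightarrow> to_delta \<phi> p z \<in> cycles Delta p"
proof -
  assume z: "z \<in> cycles R.Tor p"
  then have zC: "z \<in> R.C p" by (simp add: R.Tor_cycles)
  have "delta_diff E Q (to_delta \<phi> p z) = 0"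
  proof (cases p)
    case 0
    then show ?thesis using to_delta_\<phi>_in[OF zC] delta_diff_0 by simp
  next
    case (Suc p')
    then show ?thesis using to_delta_\<phi>_push_d[of z p'] to_delta_\<phi>_T z zC
      by (simp add: R.Tor_cycles)
  qed
  then show ?thesis using to_delta_\<phi>_in[OF zC] by (simp add: Delta_cycles)
qed

lemma to_delta_boundaries: "b \<in> boundaries R.Tor p \<Longrightarrow> to_delta \<phi> p b \<in> boundaries Delta p"
proof (elim R.Tor_boundaryE)
  fix u assume u: "u \<in> R.C (Suc p)" "b - push (d (Suc p)) u \<in> R.T p"
  have "to_delta \<phi> p b = delta_diff E Q (to_delta \<phi> (Suc p) u)"
    using to_delta_\<phi>_T[OF u(2)] by (simp add: to_delta_diff to_delta_\<phi>_push_d[OF u(1)])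
  then show ?thesis using to_delta_\<phi>_in[OF u(1)] by (auto simp: Delta_boundaries)
qed

lemma to_delta_tscal: "to_delta \<chi> p (R.tscal c z) = pm_scale c (to_delta \<chi> p z)"
proof (induction z rule: frag_induction[OF subset_UNIV])
  case (2 x)
  then show ?case by (cases x) simp
qed (simp_all add: R.tscal_diff to_delta_diff pm.scale_right_diff_distrib)

text \<open>
  The element of \<open>K\<^sub>0 = S\<close> that represents \<open>1\<close> is \<open>1\<close> plus an element of \<open>I\<close>, and elements of \<open>I\<close> have
  no constant term.
\<close>

lemma to_delta_unit: "to_delta \<phi> 0 (unit R.Tor) = unit Delta"
proof -
  let ?e = "SOME e. e \<in> F 0 \<and> \<epsilon> e = 1 +o I"
  have e: "\<phi> 0 ?e \<in> subset_module m 0" using linear_map_onD(1)[OF linear_\<phi> R.unit_rep(1)] .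
  have "lookup (\<phi> 0 ?e) {} +o I = 1 +o I"
    using \<phi>_aug[OF R.unit_rep(1)] R.unit_rep(2) by (simp add: taylor_aug_def)
  then have "const_coeff (lookup (\<phi> 0 ?e) {} - 1) = 0" by (intro const_coeff_I) (simp add: K.coset_eq_iff)
  then have 1: "const_coeff (lookup (\<phi> 0 ?e) {}) = 1" by (simp add: const_coeff_def lookup_minus)
  have 2: "lookup (\<phi> 0 ?e) \<sigma> = 0" if "\<sigma> \<noteq> {}" for \<sigma>
  proof (rule ccontr)
    assume "lookup (\<phi> 0 ?e) \<sigma> \<noteq> 0"
    then have "\<sigma> \<subseteq> {1..m} \<and> card \<sigma> = 0" using subset_module_keys[OF e, of \<sigma>] by (simp add: in_keys_iff)
    then show False using that finite_subset[of \<sigma> "{1..m}"] by simp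
  qed
  have "const_reduce (\<phi> 0 ?e) = Poly_Mapping.single {} 1"
    by (rule poly_mapping_eqI) (auto simp: 1 2 lookup_single when_def)
  then show ?thesis by (simp add: R.Tor_simps Delta_simps)
qed

text \<open>
  The map in the other direction, \<open>\<sigma> \<otimes> a \<mapsto> \<psi> \<sigma> \<otimes> a\<close>. It is additive only modulo the relations of the
  tensor product.
\<close>

definition from_delta :: "nat \<Rightarrow> (nat set \<Rightarrow>\<^sub>0 'k) \<Rightarrow> ('m \<times> 'k \<Rightarrow>\<^sub>0 int)"
  where "from_delta p v = (\<Sum>\<sigma>\<in>keys v. frag_of (\<psi> p (Poly_Mapping.single \<sigma> 1), lookup v \<sigma>))"

lemma \<psi>_single:
  assumes "v \<in> subset_module m p" "\<sigma> \<in> keys v" shows "\<psi> p (Poly_Mapping.single \<sigma> 1) \<in> F p"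
  using subset_module_keys[OF assms] by (intro linear_map_onD(1)[OF linear_\<psi>] subset_module_single) auto

lemma from_delta_C: "v \<in> subset_module m p \<Longrightarrow> from_delta p v \<in> R.C p"
  unfolding from_delta_def by (intro tensor_free_sum tensor_free_closed \<psi>_single UNIV_I)

lemma from_delta_superset:
  assumes "finite S" "keys v \<subseteq> S" "\<And>\<sigma>. \<sigma> \<in> S \<Longrightarrow> \<psi> p (Poly_Mapping.single \<sigma> 1) \<in> F p"
  shows "(\<Sum>\<sigma>\<in>S. frag_of (\<psi> p (Poly_Mapping.single \<sigma> 1), lookup v \<sigma>)) - from_delta p v \<in> R.T p"
proof -
  have "(\<Sum>\<sigma>\<in>S. frag_of (\<psi> p (Poly_Mapping.single \<sigma> 1), lookup v \<sigma>)) - from_delta p v =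
      (\<Sum>\<sigma>\<in>S - keys v. frag_of (\<psi> p (Poly_Mapping.single \<sigma> 1), lookup v \<sigma>))"
    unfolding from_delta_def using assms(1,2) by (simp add: sum_diff)
  also have "\<dots> \<in> R.T p"
  proof (rule R.T_sum)
    fix \<sigma> assume "\<sigma> \<in> S - keys v"
    then show "frag_of (\<psi> p (Poly_Mapping.single \<sigma> 1), lookup v \<sigma>) \<in> R.T p"
      using R.T_zero_right[OF assms(3)] by (simp add: in_keys_iff)
  qed
  finally show ?thesis .
qed

lemma from_delta_diff:
  assumes v: "v \<in> subset_module m p" and w: "w \<in> subset_module m p"
  shows "from_delta p (v - w) - (from_delta p v - from_delta p w) \<in> R.T p"
proof -
  let ?S = "keys v \<union> keys w" and ?\<psi> = "\<lambda>\<sigma>. \<psi> p (Poly_Mapping.single \<sigma> 1)"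
  let ?f = "\<lambda>v. \<Sum>\<sigma>\<in>?S. frag_of (?\<psi> \<sigma>, lookup v \<sigma>)"
  have S: "finite ?S" "?\<psi> \<sigma> \<in> F p" if "\<sigma> \<in> ?S" for \<sigma> using \<psi>_single v w that by auto
  have fS: "finite ?S" by simp
  have 1: "?f u - from_delta p u \<in> R.T p" if "keys u \<subseteq> ?S" for u
    by (rule from_delta_superset[OF fS that S(2)])
  have "?f (v - w) - (?f v - ?f w) =
      (\<Sum>\<sigma>\<in>?S. frag_of (?\<psi> \<sigma>, lookup v \<sigma> - lookup w \<sigma>) - (frag_of (?\<psi> \<sigma>, lookup v \<sigma>) - frag_of (?\<psi> \<sigma>, lookup w \<sigma>)))"
    by (simp add: sum_subtractf lookup_minus)
  also have "\<dots> \<in> R.T p" by (intro R.T_sum R.T_diff_right S(2))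
  finally have "?f (v - w) - (?f v - ?f w) \<in> R.T p" .
  from R.T_diff[OF this 1[OF keys_diff]]
  have "from_delta p (v - w) - (?f v - ?f w) \<in> R.T p"
    using R.T_minus by (force simp: algebra_simps)
  from R.T_add[OF this R.T_diff[OF 1[OF Un_upper1] 1[OF Un_upper2]]] show ?thesis by (simp add: algebra_simps)
qed

lemma from_delta_0 [simp]: "from_delta p 0 = 0"
  by (simp add: from_delta_def)

lemma from_delta_add:
  assumes v: "v \<in> subset_module m p" and w: "w \<in> subset_module m p"
  shows "from_delta p (v + w) - (from_delta p v + from_delta p w) \<in> R.T p"
  using R.T_minus[OF from_delta_diff[OF subset_module_closed(2)[OF v w] w]] by (simp add: algebra_simps)

lemma from_delta_sum:
  "(\<And>a. a \<in> A \<Longrightarrow> g a \<in> subset_module m p) \<Longrightarrow> from_delta p (sum g A) - (\<Sum>a\<in>A. from_delta p (g a)) \<in> R.T p"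
proof (induction A rule: infinite_finite_induct)
  case (insert a A)
  have "sum g A \<in> subset_module m p"
    using insert.prems by (intro pm.subspace_sum[OF subspace_subset_module]) auto
  then have "from_delta p (g a + sum g A) - (from_delta p (g a) + from_delta p (sum g A)) \<in> R.T p"
    using insert.prems by (intro from_delta_add) auto
  from R.T_add[OF this insert.IH] insert show ?case by (simp add: algebra_simps)
qed (simp_all add: R.T_0)

text \<open>
  In \<open>F \<otimes> k\<close> the coefficients of \<open>y\<close> may be replaced by their constant terms. So \<open>from_delta\<close> is
  \<open>\<psi> \<otimes> k\<close>, up to the identification of \<open>K \<otimes> k\<close> with \<open>\<Delta>(D)\<close>.
\<close>

lemma from_delta_const_reduce:
  assumes y: "y \<in> subset_module m p"
  shows "frag_of (\<psi> p y, a) - from_delta p (pm_scale a (const_reduce y)) \<in> R.T p"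
proof -
  let ?\<psi> = "\<lambda>\<sigma>. \<psi> p (Poly_Mapping.single \<sigma> 1)"
  have "frag_of (\<Sum>\<sigma>\<in>keys y. s (lookup y \<sigma>) (?\<psi> \<sigma>), a) -
      (\<Sum>\<sigma>\<in>keys y. frag_of (s (lookup y \<sigma>) (?\<psi> \<sigma>), a)) \<in> R.T p"
    by (intro R.T_sum_left F.F_closed \<psi>_single[OF y] finite_keys)
  then have 1: "frag_of (\<psi> p y, a) - (\<Sum>\<sigma>\<in>keys y. frag_of (s (lookup y \<sigma>) (?\<psi> \<sigma>), a)) \<in> R.T p"
    unfolding linear_on_subset_module[OF linear_\<psi> y] .
  have "(\<Sum>\<sigma>\<in>keys y. frag_of (s (lookup y \<sigma>) (?\<psi> \<sigma>), a)) -
      (\<Sum>\<sigma>\<in>keys y. frag_of (?\<psi> \<sigma>, const_coeff (lookup y \<sigma>) * a)) \<in> R.T p"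
    unfolding sum_subtractf[symmetric] by (intro R.T_sum R.T_scale \<psi>_single[OF y])
  then have 2: "(\<Sum>\<sigma>\<in>keys y. frag_of (s (lookup y \<sigma>) (?\<psi> \<sigma>), a)) -
      (\<Sum>\<sigma>\<in>keys y. frag_of (?\<psi> \<sigma>, lookup (pm_scale a (const_reduce y)) \<sigma>)) \<in> R.T p"
    by (simp add: mult.commute)
  have "keys (pm_scale a (const_reduce y)) \<subseteq> keys y"
    by (rule order_trans[OF keys_pm_scale keys_const_reduce])
  from from_delta_superset[OF finite_keys this \<psi>_single[OF y]]
  have 3: "(\<Sum>\<sigma>\<in>keys y. frag_of (?\<psi> \<sigma>, lookup (pm_scale a (const_reduce y)) \<sigma>)) -
      from_delta p (pm_scale a (const_reduce y)) \<in> R.T p" .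
  from R.T_add[OF R.T_add[OF 1 2] 3] show ?thesis
    by (simp only: diff_add_cancel add_diff_eq)
qed

lemma push_d_from_delta:
  assumes v: "v \<in> subset_module m (Suc p)"
  shows "push (d (Suc p)) (from_delta (Suc p) v) - from_delta p (delta_diff E Q v) \<in> R.T p"
proof -
  have \<sigma>: "Poly_Mapping.single \<sigma> 1 \<in> subset_module m (Suc p)" "\<sigma> \<subseteq> {1..m}" "taylor_face \<sigma> \<in> subset_module m p"
    if "\<sigma> \<in> keys v" for \<sigma>
    using subset_module_keys[OF v that] subset_module_single[of \<sigma> m "Suc p"] taylor_face_in[of \<sigma> p] by blast+
  have push_sum: "push g (sum f A) = (\<Sum>a\<in>A. push g (f a))" if "finite A"
    for g :: "'m \<Rightarrow> 'm" and f :: "nat set \<Rightarrow> ('m \<times> 'k \<Rightarrow>\<^sub>0 int)" and A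
    using that by (simp add: push_def frag_extend_sum)
  have "push (d (Suc p)) (from_delta (Suc p) v) = (\<Sum>\<sigma>\<in>keys v. frag_of (\<psi> p (taylor_face \<sigma>), lookup v \<sigma>))"
    unfolding from_delta_def push_sum[OF finite_keys]
    by (rule sum.cong[OF refl]) (simp add: \<psi>_d[OF \<sigma>(1), symmetric] taylor_diff_single)
  moreover have "(\<Sum>\<sigma>\<in>keys v. frag_of (\<psi> p (taylor_face \<sigma>), lookup v \<sigma>)) -
      (\<Sum>\<sigma>\<in>keys v. from_delta p (pm_scale (lookup v \<sigma>) (const_reduce (taylor_face \<sigma>)))) \<in> R.T p"
    unfolding sum_subtractf[symmetric] by (intro R.T_sum from_delta_const_reduce \<sigma>(3))
  moreover have "delta_diff E Q v = (\<Sum>\<sigma>\<in>keys v. pm_scale (lookup v \<sigma>) (const_reduce (taylor_face \<sigma>)))"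
    unfolding delta_diff_eq on_basis_def by (rule sum.cong[OF refl]) (simp only: const_reduce_taylor_face[OF \<sigma>(2)])
  moreover have "from_delta p (\<Sum>\<sigma>\<in>keys v. pm_scale (lookup v \<sigma>) (const_reduce (taylor_face \<sigma>))) -
      (\<Sum>\<sigma>\<in>keys v. from_delta p (pm_scale (lookup v \<sigma>) (const_reduce (taylor_face \<sigma>)))) \<in> R.T p"
    by (intro from_delta_sum subset_module_closed subset_module_const_reduce \<sigma>(3))
  ultimately show ?thesis using R.T_diff by fastforce
qed

lemma from_delta_cycles: "v \<in> cycles Delta p \<Longrightarrow> from_delta p v \<in> cycles R.Tor p"
  using push_d_from_delta[of v "p - 1"] from_delta_C[of v p]
  by (cases p) (auto simp: R.Tor_cycles Delta_cycles)

lemma from_delta_boundaries: "v \<in> boundaries Delta p \<Longrightarrow> from_delta p v \<in> boundaries R.Tor p"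
proof -
  assume "v \<in> boundaries Delta p"
  then obtain u where u: "u \<in> subset_module m (Suc p)" "v = delta_diff E Q u" by (auto simp: Delta_boundaries)
  show ?thesis unfolding u(2)
    by (rule R.Tor_boundaryI[OF from_delta_C[OF u(1)]])
      (use R.T_minus[OF push_d_from_delta[OF u(1)]] in simp)
qed

text \<open>
  Up to relations, \<open>from_delta\<close> after \<open>to_delta\<close> is \<open>\<psi> \<phi> \<otimes> k\<close>, and \<open>\<psi> \<phi>\<close> is homotopic to the
  identity of \<open>F\<close>.
\<close>

lemma from_delta_to_delta:
  assumes z: "z \<in> cycles R.Tor p"
  shows "from_delta p (to_delta \<phi> p z) - z \<in> boundaries R.Tor p"
proof -
  have zC: "z \<in> R.C p" using z by (simp add: R.Tor_cycles)
  let ?\<psi>\<phi> = "\<lambda>x. \<psi> p (\<phi> p x)"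
  from zC have 1: "z \<in> R.C p \<and> push ?\<psi>\<phi> z - from_delta p (to_delta \<phi> p z) \<in> R.T p"
  proof (induction rule: tensor_free_induct)
    case (one x a)
    then show ?case using from_delta_const_reduce[OF linear_map_onD(1)[OF linear_\<phi>]]
      by (auto intro: tensor_free_closed)
  next
    case (diff z w)
    have "from_delta p (to_delta \<phi> p z - to_delta \<phi> p w) -
        (from_delta p (to_delta \<phi> p z) - from_delta p (to_delta \<phi> p w)) \<in> R.T p"
      using diff by (intro from_delta_diff to_delta_\<phi>_in) auto
    from R.T_diff[OF R.T_diff[OF conjunct2[OF diff(1)] conjunct2[OF diff(2)]] this] diff show ?case
      by (simp add: push_diff to_delta_diff tensor_free_closed algebra_simps)
  qed (simp add: R.T_0 tensor_free_closed)
  obtain h where h: "\<And>p. linear_map_on s s (F p) (F (Suc p)) (h p)"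
    "\<And>p x. x \<in> F p \<Longrightarrow> \<psi> p (\<phi> p x) - x = d (Suc p) (h p x) + (if p = 0 then 0 else h (p - 1) (d p x))"
    by (rule comparison_homotopy_uniform[OF F.resolution_axioms F.resolution_axioms
      comparison_map_compose[OF \<phi> \<psi>] comparison_map_id]) blast
  let ?dh = "\<lambda>x. d (Suc p) (h p x)" and ?k = "\<lambda>x. if p = 0 then 0 else h (p - 1) (d p x)"
  have dh: "?dh x \<in> F p" if "x \<in> F p" for x
    using linear_map_onD(1)[OF F.linear_d linear_map_onD(1)[OF h(1) that]] .
  have k: "?k x \<in> F p" if "x \<in> F p" for x
    using linear_map_onD(1)[OF h(1) linear_map_onD(1)[OF F.linear_d' that]] F.F_closed(1) by (cases p) auto
  have 2: "push ?\<psi>\<phi> z = push (\<lambda>x. x + (?dh x + ?k x)) z"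
    by (rule R.push_cong[OF zC]) (simp add: h(2)[symmetric])
  have 3: "push (\<lambda>x. x + (?dh x + ?k x)) z - (push (\<lambda>x. x) z + push (\<lambda>x. ?dh x + ?k x) z) \<in> R.T p"
    by (rule R.push_add[OF zC]) (assumption, intro F.F_closed(2) dh k)
  have 4: "push (\<lambda>x. ?dh x + ?k x) z - (push ?dh z + push ?k z) \<in> R.T p"
    by (rule R.push_add[OF zC dh k])
  have 5: "push ?k z \<in> R.T p"
  proof (cases p)
    case 0
    from zC show ?thesis
      by (induction rule: tensor_free_induct) (auto simp: 0 push_diff R.T_0 R.T_zero_left intro: R.T_diff)
  next
    case (Suc p')
    have "push ?k z = push (h p') (push (d p) z)" by (simp add: Suc push_push)
    also have "\<dots> \<in> R.T p" using R.push_T[OF h(1)[of p']] z by (simp add: Suc R.Tor_cycles)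
    finally show ?thesis .
  qed
  have "push ?\<psi>\<phi> z - (z + push (\<lambda>x. ?dh x + ?k x) z) \<in> R.T p"
    unfolding 2 using 3 by (simp only: R.push_id)
  from R.T_diff[OF R.T_add[OF R.T_add[OF this 4] 5] conjunct2[OF 1]]
  have "from_delta p (to_delta \<phi> p z) - z - push (d (Suc p)) (push (h p) z) \<in> R.T p"
    by (simp add: push_push algebra_simps)
  then show ?thesis
    by (intro R.Tor_boundaryI[OF R.push_C[OF linear_map_onD(1)[OF h(1)] zC]])
qed

text \<open>
  Here \<open>\<phi> \<psi>\<close> is homotopic to the identity of the Taylor complex.
\<close>

lemma to_delta_from_delta:
  assumes v: "v \<in> cycles Delta p"
  shows "to_delta \<phi> p (from_delta p v) - v \<in> boundaries Delta p"
proof -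
  have vD: "v \<in> subset_module m p" and dv: "delta_diff E Q v = 0" using v by (simp_all add: Delta_cycles)
  let ?y = "const_lift v :: nat set \<Rightarrow>\<^sub>0 ('x, 'k) mpol"
  have y: "?y \<in> subset_module m p" by (rule const_lift_in[OF vD])
  let ?L = "\<lambda>v. \<phi> p (\<psi> p v)"
  have L: "linear_map_on pm_scale pm_scale (subset_module m p) (subset_module m p) ?L"
    by (rule linear_map_on_compose[OF linear_\<psi> linear_\<phi>])
  have "to_delta \<phi> p (from_delta p v) = on_basis (\<lambda>\<sigma>. const_reduce (?L (Poly_Mapping.single \<sigma> 1))) v"
    by (simp add: from_delta_def to_delta_sum on_basis_def)
  also have "\<dots> = const_reduce (?L ?y)" using const_reduce_linear[OF L y] by simp
  finally have 1: "to_delta \<phi> p (from_delta p v) = const_reduce (?L ?y)" .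
  obtain h where h: "\<And>p. linear_map_on pm_scale pm_scale (subset_module m p) (subset_module m (Suc p)) (h p)"
    "\<And>p y. y \<in> subset_module m p \<Longrightarrow>
      \<phi> p (\<psi> p y) - y = taylor_diff E Q (h p y) + (if p = 0 then 0 else h (p - 1) (taylor_diff E Q y))"
    by (rule comparison_homotopy_uniform[OF K.resolution_axioms K.resolution_axioms
      comparison_map_compose[OF \<psi> \<phi>] comparison_map_id]) blast
  have hy: "h p ?y \<in> subset_module m (Suc p)" by (rule linear_map_onD(1)[OF h(1) y])
  have "const_reduce (if p = 0 then 0 else h (p - 1) (taylor_diff E Q ?y)) = 0"
    using const_reduce_linear[OF h(1) taylor_diff_in[OF y]] dv by (simp add: delta_diff_conv[OF vD])
  then have "const_reduce (?L ?y - ?y) = delta_diff E Q (const_reduce (h p ?y))"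
    unfolding h(2)[OF y] by (simp add: const_reduce_add const_reduce_taylor_diff[OF hy]) (simp add: delta_diff_eq)
  then have "to_delta \<phi> p (from_delta p v) - v = delta_diff E Q (const_reduce (h p ?y))"
    by (simp add: 1 const_reduce_diff)
  then show ?thesis using subset_module_const_reduce[OF hy] unfolding Delta_boundaries by blast
qed

lemma tmult_sum: "R.tmult p q (sum f A) w = (\<Sum>a\<in>A. R.tmult p q (f a) w)"
  "R.tmult p q z (sum g A) = (\<Sum>a\<in>A. R.tmult p q z (g a))"
proof -
  have l: "R.tmult p q (z + z') w = R.tmult p q z w + R.tmult p q z' w" for z z' w
    using R.tmult_diff_left[of p q "z + z'" z' w] by (simp add: algebra_simps)
  have r: "R.tmult p q z (w + w') = R.tmult p q z w + R.tmult p q z w'" for z w w'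
    using R.tmult_diff_right[of p q z "w + w'" w'] by (simp add: algebra_simps)
  show "R.tmult p q (sum f A) w = (\<Sum>a\<in>A. R.tmult p q (f a) w)"
    by (induction A rule: infinite_finite_induct) (simp_all add: l)
  show "R.tmult p q z (sum g A) = (\<Sum>a\<in>A. R.tmult p q z (g a))"
    by (induction A rule: infinite_finite_induct) (simp_all add: r)
qed

text \<open>
  Both sides are bilinear, so it is enough to compare them on basis elements. There the product of Tor is
  that of \<open>\<psi> \<sigma> \<otimes> 1\<close> and \<open>\<psi> \<tau> \<otimes> 1\<close>, which \<open>\<phi>\<close> sends to the transported product.
\<close>

lemma to_delta_tmult_from_delta:
  assumes v: "v \<in> subset_module m p" and w: "w \<in> subset_module m q"
  shows "to_delta \<phi> (p + q) (R.tmult p q (from_delta p v) (from_delta q w)) =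
    bilin (\<lambda>\<sigma> \<tau>. const_reduce (transported_basis \<sigma> \<tau>)) v w"
proof -
  let ?\<psi> = "\<lambda>p \<sigma>. \<psi> p (Poly_Mapping.single \<sigma> 1)"
  have "to_delta \<phi> (p + q) (R.tmult p q (from_delta p v) (from_delta q w)) =
    (\<Sum>\<sigma>\<in>keys v. \<Sum>\<tau>\<in>keys w. pm_scale (lookup v \<sigma> * lookup w \<tau>)
      (const_reduce (\<phi> (p + q) (\<mu> p q (?\<psi> p \<sigma>) (?\<psi> q \<tau>)))))"
    unfolding from_delta_def tmult_sum(1)
    unfolding tmult_sum(2) to_delta_sum R.tmult_of to_delta_of ..
  also have "\<dots> = bilin (\<lambda>\<sigma> \<tau>. const_reduce (\<phi> (p + q) (\<mu> p q (?\<psi> p \<sigma>) (?\<psi> q \<tau>)))) v w"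
    by (simp add: bilin_def on_basis_def pm.scale_sum_right)
  also have "\<dots> = bilin (\<lambda>\<sigma> \<tau>. const_reduce (transported_basis \<sigma> \<tau>)) v w"
    by (rule bilin_cong_subsets[OF v w]) (simp add: transported_basis_def transported_def)
  finally show ?thesis .
qed

text \<open>
  The homotopy \<open>H\<close> between the two multiplications contributes \<open>d H(v, w)\<close>, a boundary, and terms
  \<open>H(d v, w)\<close> and \<open>H(v, d w)\<close>. The latter vanish modulo the variables, because \<open>v\<close> and \<open>w\<close> are cycles there.
\<close>

lemma bilin_transported:
  assumes v: "v \<in> cycles Delta p" and w: "w \<in> cycles Delta q"
  shows "bilin (\<lambda>\<sigma> \<tau>. const_reduce (transported_basis \<sigma> \<tau>)) v w - delta_mult v w \<in> boundaries Delta (p + q)"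
proof -
  have vD: "v \<in> subset_module m p" "delta_diff E Q v = 0" and wD: "w \<in> subset_module m q" "delta_diff E Q w = 0"
    using v w by (simp_all add: Delta_cycles)
  let ?v = "const_lift v :: nat set \<Rightarrow>\<^sub>0 ('x, 'k) mpol" and ?w = "const_lift w :: nat set \<Rightarrow>\<^sub>0 ('x, 'k) mpol"
  note v' = const_lift_in[OF vD(1)] and w' = const_lift_in[OF wD(1)]
  from transported_homotopy obtain H where
    ex: "\<forall>\<sigma> \<tau>. \<sigma> \<subseteq> {1..m} \<longrightarrow> \<tau> \<subseteq> {1..m} \<longrightarrow>
      H \<sigma> \<tau> \<in> subset_module m (Suc (card \<sigma> + card \<tau>)) \<and>
      transported_basis \<sigma> \<tau> = taylor_mult \<sigma> \<tau> + (on_basis taylor_face (H \<sigma> \<tau>) + bilin_diff H \<sigma> \<tau>)"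
    by (elim exE)
  have H: "H \<sigma> \<tau> \<in> subset_module m (Suc (card \<sigma> + card \<tau>))"
    "transported_basis \<sigma> \<tau> = taylor_mult \<sigma> \<tau> + (on_basis taylor_face (H \<sigma> \<tau>) + bilin_diff H \<sigma> \<tau>)"
    if "\<sigma> \<subseteq> {1..m}" "\<tau> \<subseteq> {1..m}" for \<sigma> \<tau>
    by (rule ex[rule_format, OF that, THEN conjunct1] ex[rule_format, OF that, THEN conjunct2])+
  have Hin: "bilin H ?v ?w \<in> subset_module m (Suc (p + q))"
  proof (rule bilin_in)
    fix \<sigma> \<tau> assume "\<sigma> \<in> keys ?v" "\<tau> \<in> keys ?w"
    from subset_module_keys[OF v' this(1)] subset_module_keys[OF w' this(2)] H(1)[of \<sigma> \<tau>]
    show "H \<sigma> \<tau> \<in> subset_module m (Suc (p + q))" by simp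
  qed
  have "bilin transported_basis ?v ?w =
      bilin (\<lambda>\<sigma> \<tau>. taylor_mult \<sigma> \<tau> + (on_basis taylor_face (H \<sigma> \<tau>) + bilin_diff H \<sigma> \<tau>)) ?v ?w"
    by (rule bilin_cong_subsets[OF v' w']) (rule H(2))
  also have "\<dots> = bilin taylor_mult ?v ?w + (taylor_diff E Q (bilin H ?v ?w) +
      (bilin H (taylor_diff E Q ?v) ?w + pm_scale ((- 1) ^ p) (bilin H ?v (taylor_diff E Q ?w))))"
    unfolding bilin_fun_add bilin_bilin_diff[OF v'] by (simp add: bilin_on_basis taylor_diff_eq)
  finally have eq: "bilin transported_basis ?v ?w = \<dots>" .
  have "const_reduce (bilin H (taylor_diff E Q ?v) ?w) = 0" "const_reduce (bilin H ?v (taylor_diff E Q ?w)) = 0"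
    using vD wD by (simp_all add: const_reduce_bilin delta_diff_conv)
  then have "const_reduce (bilin transported_basis ?v ?w) =
      delta_mult v w + delta_diff E Q (const_reduce (bilin H ?v ?w))"
    unfolding eq using const_reduce_taylor_mult_bilin[OF v' w'] const_reduce_taylor_diff[OF Hin]
    by (simp add: const_reduce_add const_reduce_scale delta_diff_eq)
  then have "bilin (\<lambda>\<sigma> \<tau>. const_reduce (transported_basis \<sigma> \<tau>)) v w - delta_mult v w =
      delta_diff E Q (const_reduce (bilin H ?v ?w))"
    by (simp add: const_reduce_bilin)
  then show ?thesis using subset_module_const_reduce[OF Hin] unfolding Delta_boundaries by blast
qed

text \<open>
  Cycles of \<open>F \<otimes> k\<close> may be replaced by homologous ones in the image of \<open>from_delta\<close>, where the product is
  known.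
\<close>

lemma to_delta_mult:
  assumes z: "z \<in> cycles R.Tor p" and w: "w \<in> cycles R.Tor q"
  shows "to_delta \<phi> (p + q) (mult R.Tor p q z w) - mult Delta p q (to_delta \<phi> p z) (to_delta \<phi> q w)
    \<in> boundaries Delta (p + q)"
proof -
  let ?z = "to_delta \<phi> p z" and ?w = "to_delta \<phi> q w"
  note zY = to_delta_cycles[OF z] and wY = to_delta_cycles[OF w]
  have "mult R.Tor p q (from_delta p ?z) (from_delta q ?w) - mult R.Tor p q z w \<in> boundaries R.Tor (p + q)"
    by (rule X.mult_cong[OF z from_delta_to_delta[OF z] w from_delta_to_delta[OF w]])
  from Y.boundaries_minus[OF to_delta_boundaries[OF this]]
  have "to_delta \<phi> (p + q) (mult R.Tor p q z w) -
      to_delta \<phi> (p + q) (R.tmult p q (from_delta p ?z) (from_delta q ?w)) \<in> boundaries Delta (p + q)"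
    by (simp add: to_delta_diff R.Tor_simps)
  moreover have "to_delta \<phi> (p + q) (R.tmult p q (from_delta p ?z) (from_delta q ?w)) - delta_mult ?z ?w
      \<in> boundaries Delta (p + q)"
    using to_delta_tmult_from_delta[of ?z p ?w q] bilin_transported[OF zY wY] zY wY by (simp add: Delta_cycles)
  ultimately show ?thesis using Y.boundaries_add by (fastforce simp: Delta_simps)
qed

theorem Tor_iso_Delta:
  "\<exists>h. homology_algebra_iso R.Tor Delta h \<and>
    (\<forall>p. \<forall>z\<in>cycles R.Tor p. h p (hclass R.Tor p z) = hclass Delta p (to_delta \<phi> p z))"
proof (rule homology_algebra_iso_induced[OF X.chain_algebra_axioms Y.chain_algebra_axioms])
  show "to_delta \<phi> p (z - w) = to_delta \<phi> p z - to_delta \<phi> p w" for p z w by (rule to_delta_diff)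
  show "to_delta \<phi> p (scal R.Tor c z) - scal Delta c (to_delta \<phi> p z) \<in> boundaries Delta p" for p c z
    using Y.boundaries_0 by (simp add: R.Tor_simps Delta_simps to_delta_tscal)
  show "to_delta \<phi> 0 (unit R.Tor) - unit Delta \<in> boundaries Delta 0"
    using Y.boundaries_0 by (simp add: to_delta_unit)
  show "z \<in> boundaries R.Tor p" if "z \<in> cycles R.Tor p" "to_delta \<phi> p z \<in> boundaries Delta p" for p z
    using X.boundaries_diff[OF from_delta_boundaries[OF that(2)] from_delta_to_delta[OF that(1)]] by simp
  show "\<exists>z\<in>cycles R.Tor p. to_delta \<phi> p z - w \<in> boundaries Delta p" if "w \<in> cycles Delta p" for p w
    using to_delta_from_delta[OF that] from_delta_cycles[OF that] by blast
qed (fact to_delta_cycles to_delta_boundaries to_delta_mult)+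

end

theorem theorem3p2:
  fixes Q :: "nat \<Rightarrow> ('x::{finite,linorder}, 'k::field) mpol" and m :: nat
    and E I :: "('x, 'k) mpol set"
    and s :: "('x, 'k) mpol \<Rightarrow> 'm::ab_group_add \<Rightarrow> 'm"
    and F :: "nat \<Rightarrow> 'm set" and d :: "nat \<Rightarrow> 'm \<Rightarrow> 'm"
    and \<epsilon> :: "'m \<Rightarrow> ('x, 'k) mpol set"
    and \<mu> :: "nat \<Rightarrow> nat \<Rightarrow> 'm \<Rightarrow> 'm \<Rightarrow> 'm"
  assumes "\<And>i. i \<in> {1..m} \<Longrightarrow> homogeneous (Q i) \<and> \<not> constant_poly (Q i)"
    and "inj_on Q {1..m}"
    and "I = ideal_gen (Q ` {1..m})"
    and "\<And>B. B \<subset> Q ` {1..m} \<Longrightarrow> ideal_gen B \<noteq> I"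
    and "factor_representatives (Q ` {1..m}) E"
    and "taylor_is_resolution E Q m I"
    and "free_resolution s F d \<epsilon> I"
    and "lifts_multiplication s F d \<epsilon> I \<mu>"
  shows "\<exists>h. homology_algebra_iso (tor_dga s F d \<epsilon> I \<mu>) (delta_dga E Q m) h
           \<and> canonical_map s F d \<epsilon> I \<mu> E Q m h"
proof -
  interpret taylor_resolution Q m E I
    by unfold_locales (use assms in auto)
  interpret F: resolution s F d \<epsilon> I
    by unfold_locales (use assms(7) ideal_I in auto)
  obtain \<phi> where \<phi>: "comparison_map s F d \<epsilon> pm_scale (subset_module m) (\<lambda>_. taylor_diff E Q) (taylor_aug I) \<phi>"
    using comparison_map_exists[OF F.resolution_axioms K.resolution_axioms] by blast
  obtain \<psi> where \<psi>: "comparison_map pm_scale (subset_module m) (\<lambda>_. taylor_diff E Q) (taylor_aug I) s F d \<epsilon> \<psi>"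
    using comparison_map_exists[OF K.resolution_axioms F.resolution_axioms] by blast
  interpret taylor_comparison Q m E I s F d \<epsilon> \<mu> \<phi> \<psi>
    by unfold_locales (use assms(8) \<phi> \<psi> in auto)
  \<comment> \<open>The isomorphism is constructed from \<open>\<phi>\<close>; any other comparison map is homotopic to \<open>\<phi>\<close>.\<close>
  obtain h where h: "homology_algebra_iso R.Tor Delta h"
    "\<And>p z. z \<in> cycles R.Tor p \<Longrightarrow> h p (hclass R.Tor p z) = hclass Delta p (to_delta \<phi> p z)"
    using Tor_iso_Delta by blast
  have "h p (hclass R.Tor p z) = hclass Delta p (to_delta \<phi>' p z)"
    if "comparison_map s F d \<epsilon> pm_scale (subset_module m) (\<lambda>_. taylor_diff E Q) (taylor_aug I) \<phi>'"
      "z \<in> cycles R.Tor p" for \<phi>' p z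
    using h(2)[OF that(2)] to_delta_comparison_unique[OF that] by (simp add: Y.hclass_eq_iff)
  then have "canonical_map s F d \<epsilon> I \<mu> E Q m h"
    unfolding canonical_map_def Let_def using \<phi> by blast
  with h(1) show ?thesis by blast
qed

end
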